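(* (i) Let $E\in\mathfrak E_n(\mathbb D)$. Then there exists a sequence $(F_k)_{k\in\mathbb N}$ from $H_n^\infty(\mathbb D)$ with the following properties: $(\alpha)$ For $m$-almost all $t\in\mathbb T$, $\lim_{k\to\infty}\underline E(t)\cdot\underline{F_k}(t)=I_n$. $(\beta)$ The family $(\ln^+\|\underline{F_k}\|)_{k\in\mathbb N}$ is uniformly integrable with respect to $m$. $(\gamma)$ There exists a Borel subset $B_0$ of $\mathbb T$ with $m(B_0)=0$ such that for all $k\in\mathbb N$ and all $t\in\mathbb T\setminus B_0$ the inequality $\|\underline E(t)\cdot\underline{F_k}(t)\|\le1$ holds. (ii) Let $E\in\mathfrak N_n^+(\mathbb D)$ be such that there exists a sequence $(F_k)_{k\in\mathbb N}$ in $H_n^\infty(\mathbb D)$ satisfying conditions $(\alpha)$ and $(\beta)$. Then $E\in\mathfrak E_n(\mathbb D)$.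
   Context: $\mathbb D$ is the open unit disc, $\mathbb T$ the unit circle, $m$ normalized Lebesgue measure on $\mathbb T$, $\mathfrak M_n$ the complex $n\times n$ matrices with the operator norm induced by the Euclidean norm. Uniform integrability: a family $(f_\alpha)$ in $L^1(m)$ is uniformly integrable if $\sup_\alpha\int|f_\alpha|\,dm<\infty$ and for every $\epsilon>0$ there is $\delta>0$ such that $\int_\Delta|f_\alpha|\,dm<\epsilon$ for all $\alpha$ and all Borel $\Delta\subseteq\mathbb T$ with $m(\Delta)<\delta$. Smirnov class: $\mathfrak N_n^+(\mathbb D)$ is the set of holomorphic $F:\mathbb D\to\mathfrak M_n$ for which the family $t\mapsto\ln^+\|F(rt)\|$, $r\in[0,1)$, is uniformly integrable with respect to $m$. Such $F$ has radial boundary values $\underline F(t)=\lim_{r\to1-0}F(rt)$ for $m$-a.e. $t$. $H_n^\infty(\mathbb D)$ is the set of bounded holomorphic functions $\mathbb D\to\mathfrak M_n$. Outer: a scalar function $e:\mathbb D\to\mathbb C$ is outer if $e(z)=C\exp\{\int_{\mathbb T}\frac{t+z}{t-z}\ln[w(t)]\,m(dt)\}$ with $|C|=1$ and $w:\mathbb T\to[0,\infty)$ such that $\ln w$ is $m$-integrable. $\mathfrak E_n(\mathbb D)$ is the set of $E\in\mathfrak N_n^+(\mathbb D)$ with $\det E$ outer. *)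

theory Defs
  imports "HOL-Complex_Analysis.Complex_Analysis" "HOL-Probability.Probability"
begin

abbreviation unit_disc :: "complex set" where
  "unit_disc \<equiv> ball 0 1"

abbreviation unit_circle :: "complex set" where
  "unit_circle \<equiv> sphere 0 1"

text \<open>The underlying space of the measure is the circle itself, so its measurable sets
  are exactly the Borel subsets of the circle.\<close>

definition circle_measure :: "complex measure" where
  "circle_measure =
     distr (uniform_measure lborel {0..2 * pi}) (restrict_space borel unit_circle) cis"

lemma space_circle_measure [simp]: "space circle_measure = unit_circle"
  by (simp add: circle_measure_def space_restrict_space)

lemma sets_circle_measure: "sets circle_measure = sets (restrict_space borel unit_circle)"
  by (simp add: circle_measure_def)

lemma prob_space_circle_measure: "prob_space circle_measure"
proof -
  have "cis \<in> borel_measurable borel"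
    by (intro borel_measurable_continuous_onI continuous_intros)
  then have "cis \<in> uniform_measure lborel {0..2 * pi} \<rightarrow>\<^sub>M restrict_space borel unit_circle"
    by (auto intro!: measurable_restrict_space2)
  moreover have "prob_space (uniform_measure lborel {0..2 * pi})"
    by (rule prob_space_uniform_measure) auto
  ultimately show ?thesis
    unfolding circle_measure_def by (rule prob_space.prob_space_distr[rotated])
qed

definition opnorm :: "complex^'n^'n \<Rightarrow> real" where
  "opnorm A = onorm (\<lambda>x. A *v x)"

text \<open>The form \<open>ln (max 1 x)\<close> gives the value \<open>0\<close> at \<open>x = 0\<close>.\<close>

definition ln_plus :: "real \<Rightarrow> real" where
  "ln_plus x = ln (max 1 x)"

definition uniformly_integrable :: "'i set \<Rightarrow> ('i \<Rightarrow> complex \<Rightarrow> real) \<Rightarrow> bool" where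
  "uniformly_integrable I f \<longleftrightarrow>
     (\<forall>i\<in>I. integrable circle_measure (f i)) \<and>
     (\<exists>C. \<forall>i\<in>I. (LINT t|circle_measure. \<bar>f i t\<bar>) \<le> C) \<and>
     (\<forall>\<epsilon>>0. \<exists>\<delta>>0. \<forall>i\<in>I. \<forall>\<Delta>\<in>sets circle_measure.
        measure circle_measure \<Delta> < \<delta> \<longrightarrow> (LINT t:\<Delta>|circle_measure. \<bar>f i t\<bar>) < \<epsilon>)"

definition matrix_holomorphic :: "(complex \<Rightarrow> complex^'n^'n) \<Rightarrow> bool" where
  "matrix_holomorphic F \<longleftrightarrow> (\<forall>i j. (\<lambda>z. F z $ i $ j) holomorphic_on unit_disc)"

definition smirnov_class :: "(complex \<Rightarrow> complex^'n^'n) set" where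
  "smirnov_class = {F. matrix_holomorphic F \<and>
     uniformly_integrable {0..<1} (\<lambda>r t. ln_plus (opnorm (F (complex_of_real r * t))))}"

definition H_infinity :: "(complex \<Rightarrow> complex^'n^'n) set" where
  "H_infinity = {F. matrix_holomorphic F \<and> (\<exists>M. \<forall>z\<in>unit_disc. opnorm (F z) \<le> M)}"

text \<open>At points where the radial limit does not exist, \<open>Lim\<close> has one fixed unspecified
  value, the same for all such points.\<close>

definition boundary_value :: "(complex \<Rightarrow> complex^'n^'n) \<Rightarrow> complex \<Rightarrow> complex^'n^'n" where
  "boundary_value F t = Lim (at_left 1) (\<lambda>r. F (complex_of_real r * t))"

text \<open>Integrability of \<open>ln w\<close> in the extended-real sense forces \<open>w > 0\<close> almost everywhere;
  this is explicit below because \<open>ln\<close> is finite at \<open>0\<close> in HOL.\<close>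

definition outer :: "(complex \<Rightarrow> complex) \<Rightarrow> bool" where
  "outer e \<longleftrightarrow> (\<exists>(C::complex) (w::complex \<Rightarrow> real).
     norm C = 1 \<and>
     w \<in> borel_measurable circle_measure \<and>
     (\<forall>t\<in>unit_circle. 0 \<le> w t) \<and>
     (AE t in circle_measure. 0 < w t) \<and>
     integrable circle_measure (\<lambda>t. ln (w t)) \<and>
     (\<forall>z\<in>unit_disc. e z =
        C * exp (LINT t|circle_measure. (t + z) / (t - z) * complex_of_real (ln (w t)))))"

definition outer_class :: "(complex \<Rightarrow> complex^'n^'n) set" where
  "outer_class = {E \<in> smirnov_class. outer (\<lambda>z. det (E z))}"

definition cond_alpha ::
  "(complex \<Rightarrow> complex^'n^'n) \<Rightarrow> (nat \<Rightarrow> complex \<Rightarrow> complex^'n^'n) \<Rightarrow> bool" where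
  "cond_alpha E F \<longleftrightarrow> (AE t in circle_measure.
     (\<lambda>k. boundary_value E t ** boundary_value (F k) t) \<longlonglongrightarrow> mat 1)"

definition cond_beta :: "(nat \<Rightarrow> complex \<Rightarrow> complex^'n^'n) \<Rightarrow> bool" where
  "cond_beta F \<longleftrightarrow>
     uniformly_integrable UNIV (\<lambda>k t. ln_plus (opnorm (boundary_value (F k) t)))"

definition cond_gamma ::
  "(complex \<Rightarrow> complex^'n^'n) \<Rightarrow> (nat \<Rightarrow> complex \<Rightarrow> complex^'n^'n) \<Rightarrow> bool" where
  "cond_gamma E F \<longleftrightarrow> (\<exists>B\<in>null_sets circle_measure. \<forall>k. \<forall>t\<in>unit_circle - B.
     opnorm (boundary_value E t ** boundary_value (F k) t) \<le> 1)"

end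

theory Submission imports Defs begin

text \<open>
  Everything is reduced to scalar functions \<open>f\<close> of the Smirnov class. Such an \<open>f\<close> is a quotient of
  bounded holomorphic functions, so Fatou's theorem gives radial limits \<open>f*\<close>, and uniform
  integrability turns the sub-mean value inequality on smaller circles into
  \<open>ln |f(z)| \<le> P[ln |f*|](z)\<close> for the Poisson integral \<open>P\<close>.

  (i) If \<open>det E\<close> is outer, then \<open>ln |1 / det E|\<close> is a Poisson integral, so
  \<open>|E\<^sup>-\<^sup>1| \<le> exp P[h]\<close> with an integrable \<open>h\<close>. The outer function \<open>\<phi>\<^sub>k\<close> with modulus
  \<open>exp (- max 0 (h - k))\<close> makes \<open>F\<^sub>k = \<phi>\<^sub>k E\<^sup>-\<^sup>1\<close> bounded by \<open>exp k\<close>, and \<open>E F\<^sub>k = \<phi>\<^sub>k I\<close>, where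
  \<open>|\<phi>\<^sub>k| \<le> 1\<close> and \<open>\<phi>\<^sub>k \<rightarrow> 1\<close> on the circle along a subsequence because \<open>\<phi>\<^sub>k(0) \<rightarrow> 1\<close>.

  (ii) With \<open>e = det E\<close> and \<open>d\<^sub>k = det F\<^sub>k\<close> the products \<open>e d\<^sub>k\<close> tend to \<open>1\<close> on the circle and, by uniform
  integrability, also at \<open>0\<close>. Passing to the limit in \<open>ln |d\<^sub>k(0)| \<le> \<integral> ln |d\<^sub>k*|\<close> gives
  \<open>ln |e(0)| \<ge> \<integral> ln |e*|\<close>, and equality in the inequality above forces \<open>e\<close> to be outer.
\<close>

section \<open>The Poisson kernel\<close>

text \<open>Uniform integrability controls \<open>ln_plus |f|\<close> only, whereas
  \<open>ln |f|\<close> is unbounded below near zeros of \<open>f\<close>. Limits are therefore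
  taken for \<open>ln (max \<epsilon> |f|)\<close>, which is dominated by
  \<open>ln_plus |f| + |ln \<epsilon>|\<close>, and \<epsilon> is sent to 0 afterwards. That last
  step needs a lower bound for the means of the logarithm, and the value
  \<open>f 0 \<noteq> 0\<close> supplies it. Bounded means of \<open>ln_plus |f(r t)|\<close> alone
  would not do: for \<open>exp ((1 + z) / (1 - z))\<close> they are bounded and the boundary values
  have modulus 1 almost everywhere, yet the function is unbounded. Mass of the logarithm escapes to
  the point 1, and uniform integrability forbids this. Radial limits come from a single source,
  Fatou's theorem for bounded holomorphic functions. Accordingly the boundary behaviour of the outer
  factors is extracted from their bound 1 and their value at 0, and the majorant for (\<beta>) in
  part (i) is built from the boundary values of \<open>det E\<close> themselves.\<close>

abbreviation \<mu> :: "complex measure" where "\<mu> \<equiv> circle_measure"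

interpretation circle: prob_space \<mu>
  by (rule prob_space_circle_measure)

lemma measure_unit_circle [simp]: "measure \<mu> unit_circle = 1"
  using circle.prob_space by simp

section \<open>Integration over the circle and over the angle\<close>

lemma borel_measurable_circleI:
  fixes f :: "complex \<Rightarrow> 'a::topological_space"
  assumes "continuous_on unit_circle f"
  shows "f \<in> borel_measurable \<mu>"
proof -
  have "f \<in> borel_measurable (restrict_space borel unit_circle)"
    by (rule borel_measurable_continuous_on_restrict[OF assms])
  moreover have "sets \<mu> = sets (restrict_space borel unit_circle)"
    by (rule sets_circle_measure)
  ultimately show ?thesis
    by (metis measurable_cong_sets)
qed

lemma integrable_circleI:
  fixes f :: "complex \<Rightarrow> 'a::{banach,second_countable_topology}"
  assumes "continuous_on unit_circle f"
  shows "integrable \<mu> f"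
proof -
  have "compact (f ` unit_circle)"
    by (intro compact_continuous_image assms compact_sphere)
  then obtain B where "\<And>t. t \<in> unit_circle \<Longrightarrow> norm (f t) \<le> B"
    using compact_imp_bounded bounded_iff by (metis imageI)
  then show ?thesis
    using borel_measurable_circleI[OF assms]
    by (intro circle.integrable_const_bound[where B = B]) auto
qed

lemma measurable_cis [measurable]: "cis \<in> uniform_measure lborel {0..2*pi} \<rightarrow>\<^sub>M restrict_space borel unit_circle"
proof -
  have "cis \<in> borel_measurable borel"
    by (intro borel_measurable_continuous_onI continuous_intros)
  then show ?thesis
    by (auto intro!: measurable_restrict_space2)
qed

text \<open>Lebesgue differentiation takes place on the real line, so Fatou's theorem is proved for
  almost every angle and carried back to the circle. The transfer through the image measure asks for
  a measurable set; for radial limits \<open>sets_ex_radial_limit\<close> provides it.\<close>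

lemma AE_circle_iff:
  assumes "{t \<in> unit_circle. Q t} \<in> sets \<mu>"
  shows "(AE t in \<mu>. Q t) \<longleftrightarrow> (AE x in lborel. x \<in> {0..2*pi} \<longrightarrow> Q (cis x))"
proof -
  have "(AE t in \<mu>. Q t) \<longleftrightarrow> (AE x in uniform_measure lborel {0..2*pi}. Q (cis x))"
    unfolding circle_measure_def
    by (subst AE_distr_iff) (use assms in \<open>auto simp: space_restrict_space sets_circle_measure\<close>)
  also have "\<dots> \<longleftrightarrow> (AE x in lborel. x \<in> {0..2*pi} \<longrightarrow> Q (cis x))"
    by (subst AE_uniform_measure) auto
  finally show ?thesis .
qed

text \<open>The parameter runs over \<open>{0..1}\<close> because \<open>circlepath\<close> does,
  which prepares the passage to contour integrals.\<close>

lemma integral_circle: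
  fixes f :: "complex \<Rightarrow> 'a::euclidean_space"
  assumes "continuous_on unit_circle f"
  shows "(LINT t|\<mu>. f t) = integral {0..1} (\<lambda>x. f (cis (2 * pi * x)))"
proof -
  have m: "f \<in> borel_measurable (restrict_space borel unit_circle)"
    by (rule borel_measurable_continuous_on_restrict[OF assms])
  have c: "continuous_on S (\<lambda>x. f (cis x))" for S
    by (rule continuous_on_compose2[OF assms]) (auto intro!: continuous_intros)
  have [measurable]: "(\<lambda>x. f (cis x)) \<in> borel_measurable borel"
    by (intro borel_measurable_continuous_onI c)
  have "(LINT t|\<mu>. f t) = (LINT x|uniform_measure lborel {0..2*pi}. f (cis x))"
    unfolding circle_measure_def by (subst integral_distr[OF measurable_cis m]) auto
  also have "uniform_measure lborel {0..2*pi} = density lborel (\<lambda>x. ennreal (indicator {0..2*pi} x / (2*pi)))"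
    unfolding uniform_measure_def
    using divide_ennreal[of 1 "2*pi"]
    by (intro density_cong) (auto split: split_indicator)
  also have "(LINT x|\<dots>. f (cis x)) = (LINT x:{0..2*pi}|lborel. f (cis x)) /\<^sub>R (2*pi)"
  proof -
    have "(LINT x|density lborel (\<lambda>x. ennreal (indicator {0..2*pi} x / (2*pi))). f (cis x))
        = (LINT x|lborel. (indicator {0..2*pi} x / (2*pi)) *\<^sub>R f (cis x))"
    proof (rule integral_density)
      show "(\<lambda>x. f (cis x)) \<in> borel_measurable lborel"
        by measurable
      show "(\<lambda>x. indicat_real {0..2*pi} x / (2*pi)) \<in> borel_measurable lborel"
        by measurable
      show "AE x in lborel. 0 \<le> indicat_real {0..2*pi} x / (2*pi)"
        by (rule AE_I2) (simp add: indicator_def)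
    qed
    also have "\<dots> = (LINT x|lborel. inverse (2*pi) *\<^sub>R (indicator {0..2*pi} x *\<^sub>R f (cis x)))"
      by (simp only: divide_inverse scaleR_scaleR mult.commute)
    also have "\<dots> = inverse (2*pi) *\<^sub>R (LINT x|lborel. indicator {0..2*pi} x *\<^sub>R f (cis x))"
      by (rule integral_scaleR_right)
    finally show ?thesis
      by (simp only: set_lebesgue_integral_def)
  qed
  also have "(LINT x:{0..2*pi}|lborel. f (cis x)) = integral {0..2*pi} (\<lambda>x. f (cis x))"
    by (rule set_borel_integral_eq_integral(2)[OF borel_integrable_atLeastAtMost']) (rule c)
  also have "integral {0..2*pi} (\<lambda>x. f (cis x)) /\<^sub>R (2*pi) = integral {0..1} (\<lambda>x. f (cis (2 * pi * x)))"
  proof -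
    have "((\<lambda>x. f (cis x)) has_integral integral {0..2*pi} (\<lambda>x. f (cis x))) {0..2*pi}"
      by (intro integrable_integral integrable_continuous_real c)
    from has_integral_stretch_real[OF this, of "2*pi"]
    have "((\<lambda>x. f (cis (2 * pi * x))) has_integral integral {0..2*pi} (\<lambda>x. f (cis x)) /\<^sub>R (2*pi)) {0..1}"
      using inverse_eq_divide[of "2*pi"] by (simp add: image_divide_atLeastAtMost)
    then show ?thesis
      by (rule integral_unique[symmetric])
  qed
  finally show ?thesis .
qed

text \<open>On the circle \<open>dt = \<i> t d\<theta>\<close>, whence the division by
  \<open>t\<close>. The formula makes the contour form of Cauchy's theorems available for
  \<mu>.\<close>

lemma integral_circle_contour:
  assumes "continuous_on unit_circle f"
  shows "(LINT t|\<mu>. f t) = contour_integral (circlepath 0 1) (\<lambda>t. f t / t) / (2 * of_real pi * \<i>)"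
proof -
  have c: "circlepath 0 1 x = cis (2 * pi * x)" for x
    by (simp add: circlepath cis_conv_exp mult_ac)
  have "contour_integral (circlepath 0 1) (\<lambda>t. f t / t)
      = integral {0..1} (\<lambda>x. f (circlepath 0 1 x) / circlepath 0 1 x *
           vector_derivative (circlepath 0 1) (at x))"
    by (rule contour_integral_integral)
  also have "\<dots> = integral {0..1} (\<lambda>x. (2 * of_real pi * \<i>) * f (cis (2 * pi * x)))"
    unfolding vector_derivative_circlepath c
    by (intro Henstock_Kurzweil_Integration.integral_cong)
       (simp add: cis_conv_exp mult_ac)
  also have "\<dots> = (2 * of_real pi * \<i>) * integral {0..1} (\<lambda>x. f (cis (2 * pi * x)))"
    by (rule integral_mult_right)
  finally show ?thesis
    by (simp add: integral_circle[OF assms])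
qed

section \<open>Cauchy's formulas as integrals over the circle\<close>

lemma circle_diff_ge:
  assumes "t \<in> unit_circle"
  shows "1 - norm z \<le> norm (t - z)"
  using assms norm_triangle_ineq2[of t z] by simp

lemma circle_neq_disc: "t \<in> unit_circle \<Longrightarrow> z \<in> unit_disc \<Longrightarrow> t \<noteq> z"
  by auto

lemma cauchy_circle:
  assumes "continuous_on (cball 0 1) f" "f holomorphic_on unit_disc" "z \<in> unit_disc"
  shows "(LINT t|\<mu>. f t * (t / (t - z))) = f z"
proof -
  have cf: "continuous_on unit_circle f"
    using assms(1) continuous_on_subset by fastforce
  have "(LINT t|\<mu>. f t * (t / (t - z))) =
      contour_integral (circlepath 0 1) (\<lambda>t. f t * (t / (t - z)) / t) / (2 * of_real pi * \<i>)"
    by (rule integral_circle_contour)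
       (use assms in \<open>auto intro!: continuous_intros cf dest: circle_neq_disc\<close>)
  also have "contour_integral (circlepath 0 1) (\<lambda>t. f t * (t / (t - z)) / t)
       = contour_integral (circlepath 0 1) (\<lambda>t. f t / (t - z))"
    by (rule contour_integral_cong) auto
  also have "\<dots> = 2 * of_real pi * \<i> * f z"
    by (rule contour_integral_unique[OF Cauchy_integral_circlepath[OF assms(1,2)]]) (use assms in auto)
  finally show ?thesis by simp
qed

lemma mean_value_circle:
  assumes "continuous_on (cball 0 1) f" "f holomorphic_on unit_disc"
  shows "(LINT t|\<mu>. f t) = f 0"
proof -
  have "(LINT t|\<mu>. f t) = (LINT t|\<mu>. f t * (t / (t - 0)))"
    by (rule Bochner_Integration.integral_cong) auto
  then show ?thesis
    using cauchy_circle[OF assms, of 0] by simp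
qed

lemma cauchy_deriv_circle:
  assumes "continuous_on (cball 0 1) f" "f holomorphic_on unit_disc" "z \<in> unit_disc"
  shows "(f has_field_derivative (LINT t|\<mu>. f t * (t / (t - z)\<^sup>2))) (at z)"
proof -
  have cf: "continuous_on unit_circle f"
    using assms(1) continuous_on_subset by fastforce
  have "(LINT t|\<mu>. f t * (t / (t - z)\<^sup>2)) =
      contour_integral (circlepath 0 1) (\<lambda>t. f t * (t / (t - z)\<^sup>2) / t) / (2 * of_real pi * \<i>)"
    by (rule integral_circle_contour)
       (use assms in \<open>auto intro!: continuous_intros cf dest: circle_neq_disc\<close>)
  also have "contour_integral (circlepath 0 1) (\<lambda>t. f t * (t / (t - z)\<^sup>2) / t)
       = contour_integral (circlepath 0 1) (\<lambda>t. f t / (t - z)\<^sup>2)"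
    by (rule contour_integral_cong) auto
  finally have *: "(LINT t|\<mu>. f t * (t / (t - z)\<^sup>2)) =
    1 / (2 * of_real pi * \<i>) * contour_integral (circlepath 0 1) (\<lambda>t. f t / (t - z)\<^sup>2)"
    by simp
  show ?thesis
    unfolding * by (rule Cauchy_derivative_integral_circlepath(2)[OF assms])
qed

text \<open>For \<open>w\<close> outside the closed disc the integrand is holomorphic, so the
  integral is its value at 0, and the factor \<open>t\<close> makes that value vanish.\<close>

lemma cauchy_deriv_exterior:
  assumes "continuous_on (cball 0 1) f" "f holomorphic_on unit_disc" "norm w > 1"
  shows "(LINT t|\<mu>. f t * (t / (t - w)\<^sup>2)) = 0"
proof -
  have "(LINT t|\<mu>. f t * (t / (t - w)\<^sup>2)) = f 0 * (0 / (0 - w)\<^sup>2)"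
    by (rule mean_value_circle) (use assms in \<open>auto intro!: continuous_intros holomorphic_intros\<close>)
  then show ?thesis by simp
qed

section \<open>Poisson and Herglotz kernels and their transforms\<close>

definition poisson_kernel :: "complex \<Rightarrow> complex \<Rightarrow> real" where
  "poisson_kernel z t = (1 - (norm z)\<^sup>2) / (norm (t - z))\<^sup>2"

definition herglotz_kernel :: "complex \<Rightarrow> complex \<Rightarrow> complex" where
  "herglotz_kernel z t = (t + z) / (t - z)"

definition herglotz :: "(complex \<Rightarrow> real) \<Rightarrow> complex \<Rightarrow> complex" where
  "herglotz u z = (LINT t|\<mu>. herglotz_kernel z t * complex_of_real (u t))"

definition poisson :: "(complex \<Rightarrow> real) \<Rightarrow> complex \<Rightarrow> real" where
  "poisson u z = (LINT t|\<mu>. poisson_kernel z t * u t)"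

lemma Re_herglotz_kernel:
  assumes "t \<in> unit_circle"
  shows "Re (herglotz_kernel z t) = poisson_kernel z t"
proof -
  have "(Re t)\<^sup>2 + (Im t)\<^sup>2 = 1"
    using assms by (metis cmod_power2 mem_sphere_0 one_power2)
  then have "Re (t + z) * Re (t - z) + Im (t + z) * Im (t - z) = 1 - (norm z)\<^sup>2"
    unfolding cmod_power2 by (simp add: algebra_simps power2_eq_square)
  then show ?thesis
    by (simp add: herglotz_kernel_def Re_divide poisson_kernel_def cmod_power2)
qed

lemma poisson_kernel_nonneg: "z \<in> unit_disc \<Longrightarrow> 0 \<le> poisson_kernel z t"
  by (auto simp: poisson_kernel_def abs_square_le_1 intro!: divide_nonneg_nonneg)

lemma norm_herglotz_kernel_le:
  assumes "t \<in> unit_circle" "z \<in> unit_disc"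
  shows "norm (herglotz_kernel z t) \<le> 2 / (1 - norm z)"
proof -
  have "norm (t + z) \<le> 2"
    using norm_triangle_ineq[of t z] assms by auto
  then show ?thesis
    using circle_diff_ge[OF assms(1), of z] assms by (auto simp: herglotz_kernel_def norm_divide intro!: frac_le)
qed

lemma poisson_kernel_le:
  assumes "t \<in> unit_circle" "z \<in> unit_disc"
  shows "poisson_kernel z t \<le> 2 / (1 - norm z)"
  using norm_herglotz_kernel_le[OF assms] complex_Re_le_cmod[of "herglotz_kernel z t"]
  by (simp add: Re_herglotz_kernel[OF assms(1)])

lemma continuous_on_herglotz_kernel:
  "z \<in> unit_disc \<Longrightarrow> continuous_on unit_circle (herglotz_kernel z)"
  unfolding herglotz_kernel_def by (auto intro!: continuous_intros dest: circle_neq_disc)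

lemma continuous_on_poisson_kernel:
  "z \<in> unit_disc \<Longrightarrow> continuous_on unit_circle (poisson_kernel z)"
  unfolding poisson_kernel_def by (auto intro!: continuous_intros dest: circle_neq_disc)

lemma borel_measurable_herglotz_kernel:
  "z \<in> unit_disc \<Longrightarrow> herglotz_kernel z \<in> borel_measurable \<mu>"
  by (intro borel_measurable_circleI continuous_on_herglotz_kernel)

lemma integrable_herglotz:
  assumes "z \<in> unit_disc" "integrable \<mu> u"
  shows "integrable \<mu> (\<lambda>t. herglotz_kernel z t * complex_of_real (u t))"
proof (rule Bochner_Integration.integrable_bound)
  show "integrable \<mu> (\<lambda>t. 2 / (1 - norm z) * u t)"
    using assms by simp
  show "(\<lambda>t. herglotz_kernel z t * complex_of_real (u t)) \<in> borel_measurable \<mu>"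
    using assms borel_measurable_herglotz_kernel[OF assms(1)]
    by (auto intro!: borel_measurable_times)
  show "AE t in \<mu>. norm (herglotz_kernel z t * complex_of_real (u t)) \<le> norm (2 / (1 - norm z) * u t)"
    using norm_herglotz_kernel_le[OF _ assms(1)] assms(1)
    by (intro AE_I2) (auto simp: norm_mult abs_mult simp del: times_divide_eq_left intro!: mult_right_mono)
qed

lemma
  assumes "z \<in> unit_disc" "integrable \<mu> u"
  shows Re_herglotz: "Re (herglotz u z) = poisson u z"
    and integrable_poisson: "integrable \<mu> (\<lambda>t. poisson_kernel z t * u t)"
proof -
  have *: "Re (herglotz_kernel z t * complex_of_real (u t)) = poisson_kernel z t * u t"
    if "t \<in> space \<mu>" for t
    using that Re_herglotz_kernel[of t z] by simp
  show "Re (herglotz u z) = poisson u z"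
    unfolding herglotz_def poisson_def
    by (subst integral_Re[symmetric], rule integrable_herglotz[OF assms])
       (intro Bochner_Integration.integral_cong refl *)
  show "integrable \<mu> (\<lambda>t. poisson_kernel z t * u t)"
  proof -
    have "integrable \<mu> (\<lambda>t. Re (herglotz_kernel z t * complex_of_real (u t))) \<longleftrightarrow>
        integrable \<mu> (\<lambda>t. poisson_kernel z t * u t)"
      by (intro Bochner_Integration.integrable_cong refl *)
    then show ?thesis
      using integrable_Re[OF integrable_herglotz[OF assms]] by blast
  qed
qed

lemma integral_herglotz_kernel:
  assumes "z \<in> unit_disc"
  shows "(LINT t|\<mu>. herglotz_kernel z t) = 1"
proof -
  have i: "integrable \<mu> (\<lambda>t. t / (t - z))"
    by (rule integrable_circleI) (use assms in \<open>auto intro!: continuous_intros dest: circle_neq_disc\<close>)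
  have 1: "(LINT t|\<mu>. t / (t - z)) = 1"
    using cauchy_circle[of "\<lambda>_. 1" z] assms by simp
  have "(LINT t|\<mu>. herglotz_kernel z t) = (LINT t|\<mu>. 2 * (t / (t - z)) - 1)"
    by (rule Bochner_Integration.integral_cong)
       (use circle_neq_disc[OF _ assms] in \<open>auto simp: herglotz_kernel_def field_simps\<close>)
  also have "\<dots> = 2 * (LINT t|\<mu>. t / (t - z)) - 1"
    by (subst Bochner_Integration.integral_diff)
       (simp_all only: i integral_mult_right_zero integrable_mult_right circle.integrable_const integral_mult_right
          circle.prob_space lebesgue_integral_const, simp)
  finally show ?thesis by (simp add: 1)
qed

lemma
  assumes "z \<in> unit_disc"
  shows herglotz_const: "herglotz (\<lambda>t. c) z = of_real c"
    and poisson_const: "poisson (\<lambda>t. c) z = c"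
    and integral_poisson_kernel: "(LINT t|\<mu>. poisson_kernel z t) = 1"
proof -
  show h: "herglotz (\<lambda>t. c) z = of_real c" for c
    by (simp add: herglotz_def integral_herglotz_kernel[OF assms])
  show p: "poisson (\<lambda>t. c) z = c" for c
    using Re_herglotz[OF assms, of "\<lambda>_. c"] by (simp add: h)
  show "(LINT t|\<mu>. poisson_kernel z t) = 1"
    using p[of 1] by (simp add: poisson_def)
qed

lemma poisson_mono_AE:
  assumes "z \<in> unit_disc" "integrable \<mu> u" "integrable \<mu> v"
    and "AE t in \<mu>. u t \<le> v t"
  shows "poisson u z \<le> poisson v z"
  unfolding poisson_def
  using assms by (intro integral_mono_AE integrable_poisson) (auto intro!: mult_left_mono poisson_kernel_nonneg)

lemma poisson_nonneg:
  assumes "z \<in> unit_disc" "\<And>t. t \<in> unit_circle \<Longrightarrow> 0 \<le> u t"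
  shows "0 \<le> poisson u z"
  unfolding poisson_def
  using assms by (intro Bochner_Integration.integral_nonneg) (auto intro!: mult_nonneg_nonneg poisson_kernel_nonneg)

lemma poisson_add:
  assumes "z \<in> unit_disc" "integrable \<mu> u" "integrable \<mu> v"
  shows "poisson (\<lambda>t. u t + v t) z = poisson u z + poisson v z"
  unfolding poisson_def
  using assms by (simp add: distrib_left integrable_poisson)

lemma poisson_diff:
  assumes "z \<in> unit_disc" "integrable \<mu> u" "integrable \<mu> v"
  shows "poisson (\<lambda>t. u t - v t) z = poisson u z - poisson v z"
  unfolding poisson_def
  using assms by (simp add: right_diff_distrib integrable_poisson)

lemma poisson_cmult: "poisson (\<lambda>t. c * u t) z = c * poisson u z"
  unfolding poisson_def by (simp add: mult.left_commute)

lemma poisson_zero: "poisson u 0 = (LINT t|\<mu>. u t)"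
  unfolding poisson_def poisson_kernel_def
  by (rule Bochner_Integration.integral_cong) auto

lemma herglotz_zero: "herglotz u 0 = of_real (LINT t|\<mu>. u t)"
  unfolding herglotz_def
  by (subst integral_complex_of_real[symmetric], rule Bochner_Integration.integral_cong)
     (auto simp: herglotz_kernel_def)

text \<open>For fixed \<open>z\<close> the kernel is bounded by \<open>2 / (1 - norm z)\<close>, so
  convergence in the mean is enough.\<close>

lemma poisson_tendsto:
  assumes "z \<in> unit_disc" "integrable \<mu> u" "\<And>n. integrable \<mu> (v n)"
    and "(\<lambda>n. LINT t|\<mu>. \<bar>v n t - u t\<bar>) \<longlonglongrightarrow> 0"
  shows "(\<lambda>n. poisson (v n) z) \<longlonglongrightarrow> poisson u z"
proof -
  have bound: "norm (poisson (v n) z - poisson u z) \<le> 2 / (1 - norm z) * (LINT t|\<mu>. \<bar>v n t - u t\<bar>)" for n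
  proof -
    have "norm (poisson (v n) z - poisson u z) = norm (LINT t|\<mu>. poisson_kernel z t * (v n t - u t))"
      using poisson_diff[OF assms(1,3,2)] by (simp add: poisson_def)
    also have "\<dots> \<le> (LINT t|\<mu>. 2 / (1 - norm z) * \<bar>v n t - u t\<bar>)"
      using poisson_kernel_le[OF _ assms(1)] poisson_kernel_nonneg[OF assms(1)]
      by (intro Bochner_Integration.integral_norm_bound_integral integrable_poisson integrable_mult_right
            Bochner_Integration.integrable_diff integrable_abs assms)
         (auto simp: abs_mult simp del: times_divide_eq_left intro!: mult_right_mono)
    finally show ?thesis by simp
  qed
  have "(\<lambda>n. 2 / (1 - norm z) * (LINT t|\<mu>. \<bar>v n t - u t\<bar>)) \<longlonglongrightarrow> 0"
    by (rule tendsto_mult_right_zero[OF assms(4)])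
  then have "(\<lambda>n. poisson (v n) z - poisson u z) \<longlonglongrightarrow> 0"
    by (rule Lim_null_comparison[OF always_eventually[OF allI[OF bound]]])
  then show ?thesis
    by (rule LIM_zero_cancel)
qed

text \<open>The kernel \<open>t / (t - z)\<close> is the geometric series in \<open>z / t\<close>,
  and \<open>norm (z / t) = norm z\<close> for every \<open>t\<close> on the circle. Hence it may be
  integrated term by term against an integrable \<open>u\<close>, and a power series in
  \<open>z\<close> results.\<close>

lemma holomorphic_cauchy_transform:
  assumes "integrable \<mu> u"
  shows "(\<lambda>z. LINT t|\<mu>. t / (t - z) * complex_of_real (u t)) holomorphic_on unit_disc"
proof (rule power_series_holomorphic)
  fix w :: complex
  assume w: "w \<in> unit_disc"
  have w1: "norm w < 1" using w by simp
  let ?f = "\<lambda>n t. (w / t) ^ n * complex_of_real (u t)"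
  have m [measurable]: "(\<lambda>t. (w / t) ^ n) \<in> borel_measurable \<mu>" for n
    by (rule borel_measurable_circleI) (auto intro!: continuous_intros)
  have nf: "norm (?f n t) = norm w ^ n * \<bar>u t\<bar>" if "t \<in> unit_circle" for n t
    using that by (simp add: norm_mult norm_power norm_divide)
  have sg: "summable (\<lambda>n. norm w ^ n)"
    using w1 by simp
  have i: "integrable \<mu> (?f n)" for n
  proof (rule Bochner_Integration.integrable_bound[OF assms])
    show "?f n \<in> borel_measurable \<mu>"
      using assms by (intro borel_measurable_times m borel_measurable_of_real) auto
    show "AE t in \<mu>. norm (?f n t) \<le> norm (u t)"
      using w1 by (intro AE_I2) (simp add: nf power_le_one mult_left_le_one_le)
  qed
  have "(\<lambda>n. integral\<^sup>L \<mu> (?f n)) sums (LINT t|\<mu>. (\<Sum>n. ?f n t))"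
  proof (rule sums_integral[OF i])
    show "AE t in \<mu>. summable (\<lambda>n. norm (?f n t))"
      using sg by (intro AE_I2) (simp add: nf summable_mult2)
    have "(LINT t|\<mu>. norm (?f n t)) = norm w ^ n * (LINT t|\<mu>. \<bar>u t\<bar>)" for n
      by (subst integral_mult_right_zero[symmetric], rule Bochner_Integration.integral_cong)
         (use nf in auto)
    then show "summable (\<lambda>n. LINT t|\<mu>. norm (?f n t))"
      using sg by (simp add: summable_mult2)
  qed
  also have "(LINT t|\<mu>. (\<Sum>n. ?f n t)) = (LINT t|\<mu>. t / (t - w) * complex_of_real (u t))"
  proof (rule Bochner_Integration.integral_cong[OF refl])
    fix t assume "t \<in> space \<mu>"
    then have t: "norm t = 1" "t \<noteq> 0" "t \<noteq> w" using w1 by auto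
    have "norm (w / t) < 1"
      using t w1 by (simp add: norm_divide)
    then have "(\<lambda>n. (w / t) ^ n) sums (1 / (1 - w / t))"
      by (rule geometric_sums)
    then have "(\<lambda>n. ?f n t) sums (1 / (1 - w / t) * complex_of_real (u t))"
      by (rule sums_mult2)
    then have "(\<Sum>n. ?f n t) = 1 / (1 - w / t) * complex_of_real (u t)"
      by (rule sums_unique[symmetric])
    also have "1 / (1 - w / t) = t / (t - w)"
      using t by (simp add: field_simps)
    finally show "(\<Sum>n. ?f n t) = t / (t - w) * complex_of_real (u t)" .
  qed
  also have "(\<lambda>n. integral\<^sup>L \<mu> (?f n)) =
      (\<lambda>n. (LINT t|\<mu>. inverse t ^ n * complex_of_real (u t)) * (w - 0) ^ n)"
    by (subst integral_mult_left_zero[symmetric])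
       (simp add: power_mult_distrib divide_inverse mult_ac)
  finally show "(\<lambda>n. (LINT t|\<mu>. inverse t ^ n * complex_of_real (u t)) * (w - 0) ^ n) sums
      (LINT t|\<mu>. t / (t - w) * complex_of_real (u t))" .
qed

text \<open>The Herglotz kernel is \<open>2 t / (t - z) - 1\<close>, so the transform is twice the
  Cauchy transform minus a constant.\<close>

lemma holomorphic_herglotz:
  assumes "integrable \<mu> u"
  shows "herglotz u holomorphic_on unit_disc"
proof (rule holomorphic_transform)
  let ?T = "\<lambda>z. LINT t|\<mu>. t / (t - z) * complex_of_real (u t)"
  show "(\<lambda>z. 2 * ?T z - of_real (LINT t|\<mu>. u t)) holomorphic_on unit_disc"
    by (intro holomorphic_intros holomorphic_cauchy_transform assms)
  fix z :: complex
  assume z: "z \<in> unit_disc"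
  have "(LINT t|\<mu>. (herglotz_kernel z t * complex_of_real (u t) + complex_of_real (u t))) =
      herglotz u z + (LINT t|\<mu>. complex_of_real (u t))"
    unfolding herglotz_def
    by (intro Bochner_Integration.integral_add integrable_herglotz[OF z] integrable_of_real assms)
  also have "(LINT t|\<mu>. (herglotz_kernel z t * complex_of_real (u t) + complex_of_real (u t))) =
      (LINT t|\<mu>. 2 * (t / (t - z) * complex_of_real (u t)))"
  proof (rule Bochner_Integration.integral_cong[OF refl])
    fix t assume "t \<in> space \<mu>"
    then have "t \<noteq> z" using z by auto
    then show "herglotz_kernel z t * complex_of_real (u t) + complex_of_real (u t) = 2 * (t / (t - z) * complex_of_real (u t))"
      by (simp add: herglotz_kernel_def field_simps)
  qed
  also have "\<dots> = 2 * ?T z"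
    by (rule integral_mult_right_zero)
  finally show "2 * ?T z - of_real (LINT t|\<mu>. u t) = herglotz u z"
    by simp
qed

lemma continuous_on_poisson:
  assumes "integrable \<mu> u"
  shows "continuous_on unit_disc (poisson u)"
proof -
  have "continuous_on unit_disc (\<lambda>z. Re (herglotz u z))"
    by (intro continuous_on_Re holomorphic_on_imp_continuous_on holomorphic_herglotz assms)
  then show ?thesis
    by (rule continuous_on_cong[THEN iffD1, OF refl, rotated]) (use Re_herglotz[OF _ assms] in auto)
qed

section \<open>Exponential Poisson majorants of holomorphic functions\<close>

lemma circle_diff_le_radial:
  fixes t t0 :: complex
  assumes "t \<in> unit_circle" "t0 \<in> unit_circle" "0 \<le> r" "r < 1"
  shows "norm (t - t0) \<le> 2 * norm (t - of_real r * t0)"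
proof -
  \<comment> \<open>\<open>r t0\<close> lies at distance \<open>1 - r\<close> from \<open>t0\<close>
    and at least that far from every point of the circle. The triangle inequality then costs the
    factor 2.\<close>
  have "norm (of_real r * t0 - t0) = 1 - r"
    using assms by (metis abs_of_nonneg abs_minus_commute diff_ge_0_iff_ge less_eq_real_def
      mem_sphere_0 mult.right_neutral mult_minus1 norm_mult norm_of_real of_real_1 of_real_diff left_diff_distrib mult_1)
  moreover have "1 - r \<le> norm (t - of_real r * t0)"
    using circle_diff_ge[OF assms(1), of "of_real r * t0"] assms by (simp add: norm_mult)
  moreover have "norm (t - t0) \<le> norm (t - of_real r * t0) + norm (of_real r * t0 - t0)"
    using norm_triangle_ineq[of "t - of_real r * t0" "of_real r * t0 - t0"] by simp
  ultimately show ?thesis by simp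
qed

text \<open>A quadratic error is what the kernel absorbs: by \<open>circle_diff_le_radial\<close>,
  \<open>(norm (t - t0))\<^sup>2\<close> times the kernel is at most
  \<open>4 (1 - r\<^sup>2)\<close>. A bounded function that is small near \<open>t0\<close>
  satisfies such a bound for a large \<open>B\<close>, which replaces splitting the circle into a
  near and a far arc.\<close>

lemma poisson_approximate_identity:
  fixes t0 :: complex
  assumes t0: "t0 \<in> unit_circle" and r: "0 \<le> r" "r < 1"
    and w: "integrable \<mu> \<omega>" and B: "0 \<le> B"
    and bound: "\<And>t. t \<in> unit_circle \<Longrightarrow> \<bar>\<omega> t\<bar> \<le> \<epsilon> + B * (norm (t - t0))\<^sup>2"
  shows "\<bar>poisson \<omega> (of_real r * t0)\<bar> \<le> \<epsilon> + 4 * B * (1 - r\<^sup>2)"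
proof -
  let ?z = "of_real r * t0"
  have z: "?z \<in> unit_disc" using t0 r by (simp add: norm_mult)
  have r2: "0 \<le> 1 - r\<^sup>2" using r by (simp add: abs_square_le_1)
  have ik: "integrable \<mu> (poisson_kernel ?z)"
    by (intro integrable_circleI continuous_on_poisson_kernel z)
  have "\<bar>poisson \<omega> ?z\<bar> \<le> (LINT t|\<mu>. \<epsilon> * poisson_kernel ?z t + 4 * B * (1 - r\<^sup>2))"
    unfolding poisson_def real_norm_def[symmetric]
  proof (rule Bochner_Integration.integral_norm_bound_integral)
    show "integrable \<mu> (\<lambda>t. poisson_kernel ?z t * \<omega> t)"
      by (intro integrable_poisson z w)
    show "integrable \<mu> (\<lambda>t. \<epsilon> * poisson_kernel ?z t + 4 * B * (1 - r\<^sup>2))"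
      using ik by simp
    fix t assume "t \<in> space \<mu>"
    then have t: "t \<in> unit_circle" by simp
    have d: "(norm (t - t0))\<^sup>2 \<le> 4 * (norm (t - ?z))\<^sup>2"
      using power_mono[OF circle_diff_le_radial[OF t t0 r], of 2] by (simp add: power_mult_distrib)
    have pos: "0 < (norm (t - ?z))\<^sup>2"
      using circle_neq_disc[OF t z] by simp
    have "poisson_kernel ?z t * (norm (t - t0))\<^sup>2 = (1 - r\<^sup>2) * ((norm (t - t0))\<^sup>2 / (norm (t - ?z))\<^sup>2)"
      using t0 r by (simp add: poisson_kernel_def norm_mult)
    also have "\<dots> \<le> (1 - r\<^sup>2) * 4"
      using d pos r2 by (intro mult_left_mono) (auto simp: divide_le_eq)
    finally have k: "poisson_kernel ?z t * (norm (t - t0))\<^sup>2 \<le> 4 * (1 - r\<^sup>2)" by simp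
    have "norm (poisson_kernel ?z t * \<omega> t) = poisson_kernel ?z t * \<bar>\<omega> t\<bar>"
      using poisson_kernel_nonneg[OF z] by (simp add: abs_mult)
    also have "\<dots> \<le> poisson_kernel ?z t * (\<epsilon> + B * (norm (t - t0))\<^sup>2)"
      by (intro mult_left_mono bound t poisson_kernel_nonneg[OF z])
    also have "\<dots> = \<epsilon> * poisson_kernel ?z t + B * (poisson_kernel ?z t * (norm (t - t0))\<^sup>2)"
      by (simp add: algebra_simps)
    also have "\<dots> \<le> \<epsilon> * poisson_kernel ?z t + B * (4 * (1 - r\<^sup>2))"
      by (intro add_left_mono mult_left_mono k B)
    finally show "norm (poisson_kernel ?z t * \<omega> t) \<le> \<epsilon> * poisson_kernel ?z t + 4 * B * (1 - r\<^sup>2)"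
      by (simp add: algebra_simps)
  qed
  also have "\<dots> = \<epsilon> + 4 * B * (1 - r\<^sup>2)"
    using ik integral_poisson_kernel[OF z] by (simp add: circle.prob_space)
  finally show ?thesis .
qed

text \<open>The maximum principle for \<open>f(\<zeta>) exp (- H(r \<zeta>))\<close>, where \<open>H\<close> is the Herglotz transform of \<open>u\<close> and
  \<open>r < 1\<close>, needs the boundary behaviour of the Poisson integral only on smaller circles.\<close>

lemma norm_le_exp_poisson:
  fixes f :: "complex \<Rightarrow> complex"
  assumes contf: "continuous_on (cball 0 1) f" and holf: "f holomorphic_on unit_disc"
    and contu: "continuous_on unit_circle u"
    and le: "\<And>t. t \<in> unit_circle \<Longrightarrow> norm (f t) \<le> exp (u t)" and z: "z \<in> unit_disc"
  shows "norm (f z) \<le> exp (poisson u z)"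
proof -
  have iu: "integrable \<mu> u"
    by (rule integrable_circleI[OF contu])
  have "norm (f z) \<le> exp (poisson u z + \<epsilon>)" if \<epsilon>: "0 < \<epsilon>" for \<epsilon>
  proof -
    have "uniformly_continuous_on unit_circle u"
      by (intro compact_uniformly_continuous contu compact_sphere)
    then obtain \<delta> where \<delta>: "0 < \<delta>" "\<And>t t'. t \<in> unit_circle \<Longrightarrow> t' \<in> unit_circle \<Longrightarrow> dist t' t < \<delta> \<Longrightarrow> dist (u t') (u t) < \<epsilon>"
      using \<epsilon> unfolding uniformly_continuous_on_def by metis
    have "compact (u ` unit_circle)"
      by (intro compact_continuous_image contu compact_sphere)
    then obtain M where M: "\<And>t. t \<in> unit_circle \<Longrightarrow> \<bar>u t\<bar> \<le> M"
      using compact_imp_bounded bounded_iff by (metis imageI real_norm_def)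
    have M0: "0 \<le> M" using M[of 1] by simp
    \<comment> \<open>At distance at least \<delta> the quadratic term alone then reaches
      \<open>2 * M\<close>, the largest possible difference of two values of
      \<open>u\<close>.\<close>
    define B where "B = 2 * M / \<delta>\<^sup>2"
    have B: "0 \<le> B" using M0 by (simp add: B_def)
    have quad: "\<bar>u t - u t0\<bar> \<le> \<epsilon> + B * (norm (t - t0))\<^sup>2" if "t \<in> unit_circle" "t0 \<in> unit_circle" for t t0
    proof (cases "norm (t - t0) < \<delta>")
      case True
      then have "\<bar>u t - u t0\<bar> < \<epsilon>"
        using \<delta>(2)[OF that(2,1)] by (simp add: dist_norm)
      then show ?thesis using B by (smt (verit) mult_nonneg_nonneg zero_le_power2)
    next
      case False
      then have "\<delta>\<^sup>2 \<le> (norm (t - t0))\<^sup>2" using \<delta>(1) by (intro power_mono) auto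
      then have "2 * M * 1 \<le> 2 * M * ((norm (t - t0))\<^sup>2 / \<delta>\<^sup>2)"
        using M0 \<delta>(1) by (intro mult_left_mono) auto
      then have "2 * M \<le> B * (norm (t - t0))\<^sup>2"
        by (simp add: B_def)
      then show ?thesis using M[OF that(1)] M[OF that(2)] \<epsilon> by linarith
    qed
    \<comment> \<open>\<epsilon> and \<open>B\<close> do not depend on \<open>t0\<close>: the
      maximum principle needs this estimate on the whole circle at once.\<close>
    have low: "u t0 - \<epsilon> - 4 * B * (1 - r\<^sup>2) \<le> poisson u (of_real r * t0)"
      if t0: "t0 \<in> unit_circle" and r: "0 \<le> r" "r < 1" for t0 r
    proof -
      have z: "of_real r * t0 \<in> unit_disc" using t0 r by (simp add: norm_mult)
      have "\<bar>poisson (\<lambda>t. u t - u t0) (of_real r * t0)\<bar> \<le> \<epsilon> + 4 * B * (1 - r\<^sup>2)"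
        by (rule poisson_approximate_identity[OF t0 r _ B]) (use iu quad t0 in auto)
      then show ?thesis
        using poisson_diff[OF z iu, of "\<lambda>_. u t0"] poisson_const[OF z, of "u t0"] by simp
    qed
    have main: "norm (f z) \<le> exp (poisson u (of_real r * z) + \<epsilon> + 4 * B * (1 - r\<^sup>2))"
      if r: "0 \<le> r" "r < 1" for r
    proof -
      let ?g = "\<lambda>\<zeta>. f \<zeta> * exp (- herglotz u (of_real r * \<zeta>))"
      have in_disc: "of_real r * \<zeta> \<in> unit_disc" if "\<zeta> \<in> cball 0 1" for \<zeta> :: complex
      proof -
        have "norm (of_real r * \<zeta>) \<le> r"
          using that r by (simp add: norm_mult mult_left_le)
        then show ?thesis using r by simp
      qed
      have contH: "continuous_on (cball 0 1) (\<lambda>\<zeta>. herglotz u (of_real r * \<zeta>))"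
        by (rule continuous_on_compose2[OF holomorphic_on_imp_continuous_on[OF holomorphic_herglotz[OF iu]]])
           (use in_disc in \<open>auto intro!: continuous_intros\<close>)
      have holH: "(\<lambda>\<zeta>. herglotz u (of_real r * \<zeta>)) holomorphic_on unit_disc"
        by (rule holomorphic_on_compose_gen[OF _ holomorphic_herglotz[OF iu], unfolded o_def])
           (use in_disc in \<open>auto intro!: holomorphic_intros simp del: mem_ball_0\<close>)
      have "norm (?g z) \<le> exp (\<epsilon> + 4 * B * (1 - r\<^sup>2))"
      proof (rule maximum_modulus_frontier[of ?g "cball 0 1"])
        show "?g holomorphic_on interior (cball 0 1)"
          by (auto intro!: holomorphic_intros holf holH)
        show "continuous_on (closure (cball 0 1)) ?g"
          by (auto intro!: continuous_intros contf contH)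
        show "norm (?g \<zeta>) \<le> exp (\<epsilon> + 4 * B * (1 - r\<^sup>2))" if "\<zeta> \<in> frontier (cball 0 1)" for \<zeta>
        proof -
          have \<zeta>: "\<zeta> \<in> unit_circle" using that by simp
          have "norm (?g \<zeta>) = norm (f \<zeta>) * exp (- poisson u (of_real r * \<zeta>))"
            using Re_herglotz[OF in_disc iu, of \<zeta>] \<zeta> by (simp add: norm_mult)
          also have "\<dots> \<le> exp (u \<zeta>) * exp (- poisson u (of_real r * \<zeta>))"
            by (intro mult_right_mono le \<zeta>) simp
          also have "\<dots> \<le> exp (\<epsilon> + 4 * B * (1 - r\<^sup>2))"
            using low[OF \<zeta> r] by (simp flip: exp_add)
          finally show ?thesis .
        qed
      qed (use z in auto)
      also have "norm (?g z) = norm (f z) * exp (- poisson u (of_real r * z))"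
        using Re_herglotz[OF in_disc iu, of z] z by (simp add: norm_mult)
      finally have "norm (f z) * exp (- poisson u (of_real r * z)) * exp (poisson u (of_real r * z))
          \<le> exp (\<epsilon> + 4 * B * (1 - r\<^sup>2)) * exp (poisson u (of_real r * z))"
        by (rule mult_right_mono) simp
      then show ?thesis
        by (simp add: mult.assoc flip: exp_add) (simp add: algebra_simps)
    qed
    \<comment> \<open>\<open>B\<close> depends on \<epsilon>, so \<open>r\<close> must go to 1
      before \<epsilon> goes to 0. The point \<open>z\<close> is interior, where the Poisson
      integral is continuous.\<close>
    have "((\<lambda>r. exp (poisson u (of_real r * z) + \<epsilon> + 4 * B * (1 - r\<^sup>2))) \<longlongrightarrow>
        exp (poisson u (of_real 1 * z) + \<epsilon> + 4 * B * (1 - 1\<^sup>2))) (at_left 1)"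
    proof (intro tendsto_intros)
      have "isCont (poisson u) (of_real 1 * z)"
        using continuous_on_poisson[OF iu] z by (simp add: continuous_on_eq_continuous_at)
      then show "((\<lambda>r. poisson u (of_real r * z)) \<longlongrightarrow> poisson u (of_real 1 * z)) (at_left 1)"
        by (rule isCont_tendsto_compose) (intro tendsto_intros)
    qed
    moreover have "eventually (\<lambda>r. norm (f z) \<le> exp (poisson u (of_real r * z) + \<epsilon> + 4 * B * (1 - r\<^sup>2))) (at_left 1)"
      unfolding eventually_at_left_field using main by (intro exI[of _ 0]) auto
    ultimately have "norm (f z) \<le> exp (poisson u (of_real 1 * z) + \<epsilon> + 4 * B * (1 - 1\<^sup>2))"
      by (rule tendsto_lowerbound) simp
    then show ?thesis by simp
  qed
  then have "norm (f z) \<le> exp (poisson u z) * exp \<epsilon>" if "0 < \<epsilon>" for \<epsilon>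
    using that by (simp add: exp_add)
  moreover have "((\<lambda>\<epsilon>. exp (poisson u z) * exp \<epsilon>) \<longlongrightarrow> exp (poisson u z) * exp 0) (at_right 0)"
    by (intro tendsto_intros)
  ultimately have "norm (f z) \<le> exp (poisson u z) * exp 0"
    by (intro tendsto_lowerbound) (auto simp: eventually_at_right_field intro!: exI[of _ 1])
  then show ?thesis by simp
qed

lemma dilate_in_disc:
  assumes "0 \<le> R" "R < 1" "z \<in> cball 0 1"
  shows "of_real R * z \<in> unit_disc"
proof -
  have "norm (of_real R * z) \<le> R"
    using assms by (simp add: norm_mult mult_left_le)
  then show ?thesis using assms by simp
qed

lemma
  assumes "0 \<le> R" "R < 1" "f holomorphic_on unit_disc"
  shows continuous_on_dilate: "continuous_on (cball 0 1) (\<lambda>z. f (of_real R * z))"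
    and holomorphic_on_dilate: "(\<lambda>z. f (of_real R * z)) holomorphic_on unit_disc"
proof -
  show "continuous_on (cball 0 1) (\<lambda>z. f (of_real R * z))"
    by (rule continuous_on_compose2[OF holomorphic_on_imp_continuous_on[OF assms(3)]])
       (use dilate_in_disc[OF assms(1,2)] in \<open>auto intro!: continuous_intros\<close>)
  show "(\<lambda>z. f (of_real R * z)) holomorphic_on unit_disc"
    by (rule holomorphic_on_compose_gen[OF _ assms(3), unfolded o_def])
       (use dilate_in_disc[OF assms(1,2)] in \<open>auto intro!: holomorphic_intros simp del: mem_ball_0\<close>)
qed

lemma continuous_on_circle_dilate:
  assumes "0 \<le> R" "R < 1" "f holomorphic_on unit_disc"
  shows "continuous_on unit_circle (\<lambda>t. f (of_real R * t))"
  by (rule continuous_on_subset[OF continuous_on_dilate[OF assms]]) auto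

text \<open>Truncating at \<epsilon> keeps the boundary function continuous at zeros of
  \<open>f\<close>. The left side may be truncated as well because the constant
  \<open>ln \<epsilon>\<close> is its own Poisson integral.\<close>

lemma ln_max_dilate_le_poisson:
  assumes "0 \<le> R" "R < 1" "f holomorphic_on unit_disc" "0 < \<epsilon>" "z \<in> unit_disc"
  shows "ln (max \<epsilon> (norm (f (of_real R * z)))) \<le> poisson (\<lambda>t. ln (max \<epsilon> (norm (f (of_real R * t))))) z"
proof -
  let ?u = "\<lambda>t. ln (max \<epsilon> (norm (f (of_real R * t))))"
  have m: "0 < max \<epsilon> x" for x using assms(4) by auto
  have cu: "continuous_on unit_circle ?u"
    using m by (intro continuous_intros continuous_on_circle_dilate assms) (auto simp: less_le)
  have "norm (f (of_real R * z)) \<le> exp (poisson ?u z)"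
    by (rule norm_le_exp_poisson[OF continuous_on_dilate holomorphic_on_dilate cu])
       (use assms m in \<open>auto simp del: max_less_iff_conj less_max_iff_disj\<close>)
  moreover have "poisson (\<lambda>_. ln \<epsilon>) z \<le> poisson ?u z"
    using assms(4) by (intro poisson_mono_AE assms(5) integrable_circleI cu AE_I2) auto
  then have "\<epsilon> \<le> exp (poisson ?u z)"
    using assms(4) poisson_const[OF assms(5), of "ln \<epsilon>"] by (metis exp_le_cancel_iff exp_ln)
  ultimately have "max \<epsilon> (norm (f (of_real R * z))) \<le> exp (poisson ?u z)"
    by simp
  then show ?thesis
    using m by (metis ln_exp ln_le_cancel_iff exp_gt_zero)
qed

section \<open>Convergence in the mean of dilations\<close>

lemma integral_circle_powers:
  "(LINT t|\<mu>. t ^ m * cnj t ^ n) = (if m = n then 1 else 0)"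
proof -
  have less: "(LINT t|\<mu>. t ^ m * cnj t ^ n) = 0" if "n < m" for m n
  proof -
    have "(LINT t|\<mu>. t ^ m * cnj t ^ n) = (LINT t|\<mu>. t ^ (m - n))"
    proof (rule Bochner_Integration.integral_cong[OF refl])
      fix t assume "t \<in> space \<mu>"
      then have "t * cnj t = 1"
        by (simp add: complex_norm_square[symmetric])
      then have "t ^ n * cnj t ^ n = 1"
        by (metis power_mult_distrib power_one)
      moreover have "t ^ m = t ^ (m - n) * t ^ n"
        using that by (simp flip: power_add)
      ultimately show "t ^ m * cnj t ^ n = t ^ (m - n)"
        by (simp add: mult.assoc)
    qed
    also have "\<dots> = 0 ^ (m - n)"
      by (rule mean_value_circle) (auto intro!: continuous_intros holomorphic_intros)
    finally show ?thesis using that by simp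
  qed
  consider "n < m" | "m < n" | "m = n" by linarith
  then show ?thesis
  proof cases
    case 1
    then show ?thesis using less by simp
  next
    case 2
    have "(LINT t|\<mu>. t ^ m * cnj t ^ n) = (LINT t|\<mu>. cnj (t ^ n * cnj t ^ m))"
      by (simp add: mult.commute)
    also have "\<dots> = cnj (LINT t|\<mu>. t ^ n * cnj t ^ m)"
      by (rule Bochner_Integration.integral_cnj)
    finally show ?thesis using less[OF 2] 2 by simp
  next
    case 3
    have "(LINT t|\<mu>. t ^ m * cnj t ^ n) = (LINT t|\<mu>. (1::complex))"
    proof (rule Bochner_Integration.integral_cong[OF refl])
      fix t assume "t \<in> space \<mu>"
      then have "t * cnj t = 1"
        by (simp add: complex_norm_square[symmetric])
      then show "t ^ m * cnj t ^ n = 1"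
        using 3 by (metis power_mult_distrib power_one)
    qed
    then show ?thesis using 3 by simp
  qed
qed

text \<open>Absolute summability holds for the coefficients of a dilation of a function holomorphic
  on the disc; it allows termwise integration against any continuous function.\<close>

lemma parseval_circle:
  fixes c :: "nat \<Rightarrow> complex"
  assumes c: "summable (\<lambda>n. norm (c n))" and g: "\<And>t. t \<in> unit_circle \<Longrightarrow> (\<lambda>n. c n * t ^ n) sums g t"
    and contg: "continuous_on unit_circle g"
  shows "(\<lambda>n. (norm (c n))\<^sup>2) sums (LINT t|\<mu>. (norm (g t))\<^sup>2)"
proof -
  \<comment> \<open>Used twice: with \<open>h t = cnj t ^ n\<close> it identifies the coefficients,
    with \<open>h t = cnj (g t)\<close> it gives the identity.\<close>
  have sums: "(\<lambda>n. LINT t|\<mu>. c n * t ^ n * h t) sums (LINT t|\<mu>. g t * h t)"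
    if h: "continuous_on unit_circle h" for h
  proof -
    obtain B where B: "\<And>t. t \<in> unit_circle \<Longrightarrow> norm (h t) \<le> B"
      using compact_imp_bounded[OF compact_continuous_image[OF h compact_sphere]] bounded_iff by (metis imageI)
    have B0: "0 \<le> B" using B[of 1] norm_ge_zero[of "h 1"] by (simp del: norm_ge_zero)
    have nb: "norm (c n * t ^ n * h t) \<le> norm (c n) * B" if "t \<in> unit_circle" for n t
      using that B[OF that] by (simp add: norm_mult norm_power mult_left_mono)
    have i: "integrable \<mu> (\<lambda>t. c n * t ^ n * h t)" for n
      by (intro integrable_circleI continuous_intros h)
    have sB: "summable (\<lambda>n. norm (c n) * B)" by (intro summable_mult2 c)
    have "(\<lambda>n. LINT t|\<mu>. c n * t ^ n * h t) sums (LINT t|\<mu>. (\<Sum>n. c n * t ^ n * h t))"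
    proof (rule sums_integral[OF i])
      show "AE t in \<mu>. summable (\<lambda>n. norm (c n * t ^ n * h t))"
        using nb by (intro AE_I2 summable_comparison_test[OF _ sB]) auto
      have "(LINT t|\<mu>. norm (c n * t ^ n * h t)) \<le> (LINT t|\<mu>. norm (c n) * B)" for n
        using nb by (intro integral_mono integrable_norm i) auto
      then have "(LINT t|\<mu>. norm (c n * t ^ n * h t)) \<le> norm (c n) * B" for n
        by simp
      then show "summable (\<lambda>n. LINT t|\<mu>. norm (c n * t ^ n * h t))"
        by (intro summable_comparison_test[OF _ sB]) auto
    qed
    also have "(LINT t|\<mu>. (\<Sum>n. c n * t ^ n * h t)) = (LINT t|\<mu>. g t * h t)"
      by (intro Bochner_Integration.integral_cong refl sums_unique[symmetric] sums_mult2 g) simp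
    finally show ?thesis .
  qed
  have coeff: "(LINT t|\<mu>. g t * cnj t ^ n) = c n" for n
  proof -
    have "(LINT t|\<mu>. c m * t ^ m * cnj t ^ n) = (if m = n then c m else 0)" for m
    proof -
      have "(LINT t|\<mu>. c m * (t ^ m * cnj t ^ n)) = c m * (LINT t|\<mu>. t ^ m * cnj t ^ n)"
        by (rule integral_mult_right_zero)
      then show ?thesis
        by (simp add: integral_circle_powers mult.assoc)
    qed
    then have "(\<lambda>m. if m = n then c m else 0) sums (LINT t|\<mu>. g t * cnj t ^ n)"
      using sums[of "\<lambda>t. cnj t ^ n"] by (simp add: continuous_intros)
    then show ?thesis
      using sums_single[of n c] sums_unique2 by fastforce
  qed
  have "(LINT t|\<mu>. c n * t ^ n * cnj (g t)) = c n * cnj (c n)" for n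
  proof -
    have "(LINT t|\<mu>. c n * (t ^ n * cnj (g t))) = c n * (LINT t|\<mu>. t ^ n * cnj (g t))"
      by (rule integral_mult_right_zero)
    also have "(LINT t|\<mu>. t ^ n * cnj (g t)) = (LINT t|\<mu>. cnj (g t * cnj t ^ n))"
      by (simp add: mult.commute)
    also have "\<dots> = cnj (c n)"
      unfolding Bochner_Integration.integral_cnj coeff ..
    finally show ?thesis by (simp add: mult.assoc)
  qed
  then have "(\<lambda>n. c n * cnj (c n)) sums (LINT t|\<mu>. g t * cnj (g t))"
    using sums[of "\<lambda>t. cnj (g t)"] by (simp add: continuous_intros contg)
  then have "(\<lambda>n. complex_of_real ((norm (c n))\<^sup>2)) sums complex_of_real (LINT t|\<mu>. (norm (g t))\<^sup>2)"
    by (simp add: complex_norm_square[symmetric] flip: of_real_power)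
  then show ?thesis
    unfolding sums_of_real_iff .
qed

lemma holomorphic_disc_coefficients:
  assumes "f holomorphic_on unit_disc"
  obtains c where "\<And>r. 0 \<le> r \<Longrightarrow> r < 1 \<Longrightarrow> summable (\<lambda>n. norm (c n) * r ^ n)"
    and "\<And>z. z \<in> unit_disc \<Longrightarrow> (\<lambda>n. c n * z ^ n) sums f z"
proof -
  define c where "c n = (deriv ^^ n) f 0 / fact n" for n
  have s: "(\<lambda>n. c n * z ^ n) sums f z" if "z \<in> unit_disc" for z
    using holomorphic_power_series[OF assms that] by (simp add: c_def)
  have "summable (\<lambda>n. norm (c n) * r ^ n)" if "0 \<le> r" "r < 1" for r :: real
  proof -
    obtain s' where s': "r < s'" "s' < 1" using \<open>r < 1\<close> dense by blast
    have "summable (\<lambda>n. c n * complex_of_real s' ^ n)"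
      using s[of "of_real s'"] s' that by (auto simp: sums_iff)
    then have "summable (\<lambda>n. norm (c n * complex_of_real r ^ n))"
      by (rule powser_insidea) (use s' that in auto)
    then show ?thesis
      using that by (simp add: norm_mult norm_power)
  qed
  with s that show ?thesis by blast
qed

text \<open>Coefficientwise this is \<open>(s ^ n - r ^ n)\<^sup>2 \<le> (s ^ n)\<^sup>2 - (r ^
  n)\<^sup>2\<close>. The squared means on the right increase with the radius and are bounded if
  \<open>f\<close> is, so the dilations are Cauchy in the quadratic mean.\<close>

lemma L2_increment_le:
  assumes f: "f holomorphic_on unit_disc" and rs: "0 \<le> r" "r \<le> s" "s < 1"
  shows "(LINT t|\<mu>. (norm (f (of_real s * t) - f (of_real r * t)))\<^sup>2)
      \<le> (LINT t|\<mu>. (norm (f (of_real s * t)))\<^sup>2) - (LINT t|\<mu>. (norm (f (of_real r * t)))\<^sup>2)"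
proof -
  obtain c where c: "\<And>r. 0 \<le> r \<Longrightarrow> r < 1 \<Longrightarrow> summable (\<lambda>n. norm (c n) * r ^ n)"
    and cs: "\<And>z. z \<in> unit_disc \<Longrightarrow> (\<lambda>n. c n * z ^ n) sums f z"
    using holomorphic_disc_coefficients[OF f] by metis
  have cont: "continuous_on unit_circle (\<lambda>t. f (of_real r * t))" if "0 \<le> r" "r < 1" for r
    by (rule continuous_on_circle_dilate[OF that f])
  have P: "(\<lambda>n. (norm (c n * of_real r ^ n))\<^sup>2) sums (LINT t|\<mu>. (norm (f (of_real r * t)))\<^sup>2)"
    if r: "0 \<le> r" "r < 1" for r
  proof (rule parseval_circle[OF _ _ cont[OF r]])
    show "summable (\<lambda>n. norm (c n * of_real r ^ n))"
      using c[OF r] r by (simp add: norm_mult norm_power)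
    show "(\<lambda>n. c n * of_real r ^ n * t ^ n) sums f (of_real r * t)" if "t \<in> unit_circle" for t
      using cs[OF dilate_in_disc[OF r, of t]] that by (simp add: power_mult_distrib mult.assoc)
  qed
  have D: "(\<lambda>n. (norm (c n * of_real s ^ n - c n * of_real r ^ n))\<^sup>2) sums
      (LINT t|\<mu>. (norm (f (of_real s * t) - f (of_real r * t)))\<^sup>2)"
  proof (rule parseval_circle)
    show "summable (\<lambda>n. norm (c n * of_real s ^ n - c n * of_real r ^ n))"
    proof (rule summable_comparison_test[OF _ summable_add[OF c[of s] c[of r]]])
      show "\<exists>N. \<forall>n\<ge>N. norm (norm (c n * of_real s ^ n - c n * of_real r ^ n)) \<le> norm (c n) * s ^ n + norm (c n) * r ^ n"
        using norm_triangle_ineq4[of "c n * of_real s ^ n" "c n * of_real r ^ n" for n] rs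
        by (auto simp: norm_mult norm_power)
    qed (use rs in auto)
    show "(\<lambda>n. (c n * of_real s ^ n - c n * of_real r ^ n) * t ^ n) sums (f (of_real s * t) - f (of_real r * t))"
      if "t \<in> unit_circle" for t
      using sums_diff[OF cs[OF dilate_in_disc[of s t]] cs[OF dilate_in_disc[of r t]]] that rs
      by (simp add: power_mult_distrib mult.assoc left_diff_distrib)
    show "continuous_on unit_circle (\<lambda>t. f (of_real s * t) - f (of_real r * t))"
      using rs by (intro continuous_intros cont) auto
  qed
  have "(norm (c n * of_real s ^ n - c n * of_real r ^ n))\<^sup>2 \<le> (norm (c n * of_real s ^ n))\<^sup>2 - (norm (c n * of_real r ^ n))\<^sup>2" for n
  proof -
    have le: "r ^ n \<le> s ^ n" "0 \<le> r ^ n" using rs by (auto intro: power_mono)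
    have "c n * of_real s ^ n - c n * of_real r ^ n = c n * of_real (s ^ n - r ^ n)"
      by (simp add: algebra_simps)
    then have "(norm (c n * of_real s ^ n - c n * of_real r ^ n))\<^sup>2 = (norm (c n))\<^sup>2 * (s ^ n - r ^ n)\<^sup>2"
      by (simp only: norm_mult norm_of_real power_mult_distrib power2_abs)
    also have "(s ^ n - r ^ n)\<^sup>2 \<le> (s ^ n)\<^sup>2 - (r ^ n)\<^sup>2"
      using le mult_left_mono[OF le] by (simp add: power2_eq_square algebra_simps)
    then have "(norm (c n))\<^sup>2 * (s ^ n - r ^ n)\<^sup>2 \<le> (norm (c n))\<^sup>2 * ((s ^ n)\<^sup>2 - (r ^ n)\<^sup>2)"
      by (rule mult_left_mono) simp
    finally show ?thesis
      using rs by (simp add: norm_mult norm_power power_mult_distrib algebra_simps)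
  qed
  then show ?thesis
    using sums_le[OF _ D sums_diff[OF P[of s] P[of r]]] rs by auto
qed

text \<open>Discretizes the radius: measurability and the sequential limit theorems need countably
  many radii.\<close>

definition radii :: "nat \<Rightarrow> real" where
  "radii k = 1 - 1 / (real k + 2)"

lemma radii: "0 \<le> radii k" "radii k < 1" "radii \<longlonglongrightarrow> 1"
proof -
  show "0 \<le> radii k" "radii k < 1" by (simp_all add: radii_def)
  show "radii \<longlonglongrightarrow> 1" unfolding radii_def by real_asymp
qed

lemma radii_mono: "m \<le> k \<Longrightarrow> radii m \<le> radii k"
  by (auto simp: radii_def intro!: divide_left_mono)

text \<open>The radii are chosen so that the squared means are within \<open>(1/4) ^ j\<close> of
  their supremum. The mean increments are then at most \<open>(1/2) ^ j\<close>, their sum has a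
  finite integral, and so it is finite almost everywhere. This produces a boundary function along
  one sequence; the passage to all radii is Fatou's theorem.\<close>

lemma AE_convergent_dilates:
  assumes f: "f holomorphic_on unit_disc" and M: "\<And>z. z \<in> unit_disc \<Longrightarrow> norm (f z) \<le> M"
  obtains \<rho> :: "nat \<Rightarrow> real" where "\<And>j. 0 \<le> \<rho> j" "\<And>j. \<rho> j < 1" "\<rho> \<longlonglongrightarrow> 1"
    "AE t in \<mu>. convergent (\<lambda>j. f (of_real (\<rho> j) * t))"
proof -
  define A where "A r = (LINT t|\<mu>. (norm (f (of_real r * t)))\<^sup>2)" for r :: real
  have cont: "continuous_on unit_circle (\<lambda>t. f (of_real r * t))" if "0 \<le> r" "r < 1" for r
    by (rule continuous_on_circle_dilate[OF that f])
  have inc: "(LINT t|\<mu>. (norm (f (of_real s * t) - f (of_real r * t)))\<^sup>2) \<le> A s - A r"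
    if "0 \<le> r" "r \<le> s" "s < 1" for r s
    unfolding A_def by (rule L2_increment_le[OF f that])
  have "A (radii k) \<le> (LINT t|\<mu>. M\<^sup>2)" for k
    unfolding A_def
  proof (rule integral_mono)
    show "integrable \<mu> (\<lambda>t. (norm (f (of_real (radii k) * t)))\<^sup>2)"
      by (intro integrable_circleI continuous_intros cont radii)
    show "(norm (f (of_real (radii k) * t)))\<^sup>2 \<le> M\<^sup>2" if "t \<in> space \<mu>" for t
      using M[OF dilate_in_disc[OF radii(1,2), of t]] that by (intro power_mono) auto
  qed simp
  then have Abd: "A (radii k) \<le> M\<^sup>2" for k by simp
  have Amono: "A (radii j) \<le> A (radii k)" if "j \<le> k" for j k
  proof -
    have "0 \<le> (LINT t|\<mu>. (norm (f (of_real (radii k) * t) - f (of_real (radii j) * t)))\<^sup>2)"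
      by (rule Bochner_Integration.integral_nonneg) simp
    then show ?thesis
      using inc[OF radii(1) radii_mono[OF that] radii(2)] by linarith
  qed
  have "incseq (\<lambda>k. A (radii k))"
    using Amono by (simp add: incseq_def)
  then obtain L where L: "(\<lambda>k. A (radii k)) \<longlonglongrightarrow> L" "\<And>k. A (radii k) \<le> L"
    using incseq_convergent[of "\<lambda>k. A (radii k)" "M\<^sup>2"] Abd by metis
  have "\<exists>k\<ge>j. L - A (radii k) \<le> (1/4) ^ j" for j :: nat
  proof -
    have "eventually (\<lambda>k. L - (1/4) ^ j < A (radii k)) sequentially"
      by (rule order_tendstoD(1)[OF L(1)]) simp
    then obtain N where "\<And>k. k \<ge> N \<Longrightarrow> L - (1/4) ^ j < A (radii k)"
      by (auto simp: eventually_sequentially)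
    from this[of "max N j"] show ?thesis
      by (intro exI[of _ "max N j"]) (auto simp: algebra_simps)
  qed
  then obtain k where k: "\<And>j. k j \<ge> j" "\<And>j. L - A (radii (k j)) \<le> (1/4) ^ j" by metis
  define \<rho> where "\<rho> j = radii (k j)" for j
  have \<rho>: "0 \<le> \<rho> j" "\<rho> j < 1" for j using radii by (auto simp: \<rho>_def)
  have "filterlim k at_top sequentially"
    by (rule filterlim_at_top_mono[OF filterlim_ident always_eventually]) (use k(1) in auto)
  then have \<rho>lim: "\<rho> \<longlonglongrightarrow> 1"
    unfolding \<rho>_def by (rule filterlim_compose[OF radii(3)])
  let ?g = "\<lambda>j t. f (of_real (\<rho> j) * t)"
  have A\<rho>: "\<bar>A (\<rho> (Suc j)) - A (\<rho> j)\<bar> \<le> (1/4) ^ j" for j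
  proof -
    have "(1/4::real) ^ Suc j \<le> (1/4) ^ j" by simp
    then show ?thesis
      using k(2)[of j] k(2)[of "Suc j"] L(2)[of "k j"] L(2)[of "k (Suc j)"] unfolding \<rho>_def by linarith
  qed
  \<comment> \<open>The indices satisfy \<open>k j \<ge> j\<close> but need not increase, so both
    orders of the two radii occur.\<close>
  have sq: "(LINT t|\<mu>. (norm (?g (Suc j) t - ?g j t))\<^sup>2) \<le> (1/4) ^ j" for j
  proof (cases "\<rho> j \<le> \<rho> (Suc j)")
    case True
    show ?thesis using inc[OF \<rho>(1) True \<rho>(2)] A\<rho>[of j] by linarith
  next
    case False
    then show ?thesis using inc[OF \<rho>(1) _ \<rho>(2), of "Suc j" j] A\<rho>[of j] by (simp add: norm_minus_commute)
  qed
  have cg: "continuous_on unit_circle (?g j)" for j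
    by (rule cont[OF \<rho>])
  have ig: "integrable \<mu> (\<lambda>t. norm (?g (Suc j) t - ?g j t))" for j
    by (intro integrable_circleI continuous_intros cg)
  have l1: "(LINT t|\<mu>. norm (?g (Suc j) t - ?g j t)) \<le> (1/2) ^ j" for j
  proof -
    have isq: "integrable \<mu> (\<lambda>t. (norm (?g (Suc j) t - ?g j t))\<^sup>2)"
      by (intro integrable_circleI continuous_intros cg)
    \<comment> \<open>In place of Cauchy-Schwarz: the weight \<open>2 ^ j\<close> balances the bound
      \<open>(1/4) ^ j\<close> for the squares, so that both terms become
      \<open>(1/2) ^ j\<close>.\<close>
    have amgm: "x \<le> (2 ^ j * x\<^sup>2 + (1/2) ^ j) / 2" for x :: real
    proof -
      have "0 \<le> (2 ^ j * x - 1)\<^sup>2 * (1/2) ^ j" by simp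
      also have "\<dots> = ((2 ^ j * x)\<^sup>2 - 2 * (2 ^ j * x) + 1) * (1/2) ^ j"
        by (simp add: power2_diff)
      also have "\<dots> = 2 ^ j * x\<^sup>2 - 2 * x + (1/2) ^ j"
        by (simp add: algebra_simps power2_eq_square power_one_over divide_simps)
      finally show ?thesis by simp
    qed
    have "(LINT t|\<mu>. norm (?g (Suc j) t - ?g j t))
        \<le> (LINT t|\<mu>. (2 ^ j * (norm (?g (Suc j) t - ?g j t))\<^sup>2 + (1/2) ^ j) / 2)"
      using isq by (intro integral_mono ig amgm) auto
    also have "\<dots> = (2 ^ j * (LINT t|\<mu>. (norm (?g (Suc j) t - ?g j t))\<^sup>2) + (1/2) ^ j) / 2"
      using isq by simp
    also have "\<dots> \<le> (2 ^ j * (1/4) ^ j + (1/2) ^ j) / 2"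
      using sq[of j] by simp
    also have "2 ^ j * (1/4) ^ j = (1/2::real) ^ j"
      by (simp flip: power_mult_distrib)
    finally show ?thesis by simp
  qed
  have "AE t in \<mu>. (\<Sum>j. ennreal (norm (?g (Suc j) t - ?g j t))) \<noteq> \<infinity>"
  proof (rule nn_integral_PInf_AE)
    have m: "(\<lambda>t. ennreal (norm (?g (Suc j) t - ?g j t))) \<in> borel_measurable \<mu>" for j
      using borel_measurable_integrable[OF ig] by measurable
    then show "(\<lambda>t. \<Sum>j. ennreal (norm (?g (Suc j) t - ?g j t))) \<in> borel_measurable \<mu>"
      by measurable
    have "(\<integral>\<^sup>+ t. (\<Sum>j. ennreal (norm (?g (Suc j) t - ?g j t))) \<partial>\<mu>)
        = (\<Sum>j. \<integral>\<^sup>+ t. ennreal (norm (?g (Suc j) t - ?g j t)) \<partial>\<mu>)"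
      using m by (rule nn_integral_suminf)
    also have "\<dots> = (\<Sum>j. ennreal (LINT t|\<mu>. norm (?g (Suc j) t - ?g j t)))"
      using ig by (simp add: nn_integral_eq_integral)
    also have "\<dots> \<le> (\<Sum>j. ennreal ((1/2) ^ j))"
      using l1 by (intro suminf_le ennreal_leI) auto
    also have "\<dots> = ennreal (\<Sum>j. (1/2) ^ j)"
      by (intro suminf_ennreal2) (auto intro!: summable_geometric)
    also have "\<dots> < \<infinity>" by simp
    finally show "(\<integral>\<^sup>+ t. (\<Sum>j. ennreal (norm (?g (Suc j) t - ?g j t))) \<partial>\<mu>) \<noteq> \<infinity>"
      by simp
  qed
  then have "AE t in \<mu>. convergent (\<lambda>j. ?g j t)"
  proof eventually_elim
    case (elim t)
    then have "summable (\<lambda>j. norm (?g (Suc j) t - ?g j t))"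
      by (intro summable_suminf_not_top) auto
    then have "summable (\<lambda>j. ?g (Suc j) t - ?g j t)"
      by (rule summable_norm_cancel)
    then have "convergent (\<lambda>n. \<Sum>j<n. ?g (Suc j) t - ?g j t)"
      by (simp add: summable_iff_convergent)
    moreover have "(\<Sum>j<n. ?g (Suc j) t - ?g j t) = ?g n t - ?g 0 t" for n
      by (rule sum_lessThan_telescope)
    ultimately have "convergent (\<lambda>n. (?g n t - ?g 0 t) + ?g 0 t)"
      by (intro convergent_add convergent_const) simp
    then show ?case by simp
  qed
  with \<rho> \<rho>lim that show ?thesis by blast
qed

section \<open>Radial limits\<close>

definition has_radial_limit :: "(complex \<Rightarrow> 'a::topological_space) \<Rightarrow> complex \<Rightarrow> 'a \<Rightarrow> bool" where
  "has_radial_limit f t l \<longleftrightarrow> ((\<lambda>r. f (complex_of_real r * t)) \<longlongrightarrow> l) (at_left 1)"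

text \<open>Same body as \<open>boundary_value\<close> with a general target type, so that the two
  agree on matrix functions while scalar functions share the theory.\<close>

definition radial_limit :: "(complex \<Rightarrow> 'a::t2_space) \<Rightarrow> complex \<Rightarrow> 'a" where
  "radial_limit f t = Lim (at_left 1) (\<lambda>r. f (complex_of_real r * t))"

lemma radial_limit_eqI: "has_radial_limit f t l \<Longrightarrow> radial_limit f t = l"
  unfolding has_radial_limit_def radial_limit_def by (intro tendsto_Lim) auto

lemma has_radial_limit_sequentially:
  assumes "has_radial_limit f t l" "\<And>k. R k < 1" "R \<longlonglongrightarrow> 1"
  shows "(\<lambda>k. f (complex_of_real (R k) * t)) \<longlonglongrightarrow> l"
proof -
  have "filterlim R (at_left 1) sequentially"
    using assms(2,3) by (simp add: filterlim_at less_imp_neq)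
  then show ?thesis
    using assms(1) unfolding has_radial_limit_def by (rule filterlim_compose[rotated])
qed

text \<open>For fixed \<open>m\<close> and \<open>n\<close> the condition on the right is closed in \<open>t\<close>, so existence of a radial
  limit is a Borel condition.\<close>

lemma ex_radial_limit_iff:
  fixes f :: "complex \<Rightarrow> 'a::banach"
  shows "(\<exists>l. has_radial_limit f t l) \<longleftrightarrow>
     (\<forall>n. \<exists>m. \<forall>r\<in>{radii m..<1}. dist (f (of_real r * t)) (f (of_real (radii m) * t)) \<le> 1 / (real n + 1))"
    (is "?L \<longleftrightarrow> ?R")
proof
  assume ?L
  then obtain l where l: "((\<lambda>r. f (complex_of_real r * t)) \<longlongrightarrow> l) (at_left 1)"
    unfolding has_radial_limit_def by blast
  show ?R
  proof
    fix n :: nat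
    have "eventually (\<lambda>r. dist (f (complex_of_real r * t)) l < 1 / (2 * (real n + 1))) (at_left 1)"
      by (rule tendstoD[OF l]) simp
    then obtain b where b: "b < 1"
      "\<And>r. b < r \<Longrightarrow> r < 1 \<Longrightarrow> dist (f (complex_of_real r * t)) l < 1 / (2 * (real n + 1))"
      unfolding eventually_at_left_field by auto
    obtain m where m: "b < radii m"
      using order_tendstoD(1)[OF radii(3) b(1)] eventually_happens'[OF sequentially_bot] by blast
    have half: "1 / (2 * (real n + 1)) + 1 / (2 * (real n + 1)) = 1 / (real n + 1)"
      by (simp add: field_simps)
    have "dist (f (of_real r * t)) (f (of_real (radii m) * t)) \<le> 1 / (real n + 1)" if "r \<in> {radii m..<1}" for r
      using dist_triangle2[of "f (of_real r * t)" "f (of_real (radii m) * t)" l]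
        b(2)[of r] b(2)[OF m radii(2)] m that half by auto
    then show "\<exists>m. \<forall>r\<in>{radii m..<1}. dist (f (of_real r * t)) (f (of_real (radii m) * t)) \<le> 1 / (real n + 1)"
      by blast
  qed
next
  assume R: ?R
  let ?g = "\<lambda>r. f (complex_of_real r * t)"
  have osc: "\<exists>m. \<forall>r\<in>{radii m..<1}. dist (?g r) (?g (radii m)) < e" if e: "0 < e" for e
  proof -
    obtain n where n: "inverse (real (Suc n)) < e"
      using reals_Archimedean[OF e] by blast
    obtain m where "\<forall>r\<in>{radii m..<1}. dist (?g r) (?g (radii m)) \<le> 1 / (real n + 1)"
      using R by blast
    then show ?thesis
      using n by (intro exI[of _ m]) (force simp: inverse_eq_divide add.commute)
  qed
  have "Cauchy (\<lambda>k. ?g (radii k))"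
  proof (rule CauchyI')
    fix e :: real
    assume "0 < e"
    then have "0 < e / 2" by simp
    from osc[OF this] obtain m where m: "\<And>r. r \<in> {radii m..<1} \<Longrightarrow> dist (?g r) (?g (radii m)) < e / 2"
      by blast
    have "dist (?g (radii k)) (?g (radii j)) < e" if "m \<le> k" "m \<le> j" for k j
      using m[of "radii k"] m[of "radii j"] radii(2) radii_mono[OF that(1)] radii_mono[OF that(2)]
        dist_triangle2[of "?g (radii k)" "?g (radii j)" "?g (radii m)"] by auto
    then show "\<exists>M. \<forall>k\<ge>M. \<forall>j>k. dist (?g (radii k)) (?g (radii j)) < e"
      by (intro exI[of _ m]) auto
  qed
  then obtain l where l: "(\<lambda>k. ?g (radii k)) \<longlonglongrightarrow> l"
    using Cauchy_convergent convergent_def by blast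
  have "(?g \<longlongrightarrow> l) (at_left 1)"
  proof (rule tendstoI)
    fix e :: real
    assume "0 < e"
    then have "0 < e / 2" by simp
    from osc[OF this] obtain m where m: "\<And>r. r \<in> {radii m..<1} \<Longrightarrow> dist (?g r) (?g (radii m)) < e / 2"
      by blast
    have "dist l (?g (radii m)) \<le> e / 2"
      by (rule LIMSEQ_le_const2[OF tendsto_dist[OF l tendsto_const]])
         (use m radii(2) radii_mono in \<open>force intro!: exI[of _ m] less_imp_le\<close>)
    then have "dist (?g r) l < e" if "radii m < r" "r < 1" for r
      using m[of r] that dist_triangle2[of "?g r" l "?g (radii m)"] by auto
    then show "eventually (\<lambda>r. dist (?g r) l < e) (at_left 1)"
      unfolding eventually_at_left_field using radii(2) by blast
  qed
  then show ?L unfolding has_radial_limit_def by blast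
qed

lemma continuous_on_dilate_circle:
  assumes "continuous_on unit_disc f" "0 \<le> r" "r < 1"
  shows "continuous_on unit_circle (\<lambda>t. f (complex_of_real r * t))"
  by (rule continuous_on_compose2[OF assms(1)])
     (use assms(2,3) in \<open>auto intro!: continuous_intros simp: norm_mult\<close>)

lemma borel_measurable_dilate:
  assumes "continuous_on unit_disc f" "0 \<le> r" "r < 1"
  shows "(\<lambda>t. f (complex_of_real r * t)) \<in> borel_measurable \<mu>"
  by (intro borel_measurable_circleI continuous_on_dilate_circle assms)

text \<open>\<open>AE_circle_iff\<close> asks for this set when Fatou's theorem returns from angles
  to the circle.\<close>

lemma sets_ex_radial_limit:
  fixes f :: "complex \<Rightarrow> 'a::banach"
  assumes f: "continuous_on unit_disc f"
  shows "{t \<in> unit_circle. \<exists>l. has_radial_limit f t l} \<in> sets \<mu>"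
proof -
  define P where "P n m r t \<longleftrightarrow> dist (f (of_real r * t)) (f (of_real (radii m) * t)) \<le> 1 / (real n + 1)" for n m r t
  have "{t \<in> unit_circle. \<forall>r\<in>{radii m..<1}. P n m r t} \<in> sets \<mu>" for m n
  proof -
    have "closed (\<Inter>r\<in>{radii m..<1}. {t \<in> unit_circle. P n m r t})"
      unfolding P_def
    proof (intro closed_INT ballI continuous_on_closed_Collect_le)
      fix r assume "r \<in> {radii m..<1}"
      then have "0 \<le> r" "r < 1" using radii(1)[of m] by auto
      then show "continuous_on unit_circle (\<lambda>t. dist (f (of_real r * t)) (f (of_real (radii m) * t)))"
        by (intro continuous_on_dist continuous_on_dilate_circle f radii)
    qed auto
    moreover have "(\<Inter>r\<in>{radii m..<1}. {t \<in> unit_circle. P n m r t}) = {t \<in> unit_circle. \<forall>r\<in>{radii m..<1}. P n m r t}"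
      using radii(2)[of m] by force
    ultimately show ?thesis
      unfolding sets_circle_measure by (subst sets_restrict_space_iff) auto
  qed
  then have "{t \<in> space \<mu>. \<forall>r\<in>{radii m..<1}. P n m r t} \<in> sets \<mu>" for m n
    by simp
  then have "{t \<in> space \<mu>. \<forall>n. \<exists>m. \<forall>r\<in>{radii m..<1}. P n m r t} \<in> sets \<mu>"
    by (intro sets.sets_Collect_countable_All sets.sets_Collect_countable_Ex)
  also have "{t \<in> space \<mu>. \<forall>n. \<exists>m. \<forall>r\<in>{radii m..<1}. P n m r t} =
      {t \<in> unit_circle. \<exists>l. has_radial_limit f t l}"
    unfolding ex_radial_limit_iff P_def space_circle_measure ..
  finally show ?thesis .
qed

lemma borel_measurable_radial_limit:
  fixes f :: "complex \<Rightarrow> 'a::{banach,second_countable_topology}"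
  assumes f: "continuous_on unit_disc f"
  shows "radial_limit f \<in> borel_measurable \<mu>"
proof -
  have [measurable]: "(\<lambda>t. f (complex_of_real (radii k) * t)) \<in> borel_measurable \<mu>" for k
    by (rule borel_measurable_dilate[OF f radii(1,2)])
  have [measurable]: "Measurable.pred \<mu> (\<lambda>t. \<exists>l. has_radial_limit f t l)"
    using sets_ex_radial_limit[OF f] by (simp add: pred_def)
  \<comment> \<open>Where no limit exists, the description inside \<open>Lim\<close> is
    \<open>THE l. False\<close>, one constant for all such \<open>t\<close>. Elsewhere the sequence
    \<open>radii\<close> computes the limit.\<close>
  have eq: "radial_limit f t =
      (if \<exists>l. has_radial_limit f t l then lim (\<lambda>k. f (complex_of_real (radii k) * t)) else (THE l. False))" for t
  proof (cases "\<exists>l. has_radial_limit f t l")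
    case True
    then obtain l where l: "has_radial_limit f t l" ..
    have "lim (\<lambda>k. f (complex_of_real (radii k) * t)) = l"
      by (intro limI has_radial_limit_sequentially[OF l radii(2,3)])
    then show ?thesis using True radial_limit_eqI[OF l] by simp
  next
    case False
    then show ?thesis by (simp add: radial_limit_def has_radial_limit_def Topological_Spaces.Lim_def)
  qed
  have "(\<lambda>t. if \<exists>l. has_radial_limit f t l then lim (\<lambda>k. f (complex_of_real (radii k) * t)) else (THE l. False))
      \<in> borel_measurable \<mu>"
    by measurable
  then show ?thesis
    by (subst measurable_cong[OF eq])
qed

section \<open>Fatou's theorem for bounded holomorphic functions\<close>

lemma lebesgue_differentiation_real:
  fixes g :: "real \<Rightarrow> complex"
  assumes g: "integrable lborel g"
  shows "AE x in lborel. \<forall>e>0. \<exists>d>0. \<forall>y. y \<noteq> x \<and> \<bar>y - x\<bar> < d \<longrightarrow>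
    norm ((integral {min x y..max x y} g) /\<^sub>R \<bar>y - x\<bar> - g x) < e"
proof -
  have io: "h integrable_on cbox a b" if "integrable lborel h" for h :: "real \<Rightarrow> complex" and a b
  proof -
    have "set_integrable lborel {a..b} h"
      unfolding set_integrable_def using that by (intro integrable_mult_indicator) auto
    then show ?thesis
      using set_borel_integral_eq_integral(1) by auto
  qed
  \<comment> \<open>The differentiation theorem is applied to intervals with left endpoint
    \<open>x\<close>; the reflected function supplies those ending at \<open>x\<close>.\<close>
  have g': "integrable lborel (\<lambda>x. g (- x))"
    using lborel_integrable_real_affine[OF g, of "-1" 0] by simp
  obtain N1 where N1: "negligible N1"
    "\<And>x e. x \<notin> N1 \<Longrightarrow> 0 < e \<Longrightarrow> \<exists>d>0. \<forall>h. 0 < h \<and> h < d \<longrightarrow> norm (integral (cbox x (x + h *\<^sub>R One)) g /\<^sub>R h ^ DIM(real) - g x) < e"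
    using integrable_ccontinuous_explicit[of g, OF io[OF g]] by metis
  obtain N2 where N2: "negligible N2"
    "\<And>x e. x \<notin> N2 \<Longrightarrow> 0 < e \<Longrightarrow> \<exists>d>0. \<forall>h. 0 < h \<and> h < d \<longrightarrow> norm (integral (cbox x (x + h *\<^sub>R One)) (\<lambda>x. g (-x)) /\<^sub>R h ^ DIM(real) - g (- x)) < e"
    using integrable_ccontinuous_explicit[of "\<lambda>x. g (- x)", OF io[OF g']] by metis
  have "negligible (uminus ` N2)"
    by (rule negligible_differentiable_image_negligible[OF _ N2(1)]) (auto intro!: derivative_intros)
  then have "negligible (N1 \<union> uminus ` N2)"
    using N1(1) by (rule negligible_Un[rotated])
  then have "N1 \<union> uminus ` N2 \<in> null_sets lebesgue"
    by (simp add: negligible_iff_null_sets)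
  then have "AE x in lebesgue. x \<notin> N1 \<union> uminus ` N2"
    by (rule AE_not_in)
  then have "AE x in lborel. x \<notin> N1 \<union> uminus ` N2"
    by (simp add: AE_completion_iff)
  then show ?thesis
  proof eventually_elim
    case (elim x)
    then have x: "x \<notin> N1" "- x \<notin> N2" by (auto simp: image_iff)
    show ?case
    proof (intro allI impI)
      fix e :: real
      assume e: "0 < e"
      obtain d1 where d1: "d1 > 0" "\<And>h. 0 < h \<Longrightarrow> h < d1 \<Longrightarrow> norm (integral {x..x + h} g /\<^sub>R h - g x) < e"
        using N1(2)[OF x(1) e] by auto
      obtain d2 where d2: "d2 > 0" "\<And>h. 0 < h \<Longrightarrow> h < d2 \<Longrightarrow> norm (integral {- x..- x + h} (\<lambda>x. g (-x)) /\<^sub>R h - g x) < e"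
        using N2(2)[OF x(2) e] by auto
      have reflect: "integral {- x..- x + h} (\<lambda>x. g (-x)) = integral {x - h..x} g" for h
        using Henstock_Kurzweil_Integration.integral_reflect_real[of x "x - h" g] by simp
      show "\<exists>d>0. \<forall>y. y \<noteq> x \<and> \<bar>y - x\<bar> < d \<longrightarrow> norm ((integral {min x y..max x y} g) /\<^sub>R \<bar>y - x\<bar> - g x) < e"
      proof (intro exI[of _ "min d1 d2"] conjI allI impI)
        fix y assume y: "y \<noteq> x \<and> \<bar>y - x\<bar> < min d1 d2"
        show "norm ((integral {min x y..max x y} g) /\<^sub>R \<bar>y - x\<bar> - g x) < e"
        proof (cases "x < y")
          case True
          then show ?thesis using d1(2)[of "y - x"] y by simp
        next
          case False
          then have "\<bar>y - x\<bar> = x - y" by simp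
          then show ?thesis using False d2(2)[of "x - y"] y by (simp add: reflect)
        qed
      qed (use d1 d2 in auto)
    qed
  qed
qed

text \<open>Subtracting the vanishing Cauchy integral for the reflected point \<open>t0 / r\<close> turns the kernel of
  \<open>\<Psi>'(r t0)\<close> into one dominated by \<open>4 P(r t0, t) / |t - t0|\<close>.\<close>

lemma radial_limit_of_derivative:
  assumes cont: "continuous_on (cball 0 1) \<Psi>"
    and deriv: "\<And>z. z \<in> unit_disc \<Longrightarrow> (\<Psi> has_field_derivative f z) (at z)"
    and t0: "t0 \<in> unit_circle"
    and lim: "((\<lambda>t. (\<Psi> t - \<Psi> t0) / (t - t0)) \<longlongrightarrow> c) (at t0 within unit_circle)"
  shows "has_radial_limit f t0 c"
  unfolding has_radial_limit_def
proof (rule tendstoI)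
  fix e :: real
  assume e: "0 < e"
  \<comment> \<open>Removing the affine part leaves a function that vanishes at \<open>t0\<close>
    and whose quotient \<omega> tends to 0 there. At \<open>t0\<close> itself division by zero gives
    \<open>\<omega> t0 = 0\<close>.\<close>
  define \<Psi>1 where "\<Psi>1 z = \<Psi> z - \<Psi> t0 - c * (z - t0)" for z
  define \<omega> where "\<omega> t = norm (\<Psi>1 t) / norm (t - t0)" for t
  have cont1: "continuous_on (cball 0 1) \<Psi>1"
    unfolding \<Psi>1_def by (intro continuous_intros cont)
  have deriv1: "(\<Psi>1 has_field_derivative f z - c) (at z)" if "z \<in> unit_disc" for z
    unfolding \<Psi>1_def by (auto intro!: derivative_eq_intros deriv that)
  have hol1: "\<Psi>1 holomorphic_on unit_disc"
    unfolding holomorphic_on_open[OF open_ball] using deriv1 by blast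
  have cc: "continuous_on unit_circle \<Psi>1"
    by (rule continuous_on_subset[OF cont1]) auto
  \<comment> \<open>The estimate \<open>main\<close> carries a factor 4, so \<open>e / 2\<close>
    remains in the limit.\<close>
  define \<epsilon> where "\<epsilon> = e / 8"
  have \<epsilon>: "0 < \<epsilon>" using e by (simp add: \<epsilon>_def)
  obtain M where M: "\<And>t. t \<in> unit_circle \<Longrightarrow> norm (\<Psi>1 t) \<le> M"
    using compact_imp_bounded[OF compact_continuous_image[OF cc compact_sphere]] bounded_iff by (metis imageI)
  have M0: "0 \<le> M" using M[of 1] norm_ge_zero[of "\<Psi>1 1"] by (simp del: norm_ge_zero)
  have "eventually (\<lambda>t. dist ((\<Psi> t - \<Psi> t0) / (t - t0)) c < \<epsilon>) (at t0 within unit_circle)"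
    by (rule tendstoD[OF lim \<epsilon>])
  then obtain \<delta> where \<delta>: "0 < \<delta>"
    "\<And>t. t \<in> unit_circle \<Longrightarrow> t \<noteq> t0 \<Longrightarrow> dist t t0 < \<delta> \<Longrightarrow> dist ((\<Psi> t - \<Psi> t0) / (t - t0)) c < \<epsilon>"
    unfolding eventually_at by blast
  \<comment> \<open>At distance at least \<delta> the quotient \<omega> is at most
    \<open>M / \<delta>\<close>, and this value of \<open>B\<close> makes
    \<open>B * \<delta>\<^sup>2\<close> equal to it.\<close>
  define B where "B = M / \<delta> ^ 3"
  have B: "0 \<le> B" using M0 \<delta>(1) by (simp add: B_def)
  have bound: "\<bar>\<omega> t\<bar> \<le> \<epsilon> + B * (norm (t - t0))\<^sup>2" if t: "t \<in> unit_circle" for t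
  proof (cases "norm (t - t0) < \<delta>")
    case True
    have "\<omega> t \<le> \<epsilon>"
    proof (cases "t = t0")
      case True
      then show ?thesis using \<epsilon> by (simp add: \<omega>_def)
    next
      case False
      have "\<omega> t = norm ((\<Psi> t - \<Psi> t0) / (t - t0) - c)"
        using False by (simp add: \<omega>_def \<Psi>1_def diff_divide_distrib flip: norm_divide)
      then show ?thesis using \<delta>(2)[OF t False] True by (simp add: dist_norm)
    qed
    moreover have "0 \<le> B * (norm (t - t0))\<^sup>2" using B by simp
    ultimately show ?thesis by (simp add: \<omega>_def)
  next
    case False
    then have "\<omega> t \<le> M / \<delta>"
      unfolding \<omega>_def using M[OF t] \<delta>(1) M0 by (intro frac_le) auto
    also have "\<dots> = B * \<delta>\<^sup>2"
      using \<delta>(1) by (simp add: B_def power2_eq_square power3_eq_cube)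
    also have "\<dots> \<le> B * (norm (t - t0))\<^sup>2"
      using False \<delta>(1) B by (intro mult_left_mono power_mono) auto
    finally show ?thesis using \<epsilon> by (simp add: \<omega>_def)
  qed
  have \<omega>i: "integrable \<mu> \<omega>"
  proof (rule circle.integrable_const_bound)
    show "AE t in \<mu>. norm (\<omega> t) \<le> \<epsilon> + B * 2\<^sup>2"
    proof (rule AE_I2)
      fix t assume "t \<in> space \<mu>"
      then have t: "t \<in> unit_circle" by simp
      have "norm (t - t0) \<le> 2"
        using norm_triangle_ineq4[of t t0] t t0 by simp
      then have "B * (norm (t - t0))\<^sup>2 \<le> B * 2\<^sup>2"
        using B by (intro mult_left_mono power_mono) auto
      then show "norm (\<omega> t) \<le> \<epsilon> + B * 2\<^sup>2"
        using bound[OF t] by simp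
    qed
    have "\<Psi>1 \<in> borel_measurable \<mu>" "(\<lambda>t. t - t0) \<in> borel_measurable \<mu>"
      by (auto intro!: borel_measurable_circleI cc continuous_intros)
    then show "\<omega> \<in> borel_measurable \<mu>"
      unfolding \<omega>_def by measurable
  qed
  have main: "norm (f (of_real r * t0) - c) \<le> 4 * (\<epsilon> + 4 * B * (1 - r\<^sup>2))" if r: "0 < r" "r < 1" for r
  proof -
    \<comment> \<open>\<open>?w\<close> is the mirror image of \<open>?z\<close> in the circle; for
      \<open>t\<close> on the circle its distance to \<open>t\<close> is that of \<open>?z\<close>
      divided by \<open>r\<close>.\<close>
    let ?z = "of_real r * t0" and ?w = "t0 / of_real r"
    have z: "?z \<in> unit_disc" using t0 r by (simp add: norm_mult)
    have w: "norm ?w > 1" using t0 r by (simp add: norm_divide)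
    have ne: "t \<noteq> ?z" "t \<noteq> ?w" if "t \<in> unit_circle" for t
      using circle_neq_disc[OF that z] that w by auto
    have "f ?z - c = (LINT t|\<mu>. \<Psi>1 t * (t / (t - ?z)\<^sup>2))"
      by (rule DERIV_unique[OF deriv1[OF z] cauchy_deriv_circle[OF cont1 hol1 z]])
    also have "\<dots> = (LINT t|\<mu>. \<Psi>1 t * (t / (t - ?z)\<^sup>2)) - (LINT t|\<mu>. \<Psi>1 t * (t / (t - ?w)\<^sup>2))"
      using cauchy_deriv_exterior[OF cont1 hol1 w] by simp
    also have "\<dots> = (LINT t|\<mu>. \<Psi>1 t * (t / (t - ?z)\<^sup>2) - \<Psi>1 t * (t / (t - ?w)\<^sup>2))"
      using ne by (intro Bochner_Integration.integral_diff[symmetric] integrable_circleI continuous_intros cc) auto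
    finally have eq: "f ?z - c = (LINT t|\<mu>. \<Psi>1 t * (t / (t - ?z)\<^sup>2) - \<Psi>1 t * (t / (t - ?w)\<^sup>2))" .
    have "norm (f ?z - c) \<le> (LINT t|\<mu>. 4 * (poisson_kernel ?z t * \<omega> t))"
      unfolding eq
    proof (rule Bochner_Integration.integral_norm_bound_integral)
      show "integrable \<mu> (\<lambda>t. \<Psi>1 t * (t / (t - ?z)\<^sup>2) - \<Psi>1 t * (t / (t - ?w)\<^sup>2))"
        using ne by (intro integrable_circleI continuous_intros cc) auto
      show "integrable \<mu> (\<lambda>t. 4 * (poisson_kernel ?z t * \<omega> t))"
        by (intro integrable_mult_right integrable_poisson z \<omega>i)
      fix t assume "t \<in> space \<mu>"
      then have t: "t \<in> unit_circle" by simp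
      show "norm (\<Psi>1 t * (t / (t - ?z)\<^sup>2) - \<Psi>1 t * (t / (t - ?w)\<^sup>2)) \<le> 4 * (poisson_kernel ?z t * \<omega> t)"
      proof (cases "t = t0")
        case True
        then have "\<Psi>1 t = 0" by (simp add: \<Psi>1_def)
        then show ?thesis by (simp add: \<omega>_def)
      next
        case False
        define a where "a = norm (t - ?z)"
        have a: "0 < a" using ne[OF t] by (simp add: a_def)
        have reflect: "norm (of_real r * t - t0) = a"
        proof -
          have "t * cnj t = 1" "t0 * cnj t0 = 1"
            using t t0 by (simp_all add: complex_norm_square[symmetric])
          then have "of_real r * t - t0 = - (t * t0) * cnj (t - ?z)"
            by (simp add: algebra_simps)
          then show ?thesis
            using t t0 by (simp add: norm_mult a_def del: complex_cnj_diff)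
        qed
        have nw: "norm (t - ?w) = a / r"
        proof -
          have "t - ?w = (of_real r * t - t0) / of_real r"
            using r by (simp add: field_simps)
          then show ?thesis using r reflect by (simp add: norm_divide)
        qed
        have n1: "norm (?z - ?w) = (1 - r\<^sup>2) / r"
        proof -
          have "?z - ?w = - t0 * of_real ((1 - r\<^sup>2) / r)"
            using r by (simp add: field_simps power2_eq_square)
          then have "norm (?z - ?w) = \<bar>(1 - r\<^sup>2) / r\<bar>"
            using t0 by (simp only: norm_mult norm_minus_cancel norm_of_real) simp
          moreover have "r\<^sup>2 < 1" using r by (simp add: power_less_one_iff)
          ultimately show ?thesis using r by simp
        qed
        have n2: "norm ((t - ?z) + (t - ?w)) \<le> a + a / r"
          using norm_triangle_ineq[of "t - ?z" "t - ?w"] nw by (simp add: a_def)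
        \<comment> \<open>The difference of squares splits off \<open>?z - ?w\<close>, of size
          \<open>(1 - r\<^sup>2) / r\<close>. This small numerator is what the single Cauchy kernel
          lacks in comparison with the Poisson kernel.\<close>
        have n3: "t / (t - ?z)\<^sup>2 - t / (t - ?w)\<^sup>2 = t * ((?z - ?w) * ((t - ?z) + (t - ?w))) / ((t - ?z)\<^sup>2 * (t - ?w)\<^sup>2)"
        proof -
          have "t / A\<^sup>2 - t / B\<^sup>2 = t * ((B - A) * (A + B)) / (A\<^sup>2 * B\<^sup>2)" if "A \<noteq> 0" "B \<noteq> 0" for A B :: complex
            using that by (simp add: field_simps power2_eq_square)
          from this[of "t - ?z" "t - ?w"] ne[OF t] show ?thesis by simp
        qed
        have "norm (t / (t - ?z)\<^sup>2 - t / (t - ?w)\<^sup>2) =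
            norm t * (norm (?z - ?w) * norm ((t - ?z) + (t - ?w))) / ((norm (t - ?z))\<^sup>2 * (norm (t - ?w))\<^sup>2)"
          unfolding n3 by (simp only: norm_mult norm_divide norm_power)
        also have "\<dots> = ((1 - r\<^sup>2) / r * norm ((t - ?z) + (t - ?w))) / (a\<^sup>2 * (a / r)\<^sup>2)"
          using t unfolding n1 nw a_def[symmetric] by (simp only: mem_sphere_0 mult_1)
        also have "\<dots> \<le> ((1 - r\<^sup>2) / r * (a + a / r)) / (a\<^sup>2 * (a / r)\<^sup>2)"
          using r by (intro divide_right_mono mult_left_mono n2) (auto simp: abs_square_le_1)
        also have "\<dots> = (1 - r\<^sup>2) * (1 + r) / a ^ 3"
          using r a by (simp add: field_simps power2_eq_square power3_eq_cube)
        also have "\<dots> \<le> (1 - r\<^sup>2) * 2 / a ^ 3"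
          using r a by (intro divide_right_mono mult_left_mono) (auto simp: abs_square_le_1)
        finally have k: "norm (t / (t - ?z)\<^sup>2 - t / (t - ?w)\<^sup>2) \<le> (1 - r\<^sup>2) * 2 / a ^ 3" .
        have "\<Psi>1 t * (t / (t - ?z)\<^sup>2) - \<Psi>1 t * (t / (t - ?w)\<^sup>2) = \<Psi>1 t * (t / (t - ?z)\<^sup>2 - t / (t - ?w)\<^sup>2)"
          by (simp only: right_diff_distrib)
        then have "norm (\<Psi>1 t * (t / (t - ?z)\<^sup>2) - \<Psi>1 t * (t / (t - ?w)\<^sup>2))
            = norm (\<Psi>1 t) * norm (t / (t - ?z)\<^sup>2 - t / (t - ?w)\<^sup>2)"
          by (simp only: norm_mult)
        also have "\<dots> \<le> norm (\<Psi>1 t) * ((1 - r\<^sup>2) * 2 / a ^ 3)"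
          by (intro mult_left_mono k) simp
        also have "norm (\<Psi>1 t) = \<omega> t * norm (t - t0)"
          using False by (simp add: \<omega>_def)
        also have "\<omega> t * norm (t - t0) * ((1 - r\<^sup>2) * 2 / a ^ 3) \<le> \<omega> t * (2 * a) * ((1 - r\<^sup>2) * 2 / a ^ 3)"
          using circle_diff_le_radial[OF t t0, of r] r a
          by (intro mult_right_mono mult_left_mono) (auto simp: a_def \<omega>_def abs_square_le_1)
        also have "\<dots> = 4 * (poisson_kernel ?z t * \<omega> t)"
        proof -
          have "poisson_kernel ?z t = (1 - r\<^sup>2) / a\<^sup>2"
            using r t0 by (simp add: poisson_kernel_def norm_mult a_def)
          moreover have "w * (2 * a) * (x * 2 / a ^ 3) = 4 * (x / a\<^sup>2 * w)" for w x
            using a by (simp add: power2_eq_square power3_eq_cube)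
          ultimately show ?thesis by presburger
        qed
        finally show ?thesis .
      qed
    qed
    also have "\<dots> = 4 * poisson \<omega> ?z"
      unfolding poisson_def by (rule integral_mult_right_zero)
    also have "\<dots> \<le> 4 * (\<epsilon> + 4 * B * (1 - r\<^sup>2))"
      using poisson_approximate_identity[OF t0 _ r(2) \<omega>i B bound] r(1) by simp
    finally show ?thesis .
  qed
  have "((\<lambda>r. 4 * (\<epsilon> + 4 * B * (1 - r\<^sup>2))) \<longlongrightarrow> 4 * (\<epsilon> + 4 * B * (1 - 1\<^sup>2))) (at_left (1::real))"
    by (intro tendsto_intros)
  then have "eventually (\<lambda>r. 4 * (\<epsilon> + 4 * B * (1 - r\<^sup>2)) < e) (at_left (1::real))"
    by (rule order_tendstoD(2)) (use e in \<open>simp add: \<epsilon>_def\<close>)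
  moreover have "eventually (\<lambda>r. 0 < r \<and> r < 1) (at_left (1::real))"
    unfolding eventually_at_left_field by (intro exI[of _ 0]) auto
  ultimately show "eventually (\<lambda>r. dist (f (of_real r * t0)) c < e) (at_left 1)"
  proof eventually_elim
    case (elim r)
    then show ?case using main[of r] by (simp add: dist_norm)
  qed
qed

text \<open>Dividing by the difference quotient of \<open>cis\<close>, which tends to
  \<open>\<i> * cis x\<close>, changes the variable from the angle to the point. The local inverse
  of \<open>cis\<close> is built from \<open>Arg (t / cis x)\<close>, because division by
  \<open>cis x\<close> moves the base point to 1, away from the branch cut.\<close>

lemma tendsto_circle_quotient:
  assumes lim: "((\<lambda>\<theta>. (\<Psi> (cis \<theta>) - \<Psi> (cis x)) / of_real (\<theta> - x)) \<longlongrightarrow> D) (at x)"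
  shows "((\<lambda>t. (\<Psi> t - \<Psi> (cis x)) / (t - cis x)) \<longlongrightarrow> D / (\<i> * cis x)) (at (cis x) within unit_circle)"
proof -
  let ?\<theta> = "\<lambda>t. x + Arg (t / cis x)"
  have "((\<lambda>\<theta>. (cis \<theta> - cis x) / of_real (\<theta> - x)) \<longlongrightarrow> \<i> * cis x) (at x)"
  proof -
    have "(cis has_vector_derivative \<i> * cis x) (at x)"
      unfolding has_vector_derivative_def by (rule has_derivative_cis[OF has_derivative_ident])
    then have "((\<lambda>y. (cis y - cis x - (y - x) *\<^sub>R (\<i> * cis x)) /\<^sub>R norm (y - x)) \<longlongrightarrow> 0) (at x)"
      unfolding has_vector_derivative_def has_derivative_def by (simp add: Lim_ident_at)
    then have "((\<lambda>y. norm ((cis y - cis x - (y - x) *\<^sub>R (\<i> * cis x)) /\<^sub>R norm (y - x))) \<longlongrightarrow> 0) (at x)"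
      by (rule tendsto_norm_zero)
    then have "((\<lambda>y. norm ((cis y - cis x) / of_real (y - x) - \<i> * cis x)) \<longlongrightarrow> 0) (at x)"
    proof (rule Lim_transform_eventually)
      have "norm ((cis y - cis x - (y - x) *\<^sub>R (\<i> * cis x)) /\<^sub>R norm (y - x)) = norm ((cis y - cis x) / of_real (y - x) - \<i> * cis x)"
        if "y \<noteq> x" for y
      proof -
        have "(cis y - cis x) / of_real (y - x) - \<i> * cis x = (cis y - cis x - (y - x) *\<^sub>R (\<i> * cis x)) / of_real (y - x)"
          using that by (simp add: scaleR_conv_of_real diff_divide_distrib)
        then show ?thesis
          by (simp only: norm_divide norm_of_real norm_scaleR) (simp add: divide_inverse mult.commute)
      qed
      then show "eventually (\<lambda>y. norm ((cis y - cis x - (y - x) *\<^sub>R (\<i> * cis x)) /\<^sub>R norm (y - x))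
          = norm ((cis y - cis x) / of_real (y - x) - \<i> * cis x)) (at x)"
        by (simp add: eventually_at_filter)
    qed
    then show ?thesis
      by (rule LIM_zero_cancel[OF tendsto_norm_zero_cancel])
  qed
  then have "((\<lambda>\<theta>. ((\<Psi> (cis \<theta>) - \<Psi> (cis x)) / of_real (\<theta> - x)) / ((cis \<theta> - cis x) / of_real (\<theta> - x)))
      \<longlongrightarrow> D / (\<i> * cis x)) (at x)"
    by (intro tendsto_divide lim) auto
  then have Q: "((\<lambda>\<theta>. (\<Psi> (cis \<theta>) - \<Psi> (cis x)) / (cis \<theta> - cis x)) \<longlongrightarrow> D / (\<i> * cis x)) (at x)"
    by (rule Lim_transform_eventually) (auto simp: eventually_at_filter)
  have cis\<theta>: "cis (?\<theta> t) = t" if "t \<in> unit_circle" for t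
  proof -
    have "cis (Arg (t / cis x)) = t / cis x"
      using that by (subst cis_Arg) (auto simp: sgn_eq norm_divide)
    then show ?thesis by (simp add: cis_mult[symmetric])
  qed
  have "filterlim ?\<theta> (at x) (at (cis x) within unit_circle)"
    unfolding filterlim_at
  proof
    have "((\<lambda>t. x + Arg (t / cis x)) \<longlongrightarrow> x + Arg (cis x / cis x)) (at (cis x) within unit_circle)"
      by (intro tendsto_intros isCont_tendsto_compose[OF continuous_at_Arg]) auto
    then show "(?\<theta> \<longlongrightarrow> x) (at (cis x) within unit_circle)" by simp
    have "?\<theta> t \<noteq> x" if "t \<in> unit_circle" "t \<noteq> cis x" for t
      using cis\<theta>[OF that(1)] that(2) by metis
    then show "eventually (\<lambda>t. ?\<theta> t \<in> UNIV \<and> ?\<theta> t \<noteq> x) (at (cis x) within unit_circle)"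
      unfolding eventually_at_filter by (intro always_eventually) blast
  qed
  from filterlim_compose[OF Q this]
  show ?thesis
    by (rule Lim_transform_eventually) (use cis\<theta> in \<open>auto simp: eventually_at_filter intro!: always_eventually\<close>)
qed

text \<open>The primitive \<open>\<Phi>\<close> of \<open>f\<close> is Lipschitz and extends to the closed disc; its boundary function is an
  indefinite integral, hence differentiable almost everywhere.\<close>

theorem fatou_bounded_holomorphic:
  assumes f: "f holomorphic_on unit_disc" and M: "\<And>z. z \<in> unit_disc \<Longrightarrow> norm (f z) \<le> M"
  shows "AE t in \<mu>. \<exists>l. has_radial_limit f t l"
proof -
  obtain \<rho> :: "nat \<Rightarrow> real" where \<rho>: "\<And>j. 0 \<le> \<rho> j" "\<And>j. \<rho> j < 1" "\<rho> \<longlonglongrightarrow> 1"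
    and conv: "AE t in \<mu>. convergent (\<lambda>j. f (of_real (\<rho> j) * t))"
    using AE_convergent_dilates[OF f M] by metis
  have M0: "0 \<le> M" using M[of 0] norm_ge_zero[of "f 0"] by (simp del: norm_ge_zero)
  obtain \<Phi> where \<Phi>: "\<And>z. z \<in> unit_disc \<Longrightarrow> (\<Phi> has_field_derivative f z) (at z)"
    using holomorphic_convex_primitive'[OF _ _ f] by (metis at_within_open convex_ball open_ball)
  have "M-lipschitz_on unit_disc \<Phi>"
  proof (rule lipschitz_onI[OF _ M0])
    fix x y :: complex
    assume "x \<in> unit_disc" "y \<in> unit_disc"
    then show "dist (\<Phi> x) (\<Phi> y) \<le> M * dist x y"
      unfolding dist_norm
      by (intro field_differentiable_bound[of unit_disc \<Phi> f] M) (auto intro!: DERIV_subset[OF \<Phi>])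
  qed
  then obtain \<Psi> where "uniformly_continuous_on (closure unit_disc) \<Psi>" and \<Psi>: "\<And>z. z \<in> unit_disc \<Longrightarrow> \<Phi> z = \<Psi> z"
    using uniformly_continuous_on_extension_on_closure[OF lipschitz_on_uniformly_continuous] by metis
  then have cont: "continuous_on (cball 0 1) \<Psi>"
    using uniformly_continuous_imp_continuous by fastforce
  have d\<Psi>: "(\<Psi> has_field_derivative f z) (at z)" if "z \<in> unit_disc" for z
    by (rule has_field_derivative_transform_within_open[OF \<Phi>[OF that] open_ball that \<Psi>])
  \<comment> \<open>\<open>h j\<close> is the angular derivative of \<Psi> on the circle of radius
    \<open>\<rho> j\<close>; its limit \<open>g\<close> becomes the density of \<Psi> on the unit
    circle.\<close>
  define h where "h j \<theta> = f (of_real (\<rho> j) * cis \<theta>) * (of_real (\<rho> j) * \<i> * cis \<theta>)" for j \<theta>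
  define g where "g \<theta> = (if \<theta> \<in> {0..2*pi} then lim (\<lambda>j. h j \<theta>) else 0)" for \<theta>
  have in_disc: "of_real (\<rho> j) * cis \<theta> \<in> unit_disc" for j \<theta>
    by (rule dilate_in_disc[OF \<rho>(1,2)]) simp
  have conth: "continuous_on S (h j)" for j S
    unfolding h_def
    by (intro continuous_intros continuous_on_compose2[OF holomorphic_on_imp_continuous_on[OF f]])
       (use in_disc in auto)
  have [measurable]: "h j \<in> borel_measurable borel" for j
    by (intro borel_measurable_continuous_onI conth)
  have [measurable]: "g \<in> borel_measurable borel"
    unfolding g_def by measurable
  have hM: "norm (h j \<theta>) \<le> M" for j \<theta>
  proof -
    have "norm (h j \<theta>) = norm (f (of_real (\<rho> j) * cis \<theta>)) * \<rho> j"
      using \<rho>(1)[of j] by (simp add: h_def norm_mult)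
    also have "\<dots> \<le> M * 1"
      using \<rho>(1,2)[of j] by (intro mult_mono M in_disc M0) (auto simp: less_imp_le)
    finally show ?thesis by simp
  qed
  have limh: "AE \<theta> in lborel. \<theta> \<in> {0..2*pi} \<longrightarrow> (\<lambda>j. h j \<theta>) \<longlonglongrightarrow> g \<theta>"
  proof -
    have m: "{t \<in> unit_circle. convergent (\<lambda>j. f (of_real (\<rho> j) * t))} \<in> sets \<mu>"
    proof -
      have [measurable]: "(\<lambda>t. f (of_real (\<rho> j) * t)) \<in> borel_measurable \<mu>" for j
        by (intro borel_measurable_dilate holomorphic_on_imp_continuous_on f \<rho>)
      have "{t \<in> space \<mu>. Cauchy (\<lambda>j. f (of_real (\<rho> j) * t))} \<in> sets \<mu>"
        by measurable
      then show ?thesis by (simp add: Cauchy_convergent_iff)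
    qed
    have "AE \<theta> in lborel. \<theta> \<in> {0..2*pi} \<longrightarrow> convergent (\<lambda>j. f (of_real (\<rho> j) * cis \<theta>))"
      using conv unfolding AE_circle_iff[OF m] .
    then show ?thesis
    proof eventually_elim
      case (elim \<theta>)
      show ?case
      proof
        assume \<theta>: "\<theta> \<in> {0..2*pi}"
        have "convergent \<rho>" using \<rho>(3) by (auto simp: convergent_def)
        then have "convergent (\<lambda>j. h j \<theta>)"
          unfolding h_def using elim \<theta>
          by (intro convergent_mult convergent_const bounded_linear.convergent[OF bounded_linear_of_real]) auto
        then show "(\<lambda>j. h j \<theta>) \<longlonglongrightarrow> g \<theta>"
          using \<theta> by (simp add: g_def convergent_LIMSEQ_iff)
      qed
    qed
  qed
  have dct: "integrable lborel (\<lambda>\<theta>. indicator {a..b} \<theta> *\<^sub>R g \<theta>)"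
    "(\<lambda>j. LINT \<theta>|lborel. indicator {a..b} \<theta> *\<^sub>R h j \<theta>) \<longlonglongrightarrow> (LINT \<theta>|lborel. indicator {a..b} \<theta> *\<^sub>R g \<theta>)"
    if ab: "0 \<le> a" "b \<le> 2*pi" for a b
  proof -
    have w: "integrable lborel (\<lambda>\<theta>. indicator {a..b} \<theta> * M)"
      by (intro integrable_mult_left integrable_real_indicator emeasure_compact_finite) auto
    have l: "AE \<theta> in lborel. (\<lambda>j. indicator {a..b} \<theta> *\<^sub>R h j \<theta>) \<longlonglongrightarrow> indicator {a..b} \<theta> *\<^sub>R g \<theta>"
      using limh
    proof eventually_elim
      case (elim \<theta>)
      then show ?case using ab by (cases "\<theta> \<in> {a..b}") (auto intro!: tendsto_scaleR)
    qed
    have b: "AE \<theta> in lborel. norm (indicator {a..b} \<theta> *\<^sub>R h j \<theta>) \<le> indicator {a..b} \<theta> * M" for j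
      using hM[of j] by (auto simp: indicator_def)
    show "integrable lborel (\<lambda>\<theta>. indicator {a..b} \<theta> *\<^sub>R g \<theta>)"
      by (rule integrable_dominated_convergence[OF _ _ w l b]) auto
    show "(\<lambda>j. LINT \<theta>|lborel. indicator {a..b} \<theta> *\<^sub>R h j \<theta>) \<longlonglongrightarrow> (LINT \<theta>|lborel. indicator {a..b} \<theta> *\<^sub>R g \<theta>)"
      by (rule integral_dominated_convergence[OF _ _ w l b]) auto
  qed
  have gi: "integrable lborel g"
  proof -
    have "(\<lambda>\<theta>. indicator {0..2*pi} \<theta> *\<^sub>R g \<theta>) = g"
      by (auto simp: g_def indicator_def)
    then show ?thesis using dct(1)[of 0 "2*pi"] by simp
  qed
  \<comment> \<open>On the smaller circles this is the fundamental theorem of calculus for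
    \<open>h j\<close>. Bounded convergence and continuity of \<Psi> on the closed disc carry it to
    radius 1.\<close>
  have ftc: "\<Psi> (cis b) - \<Psi> (cis a) = integral {a..b} g" if ab: "0 \<le> a" "a \<le> b" "b \<le> 2*pi" for a b
  proof -
    have "(LINT \<theta>|lborel. indicator {a..b} \<theta> *\<^sub>R h j \<theta>) = \<Psi> (of_real (\<rho> j) * cis b) - \<Psi> (of_real (\<rho> j) * cis a)" for j
    proof -
      have "(h j has_integral \<Psi> (of_real (\<rho> j) * cis b) - \<Psi> (of_real (\<rho> j) * cis a)) {a..b}"
      proof (rule fundamental_theorem_of_calculus[OF ab(2)])
        fix \<theta>
        have "((\<lambda>\<theta>. of_real (\<rho> j) * cis \<theta>) has_vector_derivative (of_real (\<rho> j) * \<i> * cis \<theta>)) (at \<theta> within {a..b})"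
          unfolding has_vector_derivative_def
          by (auto intro!: derivative_eq_intros simp: scaleR_conv_of_real mult_ac)
        from field_vector_diff_chain_within[OF this has_field_derivative_at_within[OF d\<Psi>[OF in_disc]]]
        show "((\<lambda>\<theta>. \<Psi> (of_real (\<rho> j) * cis \<theta>)) has_vector_derivative h j \<theta>) (at \<theta> within {a..b})"
          by (simp add: h_def o_def mult_ac)
      qed
      moreover have "(LBINT \<theta>:{a..b}. h j \<theta>) = integral {a..b} (h j)"
        by (intro set_borel_integral_eq_integral(2) borel_integrable_atLeastAtMost' conth)
      ultimately show ?thesis
        unfolding set_lebesgue_integral_def by (simp add: integral_unique)
    qed
    then have 1: "(\<lambda>j. \<Psi> (of_real (\<rho> j) * cis b) - \<Psi> (of_real (\<rho> j) * cis a)) \<longlonglongrightarrow> (LINT \<theta>|lborel. indicator {a..b} \<theta> *\<^sub>R g \<theta>)"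
      using dct(2)[of a b] ab by simp
    have "(\<lambda>j. \<Psi> (of_real (\<rho> j) * cis \<theta>)) \<longlonglongrightarrow> \<Psi> (of_real 1 * cis \<theta>)" for \<theta>
    proof (rule continuous_on_tendsto_compose[OF cont])
      show "(\<lambda>j. complex_of_real (\<rho> j) * cis \<theta>) \<longlonglongrightarrow> of_real 1 * cis \<theta>"
        by (intro tendsto_intros \<rho>(3))
    qed (use in_disc in \<open>auto intro!: always_eventually simp: less_imp_le\<close>)
    then have 2: "(\<lambda>j. \<Psi> (of_real (\<rho> j) * cis b) - \<Psi> (of_real (\<rho> j) * cis a)) \<longlonglongrightarrow> \<Psi> (cis b) - \<Psi> (cis a)"
      by (intro tendsto_diff) auto
    have "\<Psi> (cis b) - \<Psi> (cis a) = (LBINT \<theta>:{a..b}. g \<theta>)"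
      unfolding set_lebesgue_integral_def by (rule LIMSEQ_unique[OF 2 1])
    also have "\<dots> = integral {a..b} g"
      by (rule set_borel_integral_eq_integral(2)) (use dct(1)[of a b] ab in \<open>simp add: set_integrable_def\<close>)
    finally show ?thesis .
  qed
  \<comment> \<open>The endpoints are excluded so that a whole neighbourhood of \<open>x\<close>
    lies in the parameter interval, where \<open>ftc\<close> is available.\<close>
  have "AE x in lborel. x \<noteq> 0 \<and> x \<noteq> 2*pi"
    by (intro eventually_conj AE_lborel_singleton)
  with lebesgue_differentiation_real[OF gi]
  have "AE x in lborel. x \<in> {0..2*pi} \<longrightarrow> (\<exists>l. has_radial_limit f (cis x) l)"
  proof eventually_elim
    case (elim x)
    show ?case
    proof
      assume "x \<in> {0..2*pi}"
      with elim have x: "0 < x" "x < 2*pi" by auto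
      have "((\<lambda>\<theta>. (\<Psi> (cis \<theta>) - \<Psi> (cis x)) / of_real (\<theta> - x)) \<longlongrightarrow> g x) (at x)"
      proof (rule tendstoI)
        fix e :: real
        assume "0 < e"
        then obtain d where d: "0 < d" "\<And>y. y \<noteq> x \<Longrightarrow> \<bar>y - x\<bar> < d \<Longrightarrow>
            norm ((integral {min x y..max x y} g) /\<^sub>R \<bar>y - x\<bar> - g x) < e"
          using elim by blast
        show "eventually (\<lambda>\<theta>. dist ((\<Psi> (cis \<theta>) - \<Psi> (cis x)) / of_real (\<theta> - x)) (g x) < e) (at x)"
          unfolding eventually_at
        proof (intro exI[of _ "min d (min x (2*pi - x))"] conjI ballI impI)
          fix y assume "y \<noteq> x \<and> dist y x < min d (min x (2*pi - x))"
          then have y: "y \<noteq> x" "\<bar>y - x\<bar> < d" "0 \<le> y" "y \<le> 2*pi" by (auto simp: dist_real_def)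
          have "(\<Psi> (cis y) - \<Psi> (cis x)) / of_real (y - x) = (integral {min x y..max x y} g) /\<^sub>R \<bar>y - x\<bar>"
          proof (cases "x < y")
            case True
            then show ?thesis using ftc[of x y] x y by (simp add: scaleR_conv_of_real divide_inverse mult.commute)
          next
            case False
            then have "y < x" using y by simp
            then have "integral {min x y..max x y} g = \<Psi> (cis x) - \<Psi> (cis y)"
              using ftc[of y x] x y by simp
            moreover have "\<bar>y - x\<bar> = x - y" using \<open>y < x\<close> by simp
            moreover have "(\<Psi> (cis y) - \<Psi> (cis x)) / of_real (y - x) = (\<Psi> (cis x) - \<Psi> (cis y)) / of_real (x - y)"
              by (metis minus_diff_eq minus_divide_divide of_real_minus)
            ultimately show ?thesis
              by (simp add: scaleR_conv_of_real divide_inverse mult.commute)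
          qed
          then show "dist ((\<Psi> (cis y) - \<Psi> (cis x)) / of_real (y - x)) (g x) < e"
            using d(2)[OF y(1,2)] by (simp add: dist_norm)
        qed (use d x in auto)
      qed
      then have "has_radial_limit f (cis x) (g x / (\<i> * cis x))"
        by (intro radial_limit_of_derivative[OF cont d\<Psi>] tendsto_circle_quotient) auto
      then show "\<exists>l. has_radial_limit f (cis x) l" ..
    qed
  qed
  then show ?thesis
    unfolding AE_circle_iff[OF sets_ex_radial_limit[OF holomorphic_on_imp_continuous_on[OF f]]] .
qed

section \<open>Uniform integrability\<close>

text \<open>Serves both the absolute continuity of the integral and, in part (i), the limit of the
  outer factors at 0.\<close>

lemma integral_excess_tendsto_0:
  fixes h :: "complex \<Rightarrow> real"
  assumes h: "integrable \<mu> h"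
  shows "(\<lambda>n. LINT t|\<mu>. max 0 (\<bar>h t\<bar> - real n)) \<longlonglongrightarrow> 0"
proof -
  have [measurable]: "h \<in> borel_measurable \<mu>" using h by simp
  have "(\<lambda>n. LINT t|\<mu>. max 0 (\<bar>h t\<bar> - real n)) \<longlonglongrightarrow> (LINT t|\<mu>. 0)"
  proof (rule integral_dominated_convergence[where w = "\<lambda>t. \<bar>h t\<bar>"])
    show "AE t in \<mu>. (\<lambda>n. max 0 (\<bar>h t\<bar> - real n)) \<longlonglongrightarrow> 0"
    proof (rule AE_I2)
      fix t
      obtain N :: nat where "\<bar>h t\<bar> < real N" using reals_Archimedean2 by blast
      then have "eventually (\<lambda>n. max 0 (\<bar>h t\<bar> - real n) = 0) sequentially"
        unfolding eventually_sequentially by (intro exI[of _ N]) auto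
      then show "(\<lambda>n. max 0 (\<bar>h t\<bar> - real n)) \<longlonglongrightarrow> 0" by (rule tendsto_eventually)
    qed
  qed (use h in auto)
  then show ?thesis by simp
qed

lemma integral_absolute_continuity:
  assumes h: "integrable \<mu> h" and e: "0 < \<epsilon>"
  obtains \<delta> where "0 < \<delta>"
    "\<And>\<Delta>. \<Delta> \<in> sets \<mu> \<Longrightarrow> measure \<mu> \<Delta> < \<delta> \<Longrightarrow> (LINT t:\<Delta>|\<mu>. \<bar>h t\<bar>) < (\<epsilon>::real)"
proof -
  have [measurable]: "h \<in> borel_measurable \<mu>" using h by simp
  from integral_excess_tendsto_0[OF h] have "eventually (\<lambda>n. (LINT t|\<mu>. max 0 (\<bar>h t\<bar> - real n)) < \<epsilon> / 2) sequentially"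
    by (rule order_tendstoD(2)) (use e in simp)
  then obtain n where n: "(LINT t|\<mu>. max 0 (\<bar>h t\<bar> - real n)) < \<epsilon> / 2"
    using eventually_happens'[OF sequentially_bot] by blast
  have it: "integrable \<mu> (\<lambda>t. max 0 (\<bar>h t\<bar> - real n))"
    using h by (rule Bochner_Integration.integrable_bound) (auto simp: max_def)
  show ?thesis
  proof
    \<comment> \<open>The part of \<open>\<bar>h t\<bar>\<close> above level \<open>n\<close>
      contributes less than \<open>\<epsilon> / 2\<close>, the part below at most \<open>n\<close>
      times the measure of \<Delta>. The summand 1 covers \<open>n = 0\<close>.\<close>
    show "0 < \<epsilon> / (2 * (real n + 1))" using e by simp
    fix \<Delta>
    assume \<Delta>[measurable]: "\<Delta> \<in> sets \<mu>" and small: "measure \<mu> \<Delta> < \<epsilon> / (2 * (real n + 1))"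
    have "(LINT t:\<Delta>|\<mu>. \<bar>h t\<bar>) \<le> (LINT t|\<mu>. max 0 (\<bar>h t\<bar> - real n) + real n * indicator \<Delta> t)"
      unfolding set_lebesgue_integral_def
    proof (rule integral_mono)
      show "integrable \<mu> (\<lambda>t. indicator \<Delta> t *\<^sub>R \<bar>h t\<bar>)"
        using h by (intro integrable_mult_indicator) auto
      show "integrable \<mu> (\<lambda>t. max 0 (\<bar>h t\<bar> - real n) + real n * indicator \<Delta> t)"
        using it by (auto simp: circle.emeasure_eq_measure)
    qed (auto simp: indicator_def)
    also have "\<dots> = (LINT t|\<mu>. max 0 (\<bar>h t\<bar> - real n)) + real n * measure \<mu> \<Delta>"
      using it sets.sets_into_space[OF \<Delta>]
      by (subst Bochner_Integration.integral_add) (auto simp: circle.emeasure_eq_measure Int_absorb2)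
    also have "real n * measure \<mu> \<Delta> \<le> real n * (\<epsilon> / (2 * (real n + 1)))"
      using small by (intro mult_left_mono) auto
    also have "\<dots> \<le> \<epsilon> / 2"
      using e by (simp add: field_simps)
    finally show "(LINT t:\<Delta>|\<mu>. \<bar>h t\<bar>) < \<epsilon>" using n by simp
  qed
qed

lemma uniformly_integrable_reindex:
  assumes "uniformly_integrable I f" "\<And>j. j \<in> J \<Longrightarrow> \<phi> j \<in> I"
  shows "uniformly_integrable J (\<lambda>j. f (\<phi> j))"
  using assms unfolding uniformly_integrable_def by blast

text \<open>The transfer principle for all families below: logarithms turn products, powers and
  determinants into affine bounds of this shape. With \<open>a = 0\<close> and the zero family it
  expresses domination by one integrable function.\<close>

lemma uniformly_integrable_dominated:
  assumes ui: "uniformly_integrable I f" and a: "0 \<le> a" and h: "integrable \<mu> h"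
    and m: "\<And>i. i \<in> I \<Longrightarrow> g i \<in> borel_measurable \<mu>"
    and le: "\<And>i. i \<in> I \<Longrightarrow> AE t in \<mu>. \<bar>g i t\<bar> \<le> a * \<bar>f i t\<bar> + h t"
  shows "uniformly_integrable I g"
proof -
  have fi: "integrable \<mu> (f i)" if "i \<in> I" for i
    using ui that unfolding uniformly_integrable_def by blast
  have dom: "integrable \<mu> (\<lambda>t. a * \<bar>f i t\<bar> + h t)" if "i \<in> I" for i
    using fi[OF that] h by auto
  have gi: "integrable \<mu> (g i)" if "i \<in> I" for i
    using le[OF that] by (intro Bochner_Integration.integrable_bound[OF dom[OF that] m[OF that]]) auto
  obtain C where C: "\<And>i. i \<in> I \<Longrightarrow> (LINT t|\<mu>. \<bar>f i t\<bar>) \<le> C"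
    using ui unfolding uniformly_integrable_def by blast
  have "(LINT t|\<mu>. \<bar>g i t\<bar>) \<le> a * C + (LINT t|\<mu>. h t)" if i: "i \<in> I" for i
  proof -
    have "(LINT t|\<mu>. \<bar>g i t\<bar>) \<le> (LINT t|\<mu>. a * \<bar>f i t\<bar> + h t)"
      using gi[OF i] by (intro integral_mono_AE dom le i) auto
    also have "\<dots> = a * (LINT t|\<mu>. \<bar>f i t\<bar>) + (LINT t|\<mu>. h t)"
      using fi[OF i] h by simp
    also have "\<dots> \<le> a * C + (LINT t|\<mu>. h t)"
      using a C[OF i] by (simp add: mult_left_mono)
    finally show ?thesis .
  qed
  moreover have "\<exists>\<delta>>0. \<forall>i\<in>I. \<forall>\<Delta>\<in>sets \<mu>. measure \<mu> \<Delta> < \<delta> \<longrightarrow> (LINT t:\<Delta>|\<mu>. \<bar>g i t\<bar>) < \<epsilon>"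
    if e: "0 < \<epsilon>" for \<epsilon>
  proof -
    obtain \<delta>1 where \<delta>1: "0 < \<delta>1" "\<And>\<Delta>. \<Delta> \<in> sets \<mu> \<Longrightarrow> measure \<mu> \<Delta> < \<delta>1 \<Longrightarrow> (LINT t:\<Delta>|\<mu>. \<bar>h t\<bar>) < \<epsilon> / 2"
      using integral_absolute_continuity[OF h, of "\<epsilon> / 2"] e by auto
    have "0 < \<epsilon> / (2 * (a + 1))" using e a by simp
    then obtain \<delta>2 where \<delta>2: "0 < \<delta>2" "\<And>i \<Delta>. i \<in> I \<Longrightarrow> \<Delta> \<in> sets \<mu> \<Longrightarrow> measure \<mu> \<Delta> < \<delta>2 \<Longrightarrow>
        (LINT t:\<Delta>|\<mu>. \<bar>f i t\<bar>) < \<epsilon> / (2 * (a + 1))"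
      using ui unfolding uniformly_integrable_def by meson
    have "(LINT t:\<Delta>|\<mu>. \<bar>g i t\<bar>) < \<epsilon>"
      if i: "i \<in> I" and \<Delta>: "\<Delta> \<in> sets \<mu>" "measure \<mu> \<Delta> < min \<delta>1 \<delta>2" for i \<Delta>
    proof -
      have ind: "integrable \<mu> (\<lambda>t. indicator \<Delta> t *\<^sub>R u t)" if "integrable \<mu> u" for u :: "complex \<Rightarrow> real"
        using that \<Delta> by (intro integrable_mult_indicator) auto
      have "(LINT t:\<Delta>|\<mu>. \<bar>g i t\<bar>) \<le>
          (LINT t|\<mu>. a * (indicator \<Delta> t *\<^sub>R \<bar>f i t\<bar>) + indicator \<Delta> t *\<^sub>R \<bar>h t\<bar>)"
        unfolding set_lebesgue_integral_def
      proof (rule integral_mono_AE)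
        show "integrable \<mu> (\<lambda>t. indicator \<Delta> t *\<^sub>R \<bar>g i t\<bar>)"
          using gi[OF i] by (intro ind) auto
        show "integrable \<mu> (\<lambda>t. a * (indicator \<Delta> t *\<^sub>R \<bar>f i t\<bar>) + indicator \<Delta> t *\<^sub>R \<bar>h t\<bar>)"
          using fi[OF i] h by (intro Bochner_Integration.integrable_add integrable_mult_right ind) auto
        show "AE t in \<mu>. indicator \<Delta> t *\<^sub>R \<bar>g i t\<bar> \<le> a * (indicator \<Delta> t *\<^sub>R \<bar>f i t\<bar>) + indicator \<Delta> t *\<^sub>R \<bar>h t\<bar>"
          using le[OF i] by eventually_elim (auto simp: indicator_def)
      qed
      also have "\<dots> = a * (LINT t:\<Delta>|\<mu>. \<bar>f i t\<bar>) + (LINT t:\<Delta>|\<mu>. \<bar>h t\<bar>)"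
      proof -
        have "integrable \<mu> (\<lambda>t. a * (indicator \<Delta> t *\<^sub>R \<bar>f i t\<bar>))"
          "integrable \<mu> (\<lambda>t. indicator \<Delta> t *\<^sub>R \<bar>h t\<bar>)"
          using fi[OF i] h by (auto intro!: integrable_mult_right ind simp del: real_scaleR_def)
        then show ?thesis
          unfolding set_lebesgue_integral_def by (simp only: Bochner_Integration.integral_add integral_mult_right_zero)
      qed
      also have "a * (LINT t:\<Delta>|\<mu>. \<bar>f i t\<bar>) \<le> a * (\<epsilon> / (2 * (a + 1)))"
        using \<delta>2(2)[OF i \<Delta>(1)] \<Delta>(2) a by (intro mult_left_mono) auto
      also have "\<dots> \<le> \<epsilon> / 2"
        using e a by (simp add: field_simps)
      also have "(LINT t:\<Delta>|\<mu>. \<bar>h t\<bar>) < \<epsilon> / 2"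
        using \<delta>1(2)[OF \<Delta>(1)] \<Delta>(2) by simp
      finally show ?thesis by simp
    qed
    then show ?thesis
      using \<delta>1(1) \<delta>2(1) by (intro exI[of _ "min \<delta>1 \<delta>2"]) auto
  qed
  ultimately show ?thesis
    unfolding uniformly_integrable_def using gi by blast
qed

lemma uniformly_integrable_const_zero: "uniformly_integrable I (\<lambda>i t. 0)"
  unfolding uniformly_integrable_def by (auto simp: set_lebesgue_integral_def intro: zero_less_one)

lemma vitali_convergence:
  fixes u :: "nat \<Rightarrow> complex \<Rightarrow> real"
  assumes ui: "uniformly_integrable UNIV u" and v[measurable]: "v \<in> borel_measurable \<mu>"
    and lim: "AE t in \<mu>. (\<lambda>n. u n t) \<longlonglongrightarrow> v t"
  shows "integrable \<mu> v" and "(\<lambda>n. LINT t|\<mu>. \<bar>u n t - v t\<bar>) \<longlonglongrightarrow> 0"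
proof -
  have ui': "integrable \<mu> (u n)" for n
    using ui unfolding uniformly_integrable_def by blast
  have [measurable]: "u n \<in> borel_measurable \<mu>" for n
    using ui'[of n] by simp
  obtain C where C: "\<And>n. (LINT t|\<mu>. \<bar>u n t\<bar>) \<le> C"
    using ui unfolding uniformly_integrable_def by blast
  show vi: "integrable \<mu> v"
  proof (rule integrableI_bounded[OF v])
    have "(\<integral>\<^sup>+ t. ennreal (norm (v t)) \<partial>\<mu>) = (\<integral>\<^sup>+ t. liminf (\<lambda>n. ennreal \<bar>u n t\<bar>) \<partial>\<mu>)"
    proof (rule nn_integral_cong_AE)
      show "AE t in \<mu>. ennreal (norm (v t)) = liminf (\<lambda>n. ennreal \<bar>u n t\<bar>)"
        using lim
      proof eventually_elim
        case (elim t)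
        then have "(\<lambda>n. ennreal \<bar>u n t\<bar>) \<longlonglongrightarrow> ennreal \<bar>v t\<bar>"
          by (intro tendsto_ennrealI tendsto_rabs)
        from lim_imp_Liminf[OF sequentially_bot this] show ?case by simp
      qed
    qed
    also have "\<dots> \<le> liminf (\<lambda>n. \<integral>\<^sup>+ t. ennreal \<bar>u n t\<bar> \<partial>\<mu>)"
      by (rule nn_integral_liminf) measurable
    also have "\<dots> \<le> liminf (\<lambda>n. ennreal C)"
      using C ui' by (intro Liminf_mono always_eventually allI) (simp add: nn_integral_eq_integral ennreal_leI)
    also have "\<dots> < \<infinity>" by (simp add: Liminf_const)
    finally show "(\<integral>\<^sup>+ t. ennreal (norm (v t)) \<partial>\<mu>) < \<infinity>" .
  qed
  show "(\<lambda>n. LINT t|\<mu>. \<bar>u n t - v t\<bar>) \<longlonglongrightarrow> 0"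
  proof (rule tendstoI)
    fix e :: real
    assume "0 < e"
    define \<epsilon> where "\<epsilon> = e / 4"
    have \<epsilon>: "0 < \<epsilon>" using \<open>0 < e\<close> by (simp add: \<epsilon>_def)
    obtain \<delta>1 where \<delta>1: "0 < \<delta>1" "\<And>\<Delta>. \<Delta> \<in> sets \<mu> \<Longrightarrow> measure \<mu> \<Delta> < \<delta>1 \<Longrightarrow> (LINT t:\<Delta>|\<mu>. \<bar>v t\<bar>) < \<epsilon>"
      using integral_absolute_continuity[OF vi \<epsilon>] by metis
    obtain \<delta>2 where \<delta>2: "0 < \<delta>2" "\<And>n \<Delta>. \<Delta> \<in> sets \<mu> \<Longrightarrow> measure \<mu> \<Delta> < \<delta>2 \<Longrightarrow>
        (LINT t:\<Delta>|\<mu>. \<bar>u n t\<bar>) < \<epsilon>"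
      using ui \<epsilon> unfolding uniformly_integrable_def by (metis UNIV_I)
    \<comment> \<open>Off \<open>D n\<close> the difference is at most \<epsilon>. The measure of
      \<open>D n\<close> tends to 0, so on \<open>D n\<close> uniform integrability of the
      \<open>u n\<close> and absolute continuity for \<open>v\<close> contribute less than
      \<epsilon> each.\<close>
    define D where "D n = {t \<in> space \<mu>. \<epsilon> < \<bar>u n t - v t\<bar>}" for n
    have D[measurable]: "D n \<in> sets \<mu>" for n
      unfolding D_def by measurable
    have "(\<lambda>n. LINT t|\<mu>. indicator (D n) t) \<longlonglongrightarrow> (LINT t|\<mu>. (0::real))"
    proof (rule integral_dominated_convergence[where w = "\<lambda>_. 1"])
      show "AE t in \<mu>. (\<lambda>n. indicator (D n) t :: real) \<longlonglongrightarrow> 0"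
        using lim
      proof eventually_elim
        case (elim t)
        have "eventually (\<lambda>n. dist (u n t) (v t) < \<epsilon>) sequentially"
          by (rule tendstoD[OF elim \<epsilon>])
        then have "eventually (\<lambda>n. indicator (D n) t = (0::real)) sequentially"
          by eventually_elim (auto simp: D_def indicator_def dist_real_def)
        then show ?case by (rule tendsto_eventually)
      qed
    qed (auto simp: indicator_def)
    then have "(\<lambda>n. measure \<mu> (D n)) \<longlonglongrightarrow> 0"
      using sets.sets_into_space[OF D] by (simp add: Int_absorb2)
    then have "eventually (\<lambda>n. measure \<mu> (D n) < min \<delta>1 \<delta>2) sequentially"
      using \<delta>1(1) \<delta>2(1) by (intro order_tendstoD(2)) auto
    then show "eventually (\<lambda>n. dist (LINT t|\<mu>. \<bar>u n t - v t\<bar>) 0 < e) sequentially"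
    proof eventually_elim
      case (elim n)
      have ind: "integrable \<mu> (\<lambda>t. indicator (D n) t *\<^sub>R \<bar>w t\<bar>)" if "integrable \<mu> w" for w :: "complex \<Rightarrow> real"
        using that D by (intro integrable_mult_indicator) auto
      have "(LINT t|\<mu>. \<bar>u n t - v t\<bar>) \<le>
          (LINT t|\<mu>. \<epsilon> + (indicator (D n) t *\<^sub>R \<bar>u n t\<bar> + indicator (D n) t *\<^sub>R \<bar>v t\<bar>))"
      proof (rule integral_mono)
        show "integrable \<mu> (\<lambda>t. \<bar>u n t - v t\<bar>)"
          using ui' vi by auto
        show "integrable \<mu> (\<lambda>t. \<epsilon> + (indicator (D n) t *\<^sub>R \<bar>u n t\<bar> + indicator (D n) t *\<^sub>R \<bar>v t\<bar>))"
          using ui' vi by (intro Bochner_Integration.integrable_add ind) auto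
        fix t assume "t \<in> space \<mu>"
        then show "\<bar>u n t - v t\<bar> \<le> \<epsilon> + (indicator (D n) t *\<^sub>R \<bar>u n t\<bar> + indicator (D n) t *\<^sub>R \<bar>v t\<bar>)"
          using \<epsilon> by (auto simp: D_def indicator_def)
      qed
      also have "\<dots> = \<epsilon> + ((LINT t:D n|\<mu>. \<bar>u n t\<bar>) + (LINT t:D n|\<mu>. \<bar>v t\<bar>))"
        unfolding set_lebesgue_integral_def using ind[OF ui'[of n]] ind[OF vi]
        by (simp del: real_scaleR_def)
      also have "\<dots> < \<epsilon> + (\<epsilon> + \<epsilon>)"
        using \<delta>1(2)[OF D, of n] \<delta>2(2)[OF D, of n] elim by (intro add_strict_left_mono add_strict_mono) auto
      finally have "(LINT t|\<mu>. \<bar>u n t - v t\<bar>) < e"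
        using \<epsilon> by (simp add: \<epsilon>_def)
      then show ?case by simp
    qed
  qed
qed

section \<open>The Smirnov class\<close>

definition scalar_smirnov :: "(complex \<Rightarrow> complex) \<Rightarrow> bool" where
  "scalar_smirnov f \<longleftrightarrow> f holomorphic_on unit_disc \<and>
     uniformly_integrable {0..<1} (\<lambda>r t. ln_plus (norm (f (complex_of_real r * t))))"

lemma ln_plus_nonneg: "0 \<le> ln_plus x"
  by (simp add: ln_plus_def)

lemma ln_plus_mono: "x \<le> y \<Longrightarrow> ln_plus x \<le> ln_plus y"
  unfolding ln_plus_def by (subst ln_le_cancel_iff) auto

lemma continuous_on_ln_plus [continuous_intros]: "continuous_on S f \<Longrightarrow> continuous_on S (\<lambda>x. ln_plus (f x))"
  unfolding ln_plus_def by (intro continuous_intros) auto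

lemma tendsto_ln_plus [tendsto_intros]: "(f \<longlongrightarrow> l) F \<Longrightarrow> ((\<lambda>x. ln_plus (f x)) \<longlongrightarrow> ln_plus l) F"
  unfolding ln_plus_def by (intro tendsto_intros) auto

lemma borel_measurable_ln_plus [measurable]: "ln_plus \<in> borel_measurable borel"
  unfolding ln_plus_def by measurable

lemma ln_plus_mult_le:
  assumes "0 \<le> x" "0 \<le> y"
  shows "ln_plus (x * y) \<le> ln_plus x + ln_plus y"
proof -
  have "max 1 (x * y) \<le> max 1 x * max 1 y"
    using assms mult_mono[of 1 "max 1 x" 1 "max 1 y"] mult_mono[of x "max 1 x" y "max 1 y"] by auto
  then have "ln (max 1 (x * y)) \<le> ln (max 1 x * max 1 y)"
    by (subst ln_le_cancel_iff) (auto intro!: mult_pos_pos)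
  also have "\<dots> = ln (max 1 x) + ln (max 1 y)"
    by (intro ln_mult_pos) auto
  finally show ?thesis by (simp add: ln_plus_def)
qed

text \<open>Through this bound the one-sided control of \<open>ln_plus\<close> yields uniform
  integrability of the two-sided truncated logarithm.\<close>

lemma abs_ln_max_le:
  assumes "0 < \<epsilon>" "\<epsilon> \<le> 1"
  shows "\<bar>ln (max \<epsilon> x)\<bar> \<le> ln_plus x + \<bar>ln \<epsilon>\<bar>"
proof (cases "1 \<le> x")
  case True
  then show ?thesis using assms by (simp add: ln_plus_def)
next
  case False
  have "ln \<epsilon> \<le> ln (max \<epsilon> x)" using assms by auto
  moreover have "ln (max \<epsilon> x) \<le> 0" using assms False by (subst ln_le_zero_iff) auto
  ultimately show ?thesis using ln_plus_nonneg[of x] by linarith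
qed

lemma smirnov_if_bounded:
  assumes f: "f holomorphic_on unit_disc" and M: "\<And>z. z \<in> unit_disc \<Longrightarrow> norm (f z) \<le> M"
  shows "scalar_smirnov f"
  unfolding scalar_smirnov_def
proof (intro conjI f)
  show "uniformly_integrable {0..<1} (\<lambda>r t. ln_plus (norm (f (complex_of_real r * t))))"
  proof (rule uniformly_integrable_dominated[OF uniformly_integrable_const_zero order_refl])
    show "integrable \<mu> (\<lambda>t. ln_plus M)" by simp
    fix r :: real
    assume r: "r \<in> {0..<1}"
    show "(\<lambda>t. ln_plus (norm (f (complex_of_real r * t)))) \<in> borel_measurable \<mu>"
      using r by (intro borel_measurable_circleI continuous_intros continuous_on_circle_dilate f) auto
    show "AE t in \<mu>. \<bar>ln_plus (norm (f (complex_of_real r * t)))\<bar> \<le> 0 * \<bar>0\<bar> + ln_plus M"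
      using r by (intro AE_I2) (auto intro!: ln_plus_mono M dilate_in_disc simp: ln_plus_nonneg simp del: mem_ball_0)
  qed
qed

text \<open>Vitali's theorem carries the inequality from the circles of radius
  \<open>radii k\<close> to the boundary. Radial limits are a hypothesis here because the statement
  is first applied to bounded functions, where Fatou's theorem gives them, in order to obtain them
  for the whole class.\<close>

lemma
  assumes sm: "scalar_smirnov f" and rad: "AE t in \<mu>. \<exists>l. has_radial_limit f t l"
    and e: "0 < \<epsilon>" "\<epsilon> \<le> 1"
  shows smirnov_integrable_ln_max: "integrable \<mu> (\<lambda>t. ln (max \<epsilon> (norm (radial_limit f t))))"
    and smirnov_ln_max_le: "z \<in> unit_disc \<Longrightarrow> ln (max \<epsilon> (norm (f z))) \<le> poisson (\<lambda>t. ln (max \<epsilon> (norm (radial_limit f t)))) z"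
proof -
  have f: "f holomorphic_on unit_disc"
    and ui: "uniformly_integrable {0..<1} (\<lambda>r t. ln_plus (norm (f (complex_of_real r * t))))"
    using sm by (auto simp: scalar_smirnov_def)
  have mx: "0 < max \<epsilon> x" for x using e by auto
  let ?u = "\<lambda>k t. ln (max \<epsilon> (norm (f (complex_of_real (radii k) * t))))"
  let ?v = "\<lambda>t. ln (max \<epsilon> (norm (radial_limit f t)))"
  have cu: "continuous_on unit_circle (?u k)" for k
    using mx radii by (intro continuous_intros continuous_on_circle_dilate f) (auto simp: less_le)
  have uiu: "uniformly_integrable UNIV ?u"
  proof (rule uniformly_integrable_dominated)
    show "uniformly_integrable UNIV (\<lambda>k t. ln_plus (norm (f (complex_of_real (radii k) * t))))"
      by (rule uniformly_integrable_reindex[OF ui]) (use radii in auto)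
    show "0 \<le> (1::real)" by simp
    show "integrable \<mu> (\<lambda>t. \<bar>ln \<epsilon>\<bar>)" by simp
    show "?u k \<in> borel_measurable \<mu>" for k
      by (intro borel_measurable_circleI cu)
    show "AE t in \<mu>. \<bar>?u k t\<bar> \<le> 1 * \<bar>ln_plus (norm (f (complex_of_real (radii k) * t)))\<bar> + \<bar>ln \<epsilon>\<bar>" for k
      using abs_ln_max_le[OF e] by (intro AE_I2) (simp add: ln_plus_nonneg)
  qed
  have [measurable]: "radial_limit f \<in> borel_measurable \<mu>"
    by (intro borel_measurable_radial_limit holomorphic_on_imp_continuous_on f)
  have vm: "?v \<in> borel_measurable \<mu>" by measurable
  have lim: "AE t in \<mu>. (\<lambda>k. ?u k t) \<longlonglongrightarrow> ?v t"
    using rad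
  proof eventually_elim
    case (elim t)
    then obtain l where l: "has_radial_limit f t l" ..
    have "(\<lambda>k. f (complex_of_real (radii k) * t)) \<longlonglongrightarrow> radial_limit f t"
      using has_radial_limit_sequentially[OF l radii(2,3)] radial_limit_eqI[OF l] by simp
    then show ?case using mx by (intro tendsto_intros) (auto simp: less_le)
  qed
  note V = vitali_convergence[OF uiu vm lim]
  show "integrable \<mu> ?v" by (rule V(1))
  assume z: "z \<in> unit_disc"
  have iu: "integrable \<mu> (?u k)" for k
    by (intro integrable_circleI cu)
  have "(\<lambda>k. poisson (?u k) z) \<longlonglongrightarrow> poisson ?v z"
    by (rule poisson_tendsto[OF z V(1) iu V(2)])
  moreover have "(\<lambda>k. ln (max \<epsilon> (norm (f (complex_of_real (radii k) * z))))) \<longlonglongrightarrow> ln (max \<epsilon> (norm (f z)))"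
  proof -
    have "(\<lambda>k. f (complex_of_real (radii k) * z)) \<longlonglongrightarrow> f (complex_of_real 1 * z)"
    proof (rule continuous_on_tendsto_compose[OF holomorphic_on_imp_continuous_on[OF f]])
      show "(\<lambda>k. complex_of_real (radii k) * z) \<longlonglongrightarrow> complex_of_real 1 * z"
        by (intro tendsto_intros radii)
      show "\<forall>\<^sub>F k in sequentially. complex_of_real (radii k) * z \<in> unit_disc"
        using z by (intro always_eventually allI dilate_in_disc radii) auto
    qed (use z in simp)
    then show ?thesis using mx by (intro tendsto_intros) (auto simp: less_le)
  qed
  ultimately show "ln (max \<epsilon> (norm (f z))) \<le> poisson ?v z"
    using ln_max_dilate_le_poisson[OF radii(1,2) f e(1) z]
    by (intro tendsto_le[OF sequentially_bot]) auto
qed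

text \<open>The truncation is removed first at the origin: \<open>f 0 \<noteq> 0\<close> bounds the
  integrals of the gaps between \<open>ln_plus\<close> and the truncated logarithm independently of
  the level. Fatou's lemma then makes the full gap integrable, and dominated convergence gives the
  inequality at every \<open>z\<close>.\<close>

lemma
  assumes sm: "scalar_smirnov f" and rad: "AE t in \<mu>. \<exists>l. has_radial_limit f t l"
    and f0: "f 0 \<noteq> 0"
  shows smirnov_nonzero_AE': "AE t in \<mu>. radial_limit f t \<noteq> 0"
    and smirnov_integrable_ln': "integrable \<mu> (\<lambda>t. ln (norm (radial_limit f t)))"
    and smirnov_norm_le': "z \<in> unit_disc \<Longrightarrow> norm (f z) \<le> exp (poisson (\<lambda>t. ln (norm (radial_limit f t))) z)"
proof -
  have f: "f holomorphic_on unit_disc"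
    using sm by (simp add: scalar_smirnov_def)
  define F where "F = radial_limit f"
  have [measurable]: "F \<in> borel_measurable \<mu>"
    unfolding F_def by (intro borel_measurable_radial_limit holomorphic_on_imp_continuous_on f)
  \<comment> \<open>\<open>\<epsilon> 0 = 1\<close>, so \<open>v 0\<close> is the
    \<open>ln_plus\<close> term itself and its integrability comes for free.\<close>
  define \<epsilon> where "\<epsilon> n = 1 / (real n + 1)" for n :: nat
  have e: "0 < \<epsilon> n" "\<epsilon> n \<le> 1" for n by (simp_all add: \<epsilon>_def)
  have elim0: "\<epsilon> \<longlonglongrightarrow> 0" unfolding \<epsilon>_def by real_asymp
  define v where "v n t = ln (max (\<epsilon> n) (norm (F t)))" for n t
  define w where "w n t = ln_plus (norm (F t)) - v n t" for n t
  have vi: "integrable \<mu> (v n)" for n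
    unfolding v_def F_def by (rule smirnov_integrable_ln_max[OF sm rad e])
  have lpi: "integrable \<mu> (\<lambda>t. ln_plus (norm (F t)))"
  proof -
    have "v 0 = (\<lambda>t. ln_plus (norm (F t)))"
      by (rule ext) (simp add: v_def ln_plus_def \<epsilon>_def)
    then show ?thesis using vi[of 0] by simp
  qed
  have vle: "ln (max (\<epsilon> n) (norm (f z))) \<le> poisson (v n) z" if "z \<in> unit_disc" for n z
    unfolding v_def F_def by (rule smirnov_ln_max_le[OF sm rad e that])
  have wi: "integrable \<mu> (w n)" for n
    unfolding w_def by (intro Bochner_Integration.integrable_diff lpi vi)
  have w0: "0 \<le> w n t" for n t
    unfolding w_def v_def ln_plus_def using e[of n] by (simp add: ln_le_cancel_iff max.coboundedI1)
  have [measurable]: "w n \<in> borel_measurable \<mu>" for n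
    using wi[of n] by simp
  define K where "K = (LINT t|\<mu>. ln_plus (norm (F t))) - ln (norm (f 0))"
  have wK: "(LINT t|\<mu>. w n t) \<le> K" for n
  proof -
    have "ln (norm (f 0)) \<le> ln (max (\<epsilon> n) (norm (f 0)))"
      using f0 e[of n] by (subst ln_le_cancel_iff) auto
    also have "\<dots> \<le> (LINT t|\<mu>. v n t)"
      using vle[of 0 n] by (simp add: poisson_zero)
    finally show ?thesis
      unfolding w_def K_def using lpi vi by simp
  qed
  have fin: "(\<integral>\<^sup>+ t. liminf (\<lambda>n. ennreal (w n t)) \<partial>\<mu>) < \<infinity>"
  proof -
    have "(\<integral>\<^sup>+ t. liminf (\<lambda>n. ennreal (w n t)) \<partial>\<mu>) \<le> liminf (\<lambda>n. \<integral>\<^sup>+ t. ennreal (w n t) \<partial>\<mu>)"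
      by (rule nn_integral_liminf) measurable
    also have "\<dots> \<le> liminf (\<lambda>n. ennreal K)"
      using wK wi w0 by (intro Liminf_mono always_eventually allI) (simp add: nn_integral_eq_integral ennreal_leI)
    also have "\<dots> < \<infinity>" by (simp add: Liminf_const)
    finally show ?thesis .
  qed
  then have "AE t in \<mu>. liminf (\<lambda>n. ennreal (w n t)) \<noteq> \<infinity>"
    by (intro nn_integral_PInf_AE) auto
  \<comment> \<open>Since \<open>ln\<close> is finite at 0 in HOL, integrability of the logarithm
    would not exclude zeros. The gaps do: at a zero, \<open>w n t = ln (n + 1)\<close>
    diverges.\<close>
  then have nz: "AE t in \<mu>. F t \<noteq> 0"
  proof eventually_elim
    case (elim t)
    show ?case
    proof
      assume "F t = 0"
      then have wt: "w n t = ln (real n + 1)" for n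
        using e[of n] by (simp add: w_def v_def ln_plus_def \<epsilon>_def ln_div)
      have "filterlim (\<lambda>n. ln (real n + 1)) at_top sequentially" by real_asymp
      then have "(\<lambda>n. ennreal (w n t)) \<longlonglongrightarrow> \<infinity>"
        unfolding wt by (rule ennreal_tendsto_top_eq_at_top[THEN iffD2, unfolded infinity_ennreal_def[symmetric]])
      from lim_imp_Liminf[OF sequentially_bot this] elim show False by simp
    qed
  qed
  then show "AE t in \<mu>. radial_limit f t \<noteq> 0" by (simp add: F_def)
  have vlim: "(\<lambda>n. v n t) \<longlonglongrightarrow> ln (norm (F t))" if "F t \<noteq> 0" for t
  proof -
    have "(\<lambda>n. ln (max (\<epsilon> n) (norm (F t)))) \<longlonglongrightarrow> ln (max 0 (norm (F t)))"
      using that by (intro tendsto_intros elim0) auto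
    then show ?thesis by (simp add: v_def)
  qed
  have gi: "integrable \<mu> (\<lambda>t. ln_plus (norm (F t)) - ln (norm (F t)))"
  proof (rule integrableI_bounded)
    have "(\<integral>\<^sup>+ t. ennreal (norm (ln_plus (norm (F t)) - ln (norm (F t)))) \<partial>\<mu>) =
        (\<integral>\<^sup>+ t. liminf (\<lambda>n. ennreal (w n t)) \<partial>\<mu>)"
    proof (rule nn_integral_cong_AE)
      show "AE t in \<mu>. ennreal (norm (ln_plus (norm (F t)) - ln (norm (F t)))) = liminf (\<lambda>n. ennreal (w n t))"
        using nz
      proof eventually_elim
        case (elim t)
        have l: "(\<lambda>n. w n t) \<longlonglongrightarrow> ln_plus (norm (F t)) - ln (norm (F t))"
          unfolding w_def by (intro tendsto_intros vlim elim)
        have "0 \<le> ln_plus (norm (F t)) - ln (norm (F t))"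
          by (rule LIMSEQ_le_const[OF l]) (use w0 in auto)
        with lim_imp_Liminf[OF sequentially_bot tendsto_ennrealI[OF l]] show ?case by simp
      qed
    qed
    with fin show "(\<integral>\<^sup>+ t. ennreal (norm (ln_plus (norm (F t)) - ln (norm (F t)))) \<partial>\<mu>) < \<infinity>" by simp
  qed measurable
  have li: "integrable \<mu> (\<lambda>t. ln (norm (F t)))"
    using Bochner_Integration.integrable_diff[OF lpi gi] by simp
  then show "integrable \<mu> (\<lambda>t. ln (norm (radial_limit f t)))" by (simp add: F_def)
  assume z: "z \<in> unit_disc"
  have "(\<lambda>n. LINT t|\<mu>. \<bar>v n t - ln (norm (F t))\<bar>) \<longlonglongrightarrow> (LINT t|\<mu>. 0)"
  proof (rule integral_dominated_convergence[where w = "\<lambda>t. ln_plus (norm (F t)) + \<bar>ln (norm (F t))\<bar> + \<bar>ln (norm (F t))\<bar>"])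
    show "integrable \<mu> (\<lambda>t. ln_plus (norm (F t)) + \<bar>ln (norm (F t))\<bar> + \<bar>ln (norm (F t))\<bar>)"
      using lpi li by auto
    show "AE t in \<mu>. (\<lambda>n. \<bar>v n t - ln (norm (F t))\<bar>) \<longlonglongrightarrow> 0"
      using nz
    proof eventually_elim
      case (elim t)
      show ?case using LIM_zero[OF vlim[OF elim]] by (rule tendsto_rabs_zero)
    qed
    show "AE t in \<mu>. norm \<bar>v n t - ln (norm (F t))\<bar> \<le> ln_plus (norm (F t)) + \<bar>ln (norm (F t))\<bar> + \<bar>ln (norm (F t))\<bar>" for n
      using nz
    proof eventually_elim
      case (elim t)
      have "ln (norm (F t)) \<le> v n t"
        unfolding v_def using elim e[of n] by (subst ln_le_cancel_iff) auto
      moreover have "v n t \<le> ln_plus (norm (F t))" using w0[of n t] by (simp add: w_def)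
      ultimately show ?case using ln_plus_nonneg[of "norm (F t)"] by simp
    qed
  qed (use li in \<open>auto simp: v_def\<close>)
  then have "(\<lambda>n. poisson (v n) z) \<longlonglongrightarrow> poisson (\<lambda>t. ln (norm (F t))) z"
    by (intro poisson_tendsto[OF z li vi]) simp
  then have "(\<lambda>n. exp (poisson (v n) z)) \<longlonglongrightarrow> exp (poisson (\<lambda>t. ln (norm (F t))) z)"
    by (rule tendsto_exp)
  moreover have "norm (f z) \<le> exp (poisson (v n) z)" for n
  proof -
    have "max (\<epsilon> n) (norm (f z)) \<le> exp (poisson (v n) z)"
      using vle[OF z, of n] e(1)[of n] by (metis exp_le_cancel_iff exp_ln less_max_iff_disj)
    then show ?thesis by simp
  qed
  ultimately show "norm (f z) \<le> exp (poisson (\<lambda>t. ln (norm (radial_limit f t))) z)"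
    unfolding F_def by (intro LIMSEQ_le_const) auto
qed

lemma poisson_ln_max_1_dilate:
  assumes "scalar_smirnov f" "z \<in> unit_disc"
  shows "norm (f (of_real (radii k) * z)) \<le> exp (poisson (\<lambda>t. ln_plus (norm (f (of_real (radii k) * t)))) z)"
proof -
  have "f holomorphic_on unit_disc" using assms(1) by (simp add: scalar_smirnov_def)
  from ln_max_dilate_le_poisson[OF radii(1,2) this zero_less_one assms(2), of k]
  have "ln (max 1 (norm (f (of_real (radii k) * z)))) \<le> poisson (\<lambda>t. ln_plus (norm (f (of_real (radii k) * t)))) z"
    by (simp add: ln_plus_def)
  then have "exp (ln (max 1 (norm (f (of_real (radii k) * z))))) \<le> exp (poisson (\<lambda>t. ln_plus (norm (f (of_real (radii k) * t)))) z)"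
    by (simp only: exp_le_cancel_iff)
  then show ?thesis
    by (subst (asm) exp_ln) auto
qed

text \<open>A function of the Smirnov class is a quotient of two bounded functions: the denominator is a
  locally uniform limit of the outer functions with boundary modulus \<open>exp (- ln_plus |f(r t)|)\<close>.\<close>

theorem smirnov_radial_limit:
  assumes sm: "scalar_smirnov f"
  shows "AE t in \<mu>. \<exists>l. has_radial_limit f t l"
proof -
  have f: "f holomorphic_on unit_disc"
    and ui: "uniformly_integrable {0..<1} (\<lambda>r t. ln_plus (norm (f (complex_of_real r * t))))"
    using sm by (auto simp: scalar_smirnov_def)
  define u where "u k t = ln_plus (norm (f (of_real (radii k) * t)))" for k t
  have iu: "integrable \<mu> (u k)" for k
    unfolding u_def by (intro integrable_circleI continuous_intros continuous_on_circle_dilate f radii)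
  obtain C where C: "\<And>k. (LINT t|\<mu>. u k t) \<le> C"
  proof -
    obtain C where "\<And>r. r \<in> {0..<1} \<Longrightarrow> (LINT t|\<mu>. \<bar>ln_plus (norm (f (complex_of_real r * t)))\<bar>) \<le> C"
      using ui unfolding uniformly_integrable_def by blast
    then have "(LINT t|\<mu>. u k t) \<le> C" for k
      using radii(1,2)[of k] by (simp add: u_def ln_plus_nonneg)
    then show ?thesis by (rule that)
  qed
  define G where "G k z = exp (- herglotz (u k) z)" for k z
  have nG: "norm (G k z) = exp (- poisson (u k) z)" if "z \<in> unit_disc" for k z
    using Re_herglotz[OF that iu] by (simp add: G_def)
  have u0: "0 \<le> poisson (u k) z" if "z \<in> unit_disc" for k z
    using that by (intro poisson_nonneg) (auto simp: u_def ln_plus_nonneg)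
  let ?H = "{h. h holomorphic_on unit_disc \<and> (\<forall>z\<in>unit_disc. norm (h z) \<le> 1)}"
  have G: "range G \<subseteq> ?H"
  proof safe
    fix k
    show "G k holomorphic_on unit_disc"
      unfolding G_def by (intro holomorphic_intros holomorphic_herglotz iu)
    show "norm (G k z) \<le> 1" if "z \<in> unit_disc" for z
      using nG[OF that] u0[OF that] by simp
  qed
  \<comment> \<open>There is no boundary function of \<open>f\<close> yet to which the
    \<open>u k\<close> could converge, so the denominator is obtained by compactness from
    \<open>norm (G k z) \<le> 1\<close>.\<close>
  obtain g r where g: "g holomorphic_on unit_disc" and r: "strict_mono (r :: nat \<Rightarrow> nat)"
    and lim: "\<And>z. z \<in> unit_disc \<Longrightarrow> (\<lambda>n. G (r n) z) \<longlonglongrightarrow> g z"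
    by (rule Montel[OF open_ball _ _ G]) blast+
  have g1: "norm (g z) \<le> 1" if "z \<in> unit_disc" for z
    by (rule LIMSEQ_le_const2[OF tendsto_norm[OF lim[OF that]]]) (use G that in blast)
  have fg: "norm (f z * g z) \<le> 1" if z: "z \<in> unit_disc" for z
  proof -
    have "(\<lambda>n. radii (r n)) \<longlonglongrightarrow> 1"
      using LIMSEQ_subseq_LIMSEQ[OF radii(3) r] by (simp add: o_def)
    then have "(\<lambda>n. of_real (radii (r n)) * z) \<longlonglongrightarrow> of_real 1 * z"
      by (intro tendsto_intros)
    then have "(\<lambda>n. f (of_real (radii (r n)) * z)) \<longlonglongrightarrow> f (of_real 1 * z)"
    proof (rule continuous_on_tendsto_compose[OF holomorphic_on_imp_continuous_on[OF f]])
      show "\<forall>\<^sub>F n in sequentially. of_real (radii (r n)) * z \<in> unit_disc"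
        using z by (intro always_eventually allI dilate_in_disc radii) auto
    qed (use z in simp)
    then have "(\<lambda>n. f (of_real (radii (r n)) * z) * G (r n) z) \<longlonglongrightarrow> f z * g z"
      using lim[OF z] by (auto intro: tendsto_mult)
    moreover have "norm (f (of_real (radii k) * z) * G k z) \<le> 1" for k
    proof -
      have "norm (f (of_real (radii k) * z) * G k z) \<le> exp (poisson (u k) z) * exp (- poisson (u k) z)"
        unfolding norm_mult nG[OF z] u_def by (intro mult_right_mono poisson_ln_max_1_dilate sm z) auto
      then show ?thesis by (simp flip: exp_add)
    qed
    ultimately show ?thesis
      by (intro LIMSEQ_le_const2[OF tendsto_norm]) auto
  qed
  \<comment> \<open>The common bound \<open>C\<close> for the means keeps the limit from vanishing
    at 0, so \<open>g\<close> is an admissible denominator.\<close>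
  have "exp (- C) \<le> norm (G k 0)" for k
    using C[of k] nG[of 0 k] by (simp add: poisson_zero)
  then have "exp (- C) \<le> norm (g 0)"
    by (intro LIMSEQ_le_const[OF tendsto_norm[OF lim]]) auto
  then have g0: "g 0 \<noteq> 0" by (smt (verit) exp_gt_zero norm_zero)
  have radg: "AE t in \<mu>. \<exists>l. has_radial_limit g t l"
    by (rule fatou_bounded_holomorphic[OF g g1])
  have radfg: "AE t in \<mu>. \<exists>l. has_radial_limit (\<lambda>z. f z * g z) t l"
    by (rule fatou_bounded_holomorphic[OF holomorphic_on_mult[OF f g] fg])
  have "AE t in \<mu>. radial_limit g t \<noteq> 0"
    by (rule smirnov_nonzero_AE'[OF smirnov_if_bounded[OF g g1] radg g0])
  with radg radfg show ?thesis
  proof eventually_elim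
    case (elim t)
    then obtain l m where l: "has_radial_limit g t l" "l \<noteq> 0" and m: "has_radial_limit (\<lambda>z. f z * g z) t m"
      using radial_limit_eqI by metis
    have "((\<lambda>r. f (of_real r * t) * g (of_real r * t) / g (of_real r * t)) \<longlongrightarrow> m / l) (at_left 1)"
      using l m unfolding has_radial_limit_def by (intro tendsto_divide) auto
    moreover have "eventually (\<lambda>r. g (of_real r * t) \<noteq> 0) (at_left 1)"
      using l unfolding has_radial_limit_def by (intro tendsto_imp_eventually_ne)
    then have "eventually (\<lambda>r. f (of_real r * t) * g (of_real r * t) / g (of_real r * t) = f (of_real r * t)) (at_left 1)"
      by eventually_elim simp
    ultimately have "((\<lambda>r. f (of_real r * t)) \<longlongrightarrow> m / l) (at_left 1)"
      by (rule Lim_transform_eventually)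
    then show ?case unfolding has_radial_limit_def by blast
  qed
qed

lemma
  assumes "scalar_smirnov f" "f 0 \<noteq> 0"
  shows smirnov_nonzero_AE: "AE t in \<mu>. radial_limit f t \<noteq> 0"
    and smirnov_integrable_ln: "integrable \<mu> (\<lambda>t. ln (norm (radial_limit f t)))"
    and smirnov_norm_le: "z \<in> unit_disc \<Longrightarrow> norm (f z) \<le> exp (poisson (\<lambda>t. ln (norm (radial_limit f t))) z)"
  using smirnov_nonzero_AE'[OF assms(1) smirnov_radial_limit[OF assms(1)] assms(2)]
    smirnov_integrable_ln'[OF assms(1) smirnov_radial_limit[OF assms(1)] assms(2)]
    smirnov_norm_le'[OF assms(1) smirnov_radial_limit[OF assms(1)] assms(2)] by auto

lemma smirnov_has_radial_limit_AE:
  assumes "scalar_smirnov f"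
  shows "AE t in \<mu>. has_radial_limit f t (radial_limit f t)"
  using smirnov_radial_limit[OF assms] by eventually_elim (auto dest: radial_limit_eqI)

lemma
  assumes f: "f holomorphic_on unit_disc" and M: "\<And>z. z \<in> unit_disc \<Longrightarrow> norm (f z) \<le> M"
  shows radial_limit_bounded: "AE t in \<mu>. norm (radial_limit f t) \<le> M"
    and integral_radial_limit: "(LINT t|\<mu>. radial_limit f t) = f 0"
proof -
  have sm: "scalar_smirnov f"
    by (rule smirnov_if_bounded[OF f M])
  note rad = smirnov_has_radial_limit_AE[OF sm]
  have b: "norm (f (of_real (radii k) * t)) \<le> M" if "t \<in> unit_circle" for k t
    using that by (intro M dilate_in_disc radii) auto
  have lim: "AE t in \<mu>. (\<lambda>k. f (of_real (radii k) * t)) \<longlonglongrightarrow> radial_limit f t"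
    using rad by eventually_elim (rule has_radial_limit_sequentially[OF _ radii(2,3)])
  have "AE t in \<mu>. t \<in> unit_circle"
    by (rule AE_I2) simp
  with lim show "AE t in \<mu>. norm (radial_limit f t) \<le> M"
  proof eventually_elim
    case (elim t)
    show ?case by (rule LIMSEQ_le_const2[OF tendsto_norm[OF elim(1)]]) (use b elim(2) in auto)
  qed
  have "(\<lambda>k. LINT t|\<mu>. f (of_real (radii k) * t)) \<longlonglongrightarrow> (LINT t|\<mu>. radial_limit f t)"
  proof (rule integral_dominated_convergence[where w = "\<lambda>_. M"])
    show "radial_limit f \<in> borel_measurable \<mu>"
      by (intro borel_measurable_radial_limit holomorphic_on_imp_continuous_on f)
    show "(\<lambda>t. f (of_real (radii k) * t)) \<in> borel_measurable \<mu>" for k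
      by (intro borel_measurable_dilate holomorphic_on_imp_continuous_on f radii)
  qed (use lim b in auto)
  moreover have "(LINT t|\<mu>. f (of_real (radii k) * t)) = f 0" for k
    using mean_value_circle[OF continuous_on_dilate holomorphic_on_dilate, OF radii(1,2) f radii(1,2) f, of k] by simp
  ultimately show "(LINT t|\<mu>. radial_limit f t) = f 0"
    by (simp add: LIMSEQ_const_iff)
qed

text \<open>The bound \<open>|\<phi>| \<le> 1\<close> gives \<open>\<integral> |\<phi> - 1|\<^sup>2 \<le> 2 - 2 Re \<phi>(0)\<close> on the circle.\<close>

lemma radial_limits_subsequence_tendsto_1:
  fixes \<phi> :: "nat \<Rightarrow> complex \<Rightarrow> complex"
  assumes hol: "\<And>k. \<phi> k holomorphic_on unit_disc" and le: "\<And>k z. z \<in> unit_disc \<Longrightarrow> norm (\<phi> k z) \<le> 1"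
    and lim: "(\<lambda>k. \<phi> k 0) \<longlonglongrightarrow> 1"
  obtains s :: "nat \<Rightarrow> nat" where "strict_mono s"
    "AE t in \<mu>. (\<lambda>k. radial_limit (\<phi> (s k)) t) \<longlonglongrightarrow> 1"
proof -
  let ?\<phi> = "\<lambda>k. radial_limit (\<phi> k)"
  have [measurable]: "?\<phi> k \<in> borel_measurable \<mu>" for k
    by (intro borel_measurable_radial_limit holomorphic_on_imp_continuous_on hol)
  have b: "AE t in \<mu>. norm (?\<phi> k t) \<le> 1" for k
    by (rule radial_limit_bounded[OF hol le])
  have i: "integrable \<mu> (?\<phi> k)" for k
    using b[of k] by (intro circle.integrable_const_bound[where B = 1]) auto
  have iRe: "integrable \<mu> (\<lambda>t. Re (?\<phi> k t))" for k
    by (intro integrable_Re i)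
  have iu: "integrable \<mu> (\<lambda>t. (norm (?\<phi> k t - 1))\<^sup>2)" for k
  proof (rule circle.integrable_const_bound[where B = 4])
    show "AE t in \<mu>. norm ((norm (?\<phi> k t - 1))\<^sup>2) \<le> 4"
      using b[of k]
    proof eventually_elim
      case (elim t)
      have "norm (?\<phi> k t - 1) \<le> 2"
        using norm_triangle_ineq4[of "?\<phi> k t" 1] elim by simp
      then have "(norm (?\<phi> k t - 1))\<^sup>2 \<le> 2\<^sup>2" by (intro power_mono) auto
      then show ?case by simp
    qed
  qed measurable
  have le2: "(LINT t|\<mu>. (norm (?\<phi> k t - 1))\<^sup>2) \<le> 2 - 2 * Re (\<phi> k 0)" for k
  proof -
    have "(LINT t|\<mu>. (norm (?\<phi> k t - 1))\<^sup>2) \<le> (LINT t|\<mu>. 2 - 2 * Re (?\<phi> k t))"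
    proof (rule integral_mono_AE[OF iu])
      show "AE t in \<mu>. (norm (?\<phi> k t - 1))\<^sup>2 \<le> 2 - 2 * Re (?\<phi> k t)"
        using b[of k]
      proof eventually_elim
        case (elim t)
        have "(norm (?\<phi> k t))\<^sup>2 \<le> 1" using elim by (simp add: power_le_one)
        moreover have "(norm (?\<phi> k t - 1))\<^sup>2 = (norm (?\<phi> k t))\<^sup>2 + 1 - 2 * Re (?\<phi> k t)"
          unfolding cmod_power2 by (simp add: power2_eq_square algebra_simps)
        ultimately show ?case by simp
      qed
    qed (use iRe in auto)
    also have "\<dots> = 2 - 2 * Re (LINT t|\<mu>. ?\<phi> k t)"
      using iRe[of k] i[of k] by (simp add: integral_Re)
    also have "(LINT t|\<mu>. ?\<phi> k t) = \<phi> k 0"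
      by (rule integral_radial_limit[OF hol le])
    finally show ?thesis .
  qed
  have "(\<lambda>k. LINT t|\<mu>. (norm (?\<phi> k t - 1))\<^sup>2) \<longlonglongrightarrow> 0"
  proof (rule tendsto_sandwich[OF _ _ tendsto_const])
    have "(\<lambda>k. 2 - 2 * Re (\<phi> k 0)) \<longlonglongrightarrow> 2 - 2 * Re 1"
      by (intro tendsto_intros lim)
    then show "(\<lambda>k. 2 - 2 * Re (\<phi> k 0)) \<longlonglongrightarrow> 0" by simp
  qed (use le2 in \<open>auto intro!: always_eventually Bochner_Integration.integral_nonneg\<close>)
  then have "(\<lambda>k. LINT t|\<mu>. norm ((norm (?\<phi> k t - 1))\<^sup>2)) \<longlonglongrightarrow> 0" by simp
  from tendsto_L1_AE_subseq[OF iu this]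
  obtain s :: "nat \<Rightarrow> nat" where s: "strict_mono s"
    and s': "AE t in \<mu>. (\<lambda>k. (norm (?\<phi> (s k) t - 1))\<^sup>2) \<longlonglongrightarrow> 0"
    by blast
  have "AE t in \<mu>. (\<lambda>k. ?\<phi> (s k) t) \<longlonglongrightarrow> 1"
    using s'
  proof eventually_elim
    case (elim t)
    from tendsto_real_sqrt[OF elim] have "(\<lambda>k. norm (?\<phi> (s k) t - 1)) \<longlonglongrightarrow> 0" by simp
    then show ?case
      by (rule LIM_zero_cancel[OF tendsto_norm_zero_cancel])
  qed
  with s show ?thesis by (rule that)
qed

section \<open>Outer functions\<close>

lemma has_radial_limit_mult:
  fixes f g :: "complex \<Rightarrow> complex"
  shows "has_radial_limit f t a \<Longrightarrow> has_radial_limit g t b \<Longrightarrow> has_radial_limit (\<lambda>z. f z * g z) t (a * b)"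
  unfolding has_radial_limit_def by (rule tendsto_mult)

text \<open>Dividing \<open>e\<close> by \<open>exp\<close> of the Herglotz transform of its
  boundary logarithm leaves a function bounded by 1. The assumption on the mean gives modulus 1 at
  0, so by the maximum principle the quotient is a unimodular constant.\<close>

lemma outer_if_mean_value:
  assumes sm: "scalar_smirnov e" and e0: "e 0 \<noteq> 0"
    and mean: "(LINT t|\<mu>. ln (norm (radial_limit e t))) \<le> ln (norm (e 0))"
  shows "outer e"
proof -
  let ?u = "\<lambda>t. ln (norm (radial_limit e t))"
  note ui = smirnov_integrable_ln[OF sm e0]
  have e: "e holomorphic_on unit_disc" using sm by (simp add: scalar_smirnov_def)
  define \<psi> where "\<psi> z = e z * exp (- herglotz ?u z)" for z
  have hol: "\<psi> holomorphic_on unit_disc"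
    unfolding \<psi>_def by (intro holomorphic_intros holomorphic_herglotz e ui)
  have n\<psi>: "norm (\<psi> z) = norm (e z) * exp (- poisson ?u z)" if "z \<in> unit_disc" for z
    using Re_herglotz[OF that ui] by (simp add: \<psi>_def norm_mult)
  have le: "norm (\<psi> z) \<le> 1" if z: "z \<in> unit_disc" for z
  proof -
    have "norm (e z) * exp (- poisson ?u z) \<le> exp (poisson ?u z) * exp (- poisson ?u z)"
      by (intro mult_right_mono smirnov_norm_le[OF sm e0 z]) simp
    then show ?thesis using n\<psi>[OF z] by (simp flip: exp_add)
  qed
  have "1 \<le> norm (\<psi> 0)"
  proof -
    have "exp (LINT t|\<mu>. ?u t) \<le> norm (e 0)"
      using mean e0 by (metis exp_le_cancel_iff exp_ln zero_less_norm_iff)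
    then have "exp (LINT t|\<mu>. ?u t) * exp (- (LINT t|\<mu>. ?u t)) \<le> norm (e 0) * exp (- (LINT t|\<mu>. ?u t))"
      by (rule mult_right_mono) simp
    then show ?thesis using n\<psi>[of 0] by (simp add: poisson_zero flip: exp_add)
  qed
  then have \<psi>0: "norm (\<psi> 0) = 1" using le[of 0] by simp
  have "\<psi> constant_on unit_disc"
    by (rule maximum_modulus_principle[OF hol open_ball _ open_ball order_refl, of 0]) (use le \<psi>0 in auto)
  then obtain C where C: "\<And>z. z \<in> unit_disc \<Longrightarrow> \<psi> z = C"
    unfolding constant_on_def by blast
  show ?thesis
    unfolding outer_def
  proof (intro exI[of _ C] exI[of _ "\<lambda>t. norm (radial_limit e t)"] conjI ballI)
    show "norm C = 1" using \<psi>0 C[of 0] by simp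
    show "(\<lambda>t. norm (radial_limit e t)) \<in> borel_measurable \<mu>"
      using borel_measurable_radial_limit[OF holomorphic_on_imp_continuous_on[OF e]] by measurable
    show "AE t in \<mu>. 0 < norm (radial_limit e t)"
      using smirnov_nonzero_AE[OF sm e0] by simp
    show "integrable \<mu> ?u" by (rule ui)
    fix z :: complex
    assume z: "z \<in> unit_disc"
    have "e z = \<psi> z * exp (herglotz ?u z)"
      by (simp add: \<psi>_def mult.assoc flip: exp_add)
    then show "e z = C * exp (LINT t|\<mu>. (t + z) / (t - z) * complex_of_real (?u t))"
      using C[OF z] by (simp add: herglotz_def herglotz_kernel_def)
  qed simp
qed

text \<open>Each \<open>d k\<close> is bounded, but with a bound depending on \<open>k\<close>;
  uniform integrability of the \<open>ln_plus\<close> family is the control that survives the limit.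
  That \<open>e 0 \<noteq> 0\<close> has to be derived, and follows once
  \<open>e 0 * d (s k) 0\<close> is seen to tend to 1.\<close>

lemma outer_if_approximate_inverse:
  assumes sm: "scalar_smirnov e"
    and d: "\<And>k. d k holomorphic_on unit_disc" and M: "\<And>k z. z \<in> unit_disc \<Longrightarrow> norm (d k z) \<le> M k"
    and lim: "AE t in \<mu>. (\<lambda>k. radial_limit e t * radial_limit (d k) t) \<longlonglongrightarrow> 1"
    and ui: "uniformly_integrable UNIV (\<lambda>k t. ln_plus (norm (radial_limit (d k) t)))"
  shows "outer e"
proof -
  have e: "e holomorphic_on unit_disc"
    and uie: "uniformly_integrable {0..<1} (\<lambda>r t. ln_plus (norm (e (complex_of_real r * t))))"
    using sm by (auto simp: scalar_smirnov_def)
  have smd: "scalar_smirnov (d k)" for k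
    by (rule smirnov_if_bounded[OF d M])
  define g where "g k z = e z * d k z" for k z
  have g: "g k holomorphic_on unit_disc" for k
    unfolding g_def by (intro holomorphic_intros e d)
  have smg: "scalar_smirnov (g k)" for k
    unfolding scalar_smirnov_def
  proof (intro conjI g uniformly_integrable_dominated[OF uie, of 1])
    show "integrable \<mu> (\<lambda>t. ln_plus (M k))" by simp
    fix r :: real
    assume r: "r \<in> {0..<1}"
    show "(\<lambda>t. ln_plus (norm (g k (complex_of_real r * t)))) \<in> borel_measurable \<mu>"
      using r by (intro borel_measurable_circleI continuous_intros continuous_on_circle_dilate g) auto
    show "AE t in \<mu>. \<bar>ln_plus (norm (g k (complex_of_real r * t)))\<bar> \<le>
        1 * \<bar>ln_plus (norm (e (complex_of_real r * t)))\<bar> + ln_plus (M k)"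
    proof (rule AE_I2)
      fix t assume "t \<in> space \<mu>"
      then have "complex_of_real r * t \<in> unit_disc" using r by (intro dilate_in_disc) auto
      from ln_plus_mono[OF M[OF this, of k]] ln_plus_mult_le[of "norm (e (complex_of_real r * t))" "norm (d k (complex_of_real r * t))"]
      show "\<bar>ln_plus (norm (g k (complex_of_real r * t)))\<bar> \<le>
        1 * \<bar>ln_plus (norm (e (complex_of_real r * t)))\<bar> + ln_plus (M k)"
        by (simp add: g_def norm_mult ln_plus_nonneg)
    qed
  qed simp
  have meas: "radial_limit (d k) \<in> borel_measurable \<mu>" "radial_limit (g k) \<in> borel_measurable \<mu>"
    "radial_limit e \<in> borel_measurable \<mu>" for k
    by (intro borel_measurable_radial_limit holomorphic_on_imp_continuous_on d g e)+
  note [measurable] = meas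
  have radg: "AE t in \<mu>. \<forall>k. has_radial_limit (g k) t (radial_limit (g k) t) \<and>
      radial_limit (g k) t = radial_limit e t * radial_limit (d k) t"
  proof (subst AE_all_countable, intro allI)
    fix k
    show "AE t in \<mu>. has_radial_limit (g k) t (radial_limit (g k) t) \<and>
      radial_limit (g k) t = radial_limit e t * radial_limit (d k) t"
      using smirnov_has_radial_limit_AE[OF sm] smirnov_has_radial_limit_AE[OF smd[of k]]
    proof eventually_elim
      case (elim t)
      have "has_radial_limit (g k) t (radial_limit e t * radial_limit (d k) t)"
        unfolding g_def by (rule has_radial_limit_mult[OF elim])
      then show ?case using radial_limit_eqI by metis
    qed
  qed
  have lime: "AE t in \<mu>. (\<lambda>k. radial_limit (g k) t) \<longlonglongrightarrow> 1"
    using lim radg by eventually_elim simp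
  \<comment> \<open>The outer factors \<open>Q k = exp (- H(v k))\<close> make \<open>g k\<close> bounded by \<open>1\<close> and tend to \<open>1\<close>, so \<open>g k\<close> tends
    to \<open>1\<close> at \<open>0\<close> by dominated convergence.\<close>
  define v where "v k t = ln_plus (norm (radial_limit (g k) t))" for k t
  have lpe: "integrable \<mu> (\<lambda>t. ln_plus (norm (radial_limit e t)))"
    using smirnov_integrable_ln_max[OF sm smirnov_radial_limit[OF sm], of 1] by (simp add: ln_plus_def)
  have uiv: "uniformly_integrable UNIV v"
  proof (rule uniformly_integrable_dominated[OF ui zero_le_one lpe])
    show "v k \<in> borel_measurable \<mu>" for k
      unfolding v_def by measurable
    show "AE t in \<mu>. \<bar>v k t\<bar> \<le> 1 * \<bar>ln_plus (norm (radial_limit (d k) t))\<bar> + ln_plus (norm (radial_limit e t))" for k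
      using radg
    proof eventually_elim
      case (elim t)
      have "v k t \<le> ln_plus (norm (radial_limit e t)) + ln_plus (norm (radial_limit (d k) t))"
        unfolding v_def using elim ln_plus_mult_le by (simp add: norm_mult)
      then show ?case by (simp add: v_def ln_plus_nonneg)
    qed
  qed
  have vi: "integrable \<mu> (v k)" for k
    using uiv by (simp add: uniformly_integrable_def)
  have limv: "AE t in \<mu>. (\<lambda>k. v k t) \<longlonglongrightarrow> 0"
    using lime
  proof eventually_elim
    case (elim t)
    have "(\<lambda>k. v k t) \<longlonglongrightarrow> ln_plus (norm (1::complex))"
      unfolding v_def by (intro tendsto_intros elim)
    then show ?case by (simp add: ln_plus_def)
  qed
  have intv: "(\<lambda>k. LINT t|\<mu>. v k t) \<longlonglongrightarrow> 0"
    using vitali_convergence(2)[OF uiv _ limv] by (simp add: v_def ln_plus_nonneg)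
  define Q where "Q k z = exp (- herglotz (v k) z)" for k z
  have Q: "Q k holomorphic_on unit_disc" for k
    unfolding Q_def by (intro holomorphic_intros holomorphic_herglotz vi)
  have nQ: "norm (Q k z) = exp (- poisson (v k) z)" if "z \<in> unit_disc" for k z
    using Re_herglotz[OF that vi] by (simp add: Q_def)
  have Q1: "norm (Q k z) \<le> 1" if "z \<in> unit_disc" for k z
    using nQ[OF that] poisson_nonneg[OF that, of "v k"] by (simp add: v_def ln_plus_nonneg)
  have gQ: "norm (g k z * Q k z) \<le> 1" if z: "z \<in> unit_disc" for k z
  proof -
    have "ln (max 1 (norm (g k z))) \<le> poisson (v k) z"
      using smirnov_ln_max_le[OF smg smirnov_radial_limit[OF smg] zero_less_one order_refl z, of k]
      by (simp add: v_def[abs_def] ln_plus_def)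
    then have "max 1 (norm (g k z)) \<le> exp (poisson (v k) z)"
      by (metis exp_le_cancel_iff exp_ln less_max_iff_disj zero_less_one)
    then have "norm (g k z) * exp (- poisson (v k) z) \<le> exp (poisson (v k) z) * exp (- poisson (v k) z)"
      by (intro mult_right_mono) auto
    then show ?thesis by (simp add: norm_mult nQ[OF z] flip: exp_add)
  qed
  have Q0: "(\<lambda>k. Q k 0) \<longlonglongrightarrow> 1"
  proof -
    have "(\<lambda>k. exp (- complex_of_real (LINT t|\<mu>. v k t))) \<longlonglongrightarrow> exp (- complex_of_real 0)"
      by (intro tendsto_intros intv)
    then show ?thesis by (simp add: Q_def herglotz_zero)
  qed
  obtain s :: "nat \<Rightarrow> nat" where s: "strict_mono s"
    and s': "AE t in \<mu>. (\<lambda>k. radial_limit (Q (s k)) t) \<longlonglongrightarrow> 1"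
    using radial_limits_subsequence_tendsto_1[of Q, OF Q Q1 Q0] by blast
  have gQ0: "(\<lambda>k. g (s k) 0 * Q (s k) 0) \<longlonglongrightarrow> 1"
  proof -
    let ?p = "\<lambda>k z. g (s k) z * Q (s k) z"
    have p: "?p k holomorphic_on unit_disc" for k
      by (intro holomorphic_intros g Q)
    have radQ: "AE t in \<mu>. \<forall>k. has_radial_limit (Q k) t (radial_limit (Q k) t)"
      by (subst AE_all_countable) (intro allI smirnov_has_radial_limit_AE smirnov_if_bounded[OF Q Q1])
    have "(\<lambda>k. LINT t|\<mu>. radial_limit (?p k) t) \<longlonglongrightarrow> (LINT t|\<mu>. 1)"
    proof (rule integral_dominated_convergence[where w = "\<lambda>_. 1"])
      show "radial_limit (?p k) \<in> borel_measurable \<mu>" for k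
        by (intro borel_measurable_radial_limit holomorphic_on_imp_continuous_on p)
      show "AE t in \<mu>. norm (radial_limit (?p k) t) \<le> 1" for k
        by (rule radial_limit_bounded[OF p gQ])
      show "AE t in \<mu>. (\<lambda>k. radial_limit (?p k) t) \<longlonglongrightarrow> 1"
        using lime s' radQ radg
      proof eventually_elim
        case (elim t)
        have "radial_limit (?p k) t = radial_limit (g (s k)) t * radial_limit (Q (s k)) t" for k
          using elim(3,4) by (intro radial_limit_eqI has_radial_limit_mult) blast+
        moreover have "(\<lambda>k. radial_limit (g (s k)) t) \<longlonglongrightarrow> 1"
          using LIMSEQ_subseq_LIMSEQ[OF elim(1) s] by (simp add: o_def)
        then have "(\<lambda>k. radial_limit (g (s k)) t * radial_limit (Q (s k)) t) \<longlonglongrightarrow> 1 * 1"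
          by (intro tendsto_mult elim(2))
        ultimately show ?case by simp
      qed
    qed auto
    moreover have "(LINT t|\<mu>. radial_limit (?p k) t) = ?p k 0" for k
      by (rule integral_radial_limit[OF p gQ])
    ultimately show ?thesis by simp
  qed
  have Qs0: "(\<lambda>k. Q (s k) 0) \<longlonglongrightarrow> 1"
    using LIMSEQ_subseq_LIMSEQ[OF Q0 s] by (simp add: o_def)
  have "(\<lambda>k. g (s k) 0 * Q (s k) 0 / Q (s k) 0) \<longlonglongrightarrow> 1 / 1"
    by (intro tendsto_divide gQ0 Qs0) simp
  then have gs0: "(\<lambda>k. e 0 * d (s k) 0) \<longlonglongrightarrow> 1"
    by (simp add: Q_def g_def)
  have e0: "e 0 \<noteq> 0"
    using gs0 LIMSEQ_unique[OF tendsto_const, of "0::complex" 1] by auto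
  have ds0: "(\<lambda>k. d (s k) 0) \<longlonglongrightarrow> 1 / e 0"
    using tendsto_divide[OF gs0 tendsto_const e0] e0 by simp
  have nz: "AE t in \<mu>. radial_limit e t \<noteq> 0"
    by (rule smirnov_nonzero_AE[OF sm e0])
  have li: "integrable \<mu> (\<lambda>t. ln (norm (radial_limit e t)))"
    by (rule smirnov_integrable_ln[OF sm e0])
  let ?m = "\<lambda>\<epsilon> t. ln (max \<epsilon> (norm (1 / radial_limit e t)))"
  \<comment> \<open>The mean inequality for \<open>d k\<close> survives the limit at a fixed
    truncation level: the boundary values tend to \<open>1 / radial_limit e t\<close> and, along
    \<open>s\<close>, the values at 0 to \<open>1 / e 0\<close>.\<close>
  have key: "ln (max \<epsilon> (norm (1 / e 0))) \<le> (LINT t|\<mu>. ?m \<epsilon> t)" if \<epsilon>: "0 < \<epsilon>" "\<epsilon> \<le> 1" for \<epsilon>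
  proof -
    have mx: "0 < max \<epsilon> x" for x using \<epsilon> by auto
    let ?y = "\<lambda>k t. ln (max \<epsilon> (norm (radial_limit (d k) t)))"
    have uiy: "uniformly_integrable UNIV ?y"
    proof (rule uniformly_integrable_dominated[OF ui zero_le_one])
      show "integrable \<mu> (\<lambda>t. \<bar>ln \<epsilon>\<bar>)" by simp
      show "AE t in \<mu>. \<bar>?y k t\<bar> \<le> 1 * \<bar>ln_plus (norm (radial_limit (d k) t))\<bar> + \<bar>ln \<epsilon>\<bar>" for k
        using abs_ln_max_le[OF \<epsilon>] by (intro AE_I2) (simp add: ln_plus_nonneg)
    qed measurable
    have yi: "integrable \<mu> (?y k)" for k
      using uiy by (simp add: uniformly_integrable_def)
    have mm: "?m \<epsilon> \<in> borel_measurable \<mu>" by measurable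
    have limy: "AE t in \<mu>. (\<lambda>k. ?y k t) \<longlonglongrightarrow> ?m \<epsilon> t"
      using lim nz
    proof eventually_elim
      case (elim t)
      have "(\<lambda>k. radial_limit (d k) t) \<longlonglongrightarrow> 1 / radial_limit e t"
        using tendsto_divide[OF elim(1) tendsto_const elim(2)] elim(2) by simp
      then show ?case using mx by (intro tendsto_intros) (auto simp: less_le)
    qed
    note V = vitali_convergence[OF uiy mm limy]
    have "(\<lambda>k. poisson (?y k) 0) \<longlonglongrightarrow> poisson (?m \<epsilon>) 0"
      by (rule poisson_tendsto[OF _ V(1) yi V(2)]) simp
    then have "(\<lambda>k. poisson (?y (s k)) 0) \<longlonglongrightarrow> poisson (?m \<epsilon>) 0"
      using LIMSEQ_subseq_LIMSEQ[OF _ s] by (fastforce simp: o_def)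
    moreover have "(\<lambda>k. ln (max \<epsilon> (norm (d (s k) 0)))) \<longlonglongrightarrow> ln (max \<epsilon> (norm (1 / e 0)))"
      using mx by (intro tendsto_intros ds0) (auto simp: less_le)
    moreover have "ln (max \<epsilon> (norm (d k 0))) \<le> poisson (?y k) 0" for k
      by (rule smirnov_ln_max_le[OF smd smirnov_radial_limit[OF smd] \<epsilon>]) simp
    ultimately have "ln (max \<epsilon> (norm (1 / e 0))) \<le> poisson (?m \<epsilon>) 0"
      by (intro tendsto_le[OF sequentially_bot]) auto
    then show ?thesis by (simp add: poisson_zero)
  qed
  define \<epsilon> where "\<epsilon> n = 1 / (real n + 1)" for n :: nat
  have \<epsilon>: "0 < \<epsilon> n" "\<epsilon> n \<le> 1" for n by (simp_all add: \<epsilon>_def)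
  have lim0: "\<epsilon> \<longlonglongrightarrow> 0" unfolding \<epsilon>_def by real_asymp
  have ln_inv: "ln (norm (1 / x)) = - ln (norm x)" if "x \<noteq> 0" for x :: complex
    using that by (simp add: norm_divide ln_div)
  have lim_ln: "(\<lambda>n. ln (max (\<epsilon> n) (norm (1 / x)))) \<longlonglongrightarrow> - ln (norm x)" if "x \<noteq> 0" for x :: complex
  proof -
    have "(\<lambda>n. ln (max (\<epsilon> n) (norm (1 / x)))) \<longlonglongrightarrow> ln (max 0 (norm (1 / x)))"
      using that by (intro tendsto_intros lim0) auto
    then show ?thesis using ln_inv[OF that] by simp
  qed
  have "(\<lambda>n. LINT t|\<mu>. ?m (\<epsilon> n) t) \<longlonglongrightarrow> (LINT t|\<mu>. - ln (norm (radial_limit e t)))"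
  proof (rule integral_dominated_convergence[where w = "\<lambda>t. \<bar>ln (norm (radial_limit e t))\<bar>"])
    show "AE t in \<mu>. (\<lambda>n. ?m (\<epsilon> n) t) \<longlonglongrightarrow> - ln (norm (radial_limit e t))"
      using nz by eventually_elim (rule lim_ln)
    \<comment> \<open>Since \<open>\<epsilon> n \<le> 1\<close>, truncation alters only negative
      logarithms and moves them towards 0.\<close>
    show "AE t in \<mu>. norm (?m (\<epsilon> n) t) \<le> \<bar>ln (norm (radial_limit e t))\<bar>" for n
      using nz
    proof eventually_elim
      case (elim t)
      define a where "a = norm (1 / radial_limit e t)"
      have a: "0 < a" using elim by (simp add: a_def)
      have 1: "ln a \<le> ln (max (\<epsilon> n) a)" using a by (subst ln_le_cancel_iff) auto
      have 2: "ln (max (\<epsilon> n) a) \<le> ln (max 1 a)" using a \<epsilon>[of n] by (subst ln_le_cancel_iff) auto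
      have 3: "ln (max 1 a) = max 0 (ln a)"
        using a by (cases "1 \<le> a") (auto simp: max_def)
      have "\<bar>ln (max (\<epsilon> n) a)\<bar> \<le> \<bar>ln a\<bar>" using 1 2 3 by linarith
      moreover have "\<bar>ln a\<bar> = \<bar>ln (norm (radial_limit e t))\<bar>"
        using ln_inv[OF elim] by (simp only: a_def abs_minus_cancel)
      ultimately show ?case by (simp only: a_def real_norm_def)
    qed
  qed (use li in auto)
  moreover have "(\<lambda>n. ln (max (\<epsilon> n) (norm (1 / e 0)))) \<longlonglongrightarrow> - ln (norm (e 0))"
    by (rule lim_ln[OF e0])
  ultimately have "- ln (norm (e 0)) \<le> (LINT t|\<mu>. - ln (norm (radial_limit e t)))"
    using key[OF \<epsilon>] by (intro tendsto_le[OF sequentially_bot]) auto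
  then show ?thesis
    by (intro outer_if_mean_value[OF sm e0]) simp
qed

section \<open>Matrix functions\<close>

lemma bounded_linear_matrix_vector_mult: "bounded_linear (\<lambda>x. A *v x)" for A :: "complex^'n^'n"
  by (rule matrix_vector_mul_bounded_linear)

lemma norm_entry_le_opnorm: "norm (A $ i $ j) \<le> opnorm A" for A :: "complex^'n^'n"
proof -
  have "(A *v axis j 1) $ i = A $ i $ j"
    by (simp add: matrix_vector_mult_def axis_def if_distrib cong: if_cong)
  then have "norm (A $ i $ j) \<le> norm (A *v axis j 1)"
    using Finite_Cartesian_Product.norm_nth_le[of "A *v axis j 1" i] by simp
  also have "\<dots> \<le> opnorm A * norm (axis j (1::complex))"
    unfolding opnorm_def by (rule onorm[OF bounded_linear_matrix_vector_mult])
  finally show ?thesis by simp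
qed

lemma opnorm_le_sum: "opnorm A \<le> (\<Sum>i\<in>UNIV. \<Sum>j\<in>UNIV. norm (A $ i $ j))" for A :: "complex^'n^'n"
  unfolding opnorm_def
proof (rule onorm_le)
  fix x :: "complex^'n"
  have "norm (A *v x) \<le> (\<Sum>i\<in>UNIV. norm ((A *v x) $ i))"
    unfolding norm_vec_def by (rule L2_set_le_sum) simp
  also have "\<dots> \<le> (\<Sum>i\<in>UNIV. \<Sum>j\<in>UNIV. norm (A $ i $ j) * norm x)"
  proof (rule sum_mono)
    fix i
    have "norm ((A *v x) $ i) \<le> (\<Sum>j\<in>UNIV. norm (A $ i $ j * x $ j))"
      unfolding matrix_vector_mult_def by (simp add: norm_sum)
    also have "\<dots> \<le> (\<Sum>j\<in>UNIV. norm (A $ i $ j) * norm x)"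
      by (intro sum_mono) (simp add: norm_mult mult_left_mono Finite_Cartesian_Product.norm_nth_le)
    finally show "norm ((A *v x) $ i) \<le> (\<Sum>j\<in>UNIV. norm (A $ i $ j) * norm x)" .
  qed
  also have "\<dots> = (\<Sum>i\<in>UNIV. \<Sum>j\<in>UNIV. norm (A $ i $ j)) * norm x"
    by (simp add: sum_distrib_right)
  finally show "norm (A *v x) \<le> (\<Sum>i\<in>UNIV. \<Sum>j\<in>UNIV. norm (A $ i $ j)) * norm x" .
qed

lemma opnorm_le_entries:
  fixes A :: "complex^'n^'n"
  assumes "\<And>i j. norm (A $ i $ j) \<le> B"
  shows "opnorm A \<le> (real CARD('n))\<^sup>2 * B"
proof -
  have "opnorm A \<le> (\<Sum>i\<in>(UNIV::'n set). \<Sum>j\<in>(UNIV::'n set). B)"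
    by (rule order_trans[OF opnorm_le_sum]) (intro sum_mono assms)
  then show ?thesis by (simp add: power2_eq_square mult.assoc)
qed

lemma opnorm_mat_le: "opnorm (mat c :: complex^'n^'n) \<le> norm c"
  unfolding opnorm_def
proof (rule onorm_le)
  fix x :: "complex^'n"
  have "mat c *v x = c *s x"
    by (simp add: vec_eq_iff matrix_vector_mult_def mat_def if_distrib[of "\<lambda>a. a * _"] cong: if_cong)
  then show "norm (mat c *v x) \<le> norm c * norm x"
    by (simp add: norm_vec_def L2_set_def norm_mult power_mult_distrib real_sqrt_mult flip: sum_distrib_left)
qed

text \<open>Gives the measurability of the norms of boundary values in \<open>cond_beta\<close>. The
  triangle inequality for \<open>onorm\<close> and the entrywise bound make \<open>opnorm\<close>
  Lipschitz in the entries.\<close>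

lemma continuous_on_opnorm: "continuous_on UNIV (opnorm :: complex^'n^'n \<Rightarrow> real)"
  unfolding continuous_on_def
proof safe
  fix A :: "complex^'n^'n"
  have tri: "opnorm B \<le> opnorm C + opnorm (B - C)" for B C :: "complex^'n^'n"
  proof -
    have "(\<lambda>x. B *v x) = (\<lambda>x. C *v x + (B - C) *v x)"
      by (simp add: matrix_vector_mult_diff_rdistrib)
    then show ?thesis
      unfolding opnorm_def
      using onorm_triangle[OF bounded_linear_matrix_vector_mult[of C] bounded_linear_matrix_vector_mult[of "B - C"]] by simp
  qed
  have le: "norm (opnorm B - opnorm A) \<le> (\<Sum>i\<in>UNIV. \<Sum>j\<in>UNIV. norm (B $ i $ j - A $ i $ j))" for B
  proof -
    have "norm (opnorm B - opnorm A) \<le> max (opnorm (B - A)) (opnorm (A - B))"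
      using tri[of A B] tri[of B A] by (simp add: abs_le_iff max_def)
    also have "\<dots> \<le> (\<Sum>i\<in>UNIV. \<Sum>j\<in>UNIV. norm (B $ i $ j - A $ i $ j))"
      using opnorm_le_sum[of "B - A"] opnorm_le_sum[of "A - B"] by (simp add: norm_minus_commute)
    finally show ?thesis .
  qed
  have "((\<lambda>B. \<Sum>i\<in>UNIV. \<Sum>j\<in>UNIV. norm (B $ i $ j - A $ i $ j)) \<longlongrightarrow>
      (\<Sum>i\<in>(UNIV::'n set). \<Sum>j\<in>(UNIV::'n set). norm (A $ i $ j - A $ i $ j))) (at A)"
    by (intro tendsto_intros)
  then have "((\<lambda>B. \<Sum>i\<in>UNIV. \<Sum>j\<in>UNIV. norm (B $ i $ j - A $ i $ j)) \<longlongrightarrow> 0) (at A)" by simp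
  then have "((\<lambda>B. opnorm B - opnorm A) \<longlongrightarrow> 0) (at A)"
    by (rule Lim_null_comparison[OF always_eventually[OF allI[OF le]]])
  then show "(opnorm \<longlongrightarrow> opnorm A) (at A)"
    by (rule LIM_zero_cancel)
qed

lemma norm_det_le:
  fixes A :: "complex^'n^'n"
  assumes "\<And>i j. norm (A $ i $ j) \<le> B"
  shows "norm (det A) \<le> fact CARD('n) * B ^ CARD('n)"
proof -
  have "norm (det A) \<le> (\<Sum>p\<in>{p. p permutes (UNIV::'n set)}. norm (of_int (sign p) * (\<Prod>i\<in>UNIV. A $ i $ p i)))"
    unfolding det_def by (rule norm_sum)
  also have "\<dots> \<le> (\<Sum>p\<in>{p. p permutes (UNIV::'n set)}. B ^ CARD('n))"
  proof (rule sum_mono)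
    fix p :: "'n \<Rightarrow> 'n"
    have "norm (of_int (sign p) :: complex) = 1"
      by (simp add: sign_def)
    then have "norm (of_int (sign p) * (\<Prod>i\<in>UNIV. A $ i $ p i)) = (\<Prod>i\<in>UNIV. norm (A $ i $ p i))"
      by (simp only: norm_mult prod_norm mult_1)
    also have "\<dots> \<le> (\<Prod>i\<in>(UNIV::'n set). B)"
      by (intro prod_mono) (auto simp: assms)
    finally show "norm (of_int (sign p) * (\<Prod>i\<in>UNIV. A $ i $ p i)) \<le> B ^ CARD('n)" by simp
  qed
  also have "\<dots> = fact CARD('n) * B ^ CARD('n)"
    by (simp add: card_permutations)
  finally show ?thesis .
qed

lemma tendsto_det:
  fixes F :: "'b \<Rightarrow> complex^'n^'n"
  assumes "(F \<longlongrightarrow> A) S"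
  shows "((\<lambda>x. det (F x)) \<longlongrightarrow> det A) S"
  unfolding det_def by (intro tendsto_intros assms)

lemma holomorphic_on_det:
  fixes F :: "complex \<Rightarrow> complex^'n^'n"
  assumes "\<And>i j. (\<lambda>z. F z $ i $ j) holomorphic_on S"
  shows "(\<lambda>z. det (F z)) holomorphic_on S"
  unfolding det_def by (intro holomorphic_intros assms)

text \<open>The matrix in Cramer's rule for the equation \<open>A x = axis j 1\<close>; its determinant is the
  \<open>(i, j)\<close> entry of the adjugate of \<open>A\<close>.\<close>

definition replace_column :: "'n \<Rightarrow> 'n \<Rightarrow> complex^'n^'n \<Rightarrow> complex^'n^'n" where
  "replace_column i j A = (\<chi> a b. if b = i then axis j 1 $ a else A $ a $ b)"

text \<open>By Cramer's rule column \<open>j\<close> solves \<open>A x = c axis j 1\<close>. Writing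
  the multiple \<open>c\<close> of the inverse by explicit entries makes holomorphy, bounds and
  radial limits accessible entry by entry.\<close>

lemma matrix_mult_adjugate:
  fixes A :: "complex^'n^'n"
  assumes "det A \<noteq> 0"
  shows "A ** (\<chi> i j. c * det (replace_column i j A) / det A) = mat c"
proof -
  have col: "A *v (\<chi> i. det (replace_column i j A) / det A) = axis j 1" for j
    using cramer[OF assms, of "\<chi> i. det (replace_column i j A) / det A" "axis j 1"]
    by (simp add: replace_column_def)
  have "(\<Sum>k\<in>UNIV. A $ a $ k * (c * det (replace_column k j A) / det A)) = c * (if a = j then 1 else 0)" for a j
  proof -
    have "(\<Sum>k\<in>UNIV. A $ a $ k * (c * det (replace_column k j A) / det A)) =
        c * (A *v (\<chi> i. det (replace_column i j A) / det A)) $ a"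
      by (simp add: matrix_vector_mult_def sum_distrib_left mult_ac)
    then show ?thesis unfolding col by (simp add: axis_def eq_commute)
  qed
  then show ?thesis
    by (auto simp: matrix_matrix_mult_def mat_def vec_eq_iff)
qed

lemma norm_det_replace_column_le:
  fixes A :: "complex^'n^'n"
  assumes "\<And>i j. norm (A $ i $ j) \<le> B" "1 \<le> B"
  shows "norm (det (replace_column i j A)) \<le> fact CARD('n) * B ^ CARD('n)"
proof (rule norm_det_le)
  show "norm (replace_column i j A $ a $ b) \<le> B" for a b
    using assms by (auto simp: replace_column_def axis_def)
qed

lemma tendsto_replace_column:
  fixes F :: "'b \<Rightarrow> complex^'n^'n"
  assumes "(F \<longlongrightarrow> A) S"
  shows "((\<lambda>x. replace_column i j (F x)) \<longlongrightarrow> replace_column i j A) S"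
proof -
  have "((\<lambda>x. if b = i then axis j 1 $ a else F x $ a $ b) \<longlongrightarrow> (if b = i then axis j 1 $ a else A $ a $ b)) S" for a b
    by (cases "b = i") (auto intro!: tendsto_intros assms)
  then show ?thesis
    unfolding replace_column_def by (intro tendsto_vec_lambda)
qed

lemma tendsto_mat:
  fixes c :: "'b \<Rightarrow> complex"
  assumes "(c \<longlongrightarrow> a) S"
  shows "((\<lambda>x. mat (c x) :: complex^'n^'n) \<longlongrightarrow> mat a) S"
proof -
  have "((\<lambda>x. if i = j then c x else 0) \<longlongrightarrow> (if i = j then a else 0)) S" for i j :: 'n
    using assms by simp
  then show ?thesis
    unfolding mat_def by (intro tendsto_vec_lambda)
qed

section \<open>Boundary values of matrix functions\<close>

lemma boundary_value_eq_radial_limit: "boundary_value = radial_limit"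
  by (intro ext) (simp add: boundary_value_def radial_limit_def)

lemma continuous_on_matrix_holomorphic:
  assumes "matrix_holomorphic F"
  shows "continuous_on unit_disc F"
proof -
  have "continuous_on unit_disc (\<lambda>z. \<chi> i j. F z $ i $ j)"
    using assms by (intro continuous_on_vec_lambda holomorphic_on_imp_continuous_on) (simp add: matrix_holomorphic_def)
  then show ?thesis by simp
qed

lemma borel_measurable_boundary_value:
  assumes "matrix_holomorphic F"
  shows "boundary_value F \<in> borel_measurable \<mu>"
  unfolding boundary_value_eq_radial_limit
  by (intro borel_measurable_radial_limit continuous_on_matrix_holomorphic assms)

lemma boundary_value_AE:
  fixes F :: "complex \<Rightarrow> complex^'n^'n"
  assumes "\<And>i j. scalar_smirnov (\<lambda>z. F z $ i $ j)"
  shows "AE t in \<mu>. has_radial_limit F t (boundary_value F t)"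
proof -
  have "AE t in \<mu>. \<forall>i j. \<exists>l. has_radial_limit (\<lambda>z. F z $ i $ j) t l"
    unfolding AE_all_countable by (intro allI smirnov_radial_limit assms)
  then show ?thesis
  proof eventually_elim
    case (elim t)
    then obtain l where l: "\<And>i j. ((\<lambda>r. F (of_real r * t) $ i $ j) \<longlongrightarrow> l i j) (at_left 1)"
      unfolding has_radial_limit_def by metis
    have "((\<lambda>r. \<chi> i j. F (of_real r * t) $ i $ j) \<longlongrightarrow> (\<chi> i j. l i j)) (at_left 1)"
      by (intro tendsto_vec_lambda l)
    then have "has_radial_limit F t (\<chi> i j. l i j)"
      by (simp add: has_radial_limit_def)
    then show ?case
      using radial_limit_eqI unfolding boundary_value_eq_radial_limit by metis
  qed
qed

lemma has_radial_limit_det: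
  fixes F :: "complex \<Rightarrow> complex^'n^'n"
  shows "has_radial_limit F t A \<Longrightarrow> has_radial_limit (\<lambda>z. det (F z)) t (det A)"
  unfolding has_radial_limit_def by (rule tendsto_det)

text \<open>Under the logarithm the power becomes the factor \<open>p\<close> and \<open>K\<close>
  an additive constant. Entries are the case \<open>p = 1\<close>, the determinant the case
  \<open>p = CARD('n)\<close>.\<close>

lemma scalar_smirnov_dominated:
  fixes E :: "complex \<Rightarrow> complex^'n^'n"
  assumes E: "E \<in> smirnov_class" and g: "g holomorphic_on unit_disc"
    and K: "1 \<le> K" and le: "\<And>z. z \<in> unit_disc \<Longrightarrow> norm (g z) \<le> K * max 1 (opnorm (E z)) ^ p"
  shows "scalar_smirnov g"
  unfolding scalar_smirnov_def
proof (rule conjI[OF g], rule uniformly_integrable_dominated)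
  show "uniformly_integrable {0..<1} (\<lambda>r t. ln_plus (opnorm (E (complex_of_real r * t))))"
    using E by (simp add: smirnov_class_def)
  show "integrable \<mu> (\<lambda>t. ln K)" by simp
  fix r :: real
  assume r: "r \<in> {0..<1}"
  show "(\<lambda>t. ln_plus (norm (g (complex_of_real r * t)))) \<in> borel_measurable \<mu>"
    using r by (intro borel_measurable_circleI continuous_intros continuous_on_circle_dilate g) auto
  show "AE t in \<mu>. \<bar>ln_plus (norm (g (complex_of_real r * t)))\<bar> \<le>
      real p * \<bar>ln_plus (opnorm (E (complex_of_real r * t)))\<bar> + ln K"
  proof (rule AE_I2)
    fix t assume "t \<in> space \<mu>"
    then have z: "complex_of_real r * t \<in> unit_disc" (is "?z \<in> _") using r by (intro dilate_in_disc) auto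
    have 1: "1 \<le> K * max 1 (opnorm (E ?z)) ^ p"
      using K mult_mono[of 1 K 1 "max 1 (opnorm (E ?z)) ^ p"] by simp
    have "ln (max 1 (norm (g ?z))) \<le> ln (K * max 1 (opnorm (E ?z)) ^ p)"
      using 1 le[OF z] by (subst ln_le_cancel_iff) auto
    also have "\<dots> = ln K + ln (max 1 (opnorm (E ?z)) ^ p)"
      using K by (intro ln_mult_pos) auto
    also have "ln (max 1 (opnorm (E ?z)) ^ p) = real p * ln_plus (opnorm (E ?z))"
      by (subst ln_realpow) (auto simp: ln_plus_def)
    finally show "\<bar>ln_plus (norm (g ?z))\<bar> \<le> real p * \<bar>ln_plus (opnorm (E ?z))\<bar> + ln K"
      using ln_plus_nonneg[of "norm (g ?z)"] ln_plus_nonneg[of "opnorm (E ?z)"] by (simp add: ln_plus_def)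
  qed
qed simp

lemma
  fixes E :: "complex \<Rightarrow> complex^'n^'n"
  assumes E: "E \<in> smirnov_class"
  shows scalar_smirnov_entry: "scalar_smirnov (\<lambda>z. E z $ i $ j)"
    and scalar_smirnov_det: "scalar_smirnov (\<lambda>z. det (E z))"
proof -
  have hol: "(\<lambda>z. E z $ i $ j) holomorphic_on unit_disc" for i j
    using E by (simp add: smirnov_class_def matrix_holomorphic_def)
  have le: "norm (E z $ i $ j) \<le> max 1 (opnorm (E z))" for z i j
    using norm_entry_le_opnorm[of "E z" i j] by simp
  show "scalar_smirnov (\<lambda>z. E z $ i $ j)"
    by (rule scalar_smirnov_dominated[OF E hol order_refl, where p = 1]) (use le in simp)
  show "scalar_smirnov (\<lambda>z. det (E z))"
    by (rule scalar_smirnov_dominated[OF E holomorphic_on_det[OF hol], where K = "fact CARD('n)" and p = "CARD('n)"])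
       (auto intro!: norm_det_le le simp: fact_ge_1)
qed

section \<open>Part (ii): reduction to determinants\<close>

lemma outer_if_matrix_approximate_inverse:
  fixes E :: "complex \<Rightarrow> complex^'n^'n"
  assumes E: "E \<in> smirnov_class" and F: "\<And>k. F k \<in> H_infinity"
    and \<alpha>: "cond_alpha E F" and \<beta>: "cond_beta F"
  shows "outer (\<lambda>z. det (E z))"
proof -
  let ?n = "CARD('n)"
  have "\<forall>k. \<exists>M. \<forall>z\<in>unit_disc. opnorm (F k z) \<le> M"
    using F by (simp add: H_infinity_def)
  then obtain M where "\<And>k z. z \<in> unit_disc \<Longrightarrow> opnorm (F k z) \<le> M k" by metis
  then have M: "norm (F k z $ i $ j) \<le> M k" if "z \<in> unit_disc" for k z i j
    using norm_entry_le_opnorm order_trans that by blast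
  have hol: "(\<lambda>z. F k z $ i $ j) holomorphic_on unit_disc" for k i j
    using F[of k] by (simp add: H_infinity_def matrix_holomorphic_def)
  have rE: "AE t in \<mu>. has_radial_limit E t (boundary_value E t)"
    by (intro boundary_value_AE scalar_smirnov_entry E)
  have rF: "AE t in \<mu>. \<forall>k. has_radial_limit (F k) t (boundary_value (F k) t)"
    unfolding AE_all_countable by (intro allI boundary_value_AE smirnov_if_bounded[OF hol M])
  have detF: "AE t in \<mu>. \<forall>k. radial_limit (\<lambda>z. det (F k z)) t = det (boundary_value (F k) t)"
    using rF by eventually_elim (blast intro: radial_limit_eqI has_radial_limit_det)
  show ?thesis
  proof (rule outer_if_approximate_inverse)
    show "scalar_smirnov (\<lambda>z. det (E z))" by (rule scalar_smirnov_det[OF E])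
    show "(\<lambda>z. det (F k z)) holomorphic_on unit_disc" for k
      by (rule holomorphic_on_det[OF hol])
    show "norm (det (F k z)) \<le> fact ?n * M k ^ ?n" if "z \<in> unit_disc" for k z
      by (rule norm_det_le[OF M[OF that]])
    show "AE t in \<mu>. (\<lambda>k. radial_limit (\<lambda>z. det (E z)) t * radial_limit (\<lambda>z. det (F k z)) t) \<longlonglongrightarrow> 1"
      using \<alpha>[unfolded cond_alpha_def] rE detF
    proof eventually_elim
      case (elim t)
      have "radial_limit (\<lambda>z. det (E z)) t = det (boundary_value E t)"
        by (intro radial_limit_eqI has_radial_limit_det elim)
      moreover have "(\<lambda>k. det (boundary_value E t ** boundary_value (F k) t)) \<longlonglongrightarrow> det (mat 1 :: complex^'n^'n)"
        by (rule tendsto_det[OF elim(1)])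
      ultimately show ?case using elim(3) by (simp add: det_mul)
    qed
    show "uniformly_integrable UNIV (\<lambda>k t. ln_plus (norm (radial_limit (\<lambda>z. det (F k z)) t)))"
    proof (rule uniformly_integrable_dominated[OF \<beta>[unfolded cond_beta_def]])
      show "0 \<le> real ?n" by simp
      show "integrable \<mu> (\<lambda>t. ln (fact ?n))" by simp
      fix k :: nat
      have "radial_limit (\<lambda>z. det (F k z)) \<in> borel_measurable \<mu>"
        by (intro borel_measurable_radial_limit holomorphic_on_imp_continuous_on holomorphic_on_det hol)
      then show "(\<lambda>t. ln_plus (norm (radial_limit (\<lambda>z. det (F k z)) t))) \<in> borel_measurable \<mu>"
        by measurable
      show "AE t in \<mu>. \<bar>ln_plus (norm (radial_limit (\<lambda>z. det (F k z)) t))\<bar> \<le>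
          real ?n * \<bar>ln_plus (opnorm (boundary_value (F k) t))\<bar> + ln (fact ?n)"
        using detF
      proof eventually_elim
        case (elim t)
        \<comment> \<open>The Leibniz bound on the determinant uses \<open>?m\<close> in place of
          the norm, so that the logarithm of the power is exactly a multiple of
          \<open>ln_plus\<close>.\<close>
        let ?m = "max 1 (opnorm (boundary_value (F k) t))"
        have "norm (det (boundary_value (F k) t)) \<le> fact ?n * ?m ^ ?n"
          by (rule norm_det_le) (meson max.cobounded2 norm_entry_le_opnorm order_trans)
        moreover have "1 \<le> fact ?n * ?m ^ ?n"
          using mult_mono[of 1 "fact ?n" 1 "?m ^ ?n"] by (simp add: fact_ge_1)
        ultimately have "ln (max 1 (norm (det (boundary_value (F k) t)))) \<le> ln (fact ?n * ?m ^ ?n)"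
          by (subst ln_le_cancel_iff) auto
        also have "\<dots> = ln (fact ?n) + ln (?m ^ ?n)"
          by (intro ln_mult_pos) auto
        also have "ln (?m ^ ?n) = real ?n * ln_plus (opnorm (boundary_value (F k) t))"
          by (subst ln_realpow) (auto simp: ln_plus_def)
        finally have "ln_plus (norm (det (boundary_value (F k) t))) \<le> real ?n * ln_plus (opnorm (boundary_value (F k) t)) + ln (fact ?n)"
          by (simp add: ln_plus_def)
        then show ?case using elim by (simp add: ln_plus_nonneg)
      qed
    qed
  qed
qed

section \<open>Part (i): construction of the approximate inverses\<close>

lemma smirnov_entry_bounds:
  fixes E :: "complex \<Rightarrow> complex^'n^'n"
  assumes E: "E \<in> smirnov_class"
  obtains q where "integrable \<mu> q" "\<And>t. 0 \<le> q t"
    "\<And>z i j. z \<in> unit_disc \<Longrightarrow> norm (E z $ i $ j) \<le> exp (poisson q z)"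
    "AE t in \<mu>. \<forall>i j. norm (boundary_value E t $ i $ j) \<le> exp (q t)"
proof
  let ?l = "\<lambda>i j t. ln_plus (norm (radial_limit (\<lambda>z. E z $ i $ j) t))"
  \<comment> \<open>Summing over all entries gives one function that majorizes every entry, through
    its Poisson integral in the disc and directly on the circle.\<close>
  define q where "q t = (\<Sum>i\<in>UNIV. \<Sum>j\<in>UNIV. ?l i j t)" for t
  note sm = scalar_smirnov_entry[OF E]
  have li: "integrable \<mu> (?l i j)" for i j
    using smirnov_integrable_ln_max[OF sm smirnov_radial_limit[OF sm], of 1 i j] by (simp add: ln_plus_def)
  show qi: "integrable \<mu> q"
    unfolding q_def by (intro Bochner_Integration.integrable_sum li)
  show "0 \<le> q t" for t
    unfolding q_def by (intro sum_nonneg ln_plus_nonneg)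
  have lq: "?l i j t \<le> q t" for i j t
  proof -
    have "?l i j t \<le> (\<Sum>j\<in>UNIV. ?l i j t)"
      by (rule member_le_sum) (auto simp: ln_plus_nonneg)
    also have "\<dots> \<le> q t"
      unfolding q_def
      by (rule member_le_sum[of i UNIV "\<lambda>i. \<Sum>j\<in>UNIV. ?l i j t"]) (auto intro!: sum_nonneg simp: ln_plus_nonneg)
    finally show ?thesis .
  qed
  have le_exp: "x \<le> exp y" if "ln (max 1 x) \<le> y" for x y :: real
  proof -
    have "max 1 x = exp (ln (max 1 x))" by simp
    also have "\<dots> \<le> exp y" using that by (simp only: exp_le_cancel_iff)
    finally show ?thesis by simp
  qed
  show "norm (E z $ i $ j) \<le> exp (poisson q z)" if z: "z \<in> unit_disc" for z i j
  proof (rule le_exp)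
    have "ln (max 1 (norm (E z $ i $ j))) \<le> poisson (?l i j) z"
      using smirnov_ln_max_le[OF sm smirnov_radial_limit[OF sm] zero_less_one order_refl z, of i j] by (simp add: ln_plus_def)
    also have "\<dots> \<le> poisson q z"
      using lq by (intro poisson_mono_AE z li qi AE_I2)
    finally show "ln (max 1 (norm (E z $ i $ j))) \<le> poisson q z" .
  qed
  show "AE t in \<mu>. \<forall>i j. norm (boundary_value E t $ i $ j) \<le> exp (q t)"
    using boundary_value_AE[of E, OF sm]
  proof eventually_elim
    case (elim t)
    have "radial_limit (\<lambda>z. E z $ i $ j) t = boundary_value E t $ i $ j" for i j
      using elim unfolding has_radial_limit_def
      by (intro radial_limit_eqI) (simp add: has_radial_limit_def tendsto_vec_nth)
    then show ?case
      using lq[of _ _ t] by (auto intro!: le_exp simp: ln_plus_def)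
  qed
qed

lemma outer_class_approximate_inverse:
  fixes E :: "complex \<Rightarrow> complex^'n^'n"
  assumes "E \<in> outer_class"
  shows "\<exists>F. (\<forall>k. F k \<in> H_infinity) \<and> cond_alpha E F \<and> cond_beta F \<and> cond_gamma E F"
proof -
  let ?n = "CARD('n)"
  let ?N = "real CARD('n)"
  have E: "E \<in> smirnov_class" and out: "outer (\<lambda>z. det (E z))"
    using assms by (auto simp: outer_class_def)
  have holE: "(\<lambda>z. E z $ i $ j) holomorphic_on unit_disc" for i j
    using E by (simp add: smirnov_class_def matrix_holomorphic_def)
  define e where "e z = det (E z)" for z
  have sme: "scalar_smirnov e"
    unfolding e_def by (rule scalar_smirnov_det[OF E])
  obtain C w where C: "norm C = 1" and lwi: "integrable \<mu> (\<lambda>t. ln (w t :: real))"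
    and ez: "\<And>z. z \<in> unit_disc \<Longrightarrow> e z = C * exp (LINT t|\<mu>. (t + z) / (t - z) * complex_of_real (ln (w t)))"
    using out unfolding outer_def e_def by blast
  define lw where "lw t = ln (w t)" for t
  have lwi: "integrable \<mu> lw"
    using lwi by (simp add: lw_def[abs_def])
  \<comment> \<open>The Smirnov inequality bounds \<open>norm (e z)\<close> only from above; the
    equality given by outerness bounds \<open>1 / e\<close>.\<close>
  have ne: "norm (e z) = exp (poisson lw z)" if z: "z \<in> unit_disc" for z
  proof -
    have "e z = C * exp (herglotz lw z)"
      unfolding ez[OF z] herglotz_def herglotz_kernel_def lw_def ..
    then show ?thesis
      using C Re_herglotz[OF z lwi] by (simp add: norm_mult)
  qed
  have e0: "e z \<noteq> 0" if "z \<in> unit_disc" for z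
    using ne[OF that] by auto
  obtain q where qi: "integrable \<mu> q" and q0: "\<And>t. 0 \<le> q t"
    and Eq: "\<And>z i j. z \<in> unit_disc \<Longrightarrow> norm (E z $ i $ j) \<le> exp (poisson q z)"
    and Eq': "AE t in \<mu>. \<forall>i j. norm (boundary_value E t $ i $ j) \<le> exp (q t)"
    by (rule smirnov_entry_bounds[OF E]) (rule that; assumption)
  \<comment> \<open>The exponent \<open>y\<close> is left free: it is \<open>poisson q z\<close> in
    the disc and \<open>q t\<close> on the circle.\<close>
  have cofactor: "norm (det (replace_column i j A)) \<le> exp (ln (fact ?n) + ?N * y)"
    if "\<And>i j. norm (A $ i $ j) \<le> exp y" "0 \<le> y" for A :: "complex^'n^'n" and y i j
  proof -
    have "norm (det (replace_column i j A)) \<le> fact ?n * exp y ^ ?n"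
      by (rule norm_det_replace_column_le[OF that(1)]) (use that(2) in auto)
    then show ?thesis by (simp add: exp_add exp_of_nat_mult)
  qed
  \<comment> \<open>The first two terms majorize the logarithm of a cofactor,
    \<open>\<bar>lw t\<bar>\<close> that of \<open>1 / e\<close>; the absolute value also keeps
    \<open>h\<close> nonnegative.\<close>
  define h where "h t = ln (fact ?n) + ?N * q t + \<bar>lw t\<bar>" for t
  have hi: "integrable \<mu> h"
    unfolding h_def using qi lwi by auto
  have h0: "0 \<le> h t" for t
    using q0[of t] by (simp add: h_def)
  \<comment> \<open>The excess of \<open>h\<close> over the level \<open>k\<close>. Its mean tends
    to 0, which brings the outer factors to 1 at the origin.\<close>
  define x where "x k t = max 0 (\<bar>h t\<bar> - real k)" for k t
  have xi: "integrable \<mu> (x k)" for k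
    using hi by (rule Bochner_Integration.integrable_bound) (use hi in \<open>auto simp: x_def[abs_def] max_def\<close>)
  define \<phi> where "\<phi> k z = exp (- herglotz (x k) z)" for k z
  have hol\<phi>: "\<phi> k holomorphic_on unit_disc" for k
    unfolding \<phi>_def by (intro holomorphic_intros holomorphic_herglotz xi)
  have n\<phi>: "norm (\<phi> k z) = exp (- poisson (x k) z)" if "z \<in> unit_disc" for k z
    using Re_herglotz[OF that xi] by (simp add: \<phi>_def)
  have \<phi>1: "norm (\<phi> k z) \<le> 1" if "z \<in> unit_disc" for k z
    using n\<phi>[OF that] poisson_nonneg[OF that, of "x k"] by (simp add: x_def)
  have "(\<lambda>k. \<phi> k 0) \<longlonglongrightarrow> 1"
  proof -
    have "(\<lambda>k. exp (- complex_of_real (LINT t|\<mu>. x k t))) \<longlonglongrightarrow> exp (- complex_of_real 0)"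
      unfolding x_def by (intro tendsto_intros integral_excess_tendsto_0 hi)
    then show ?thesis by (simp add: \<phi>_def herglotz_zero)
  qed
  then obtain s :: "nat \<Rightarrow> nat" where lim\<phi>: "AE t in \<mu>. (\<lambda>k. radial_limit (\<phi> (s k)) t) \<longlonglongrightarrow> 1"
    using radial_limits_subsequence_tendsto_1[of \<phi>, OF hol\<phi> \<phi>1] by blast
  define F where "F k z = (\<chi> i j. \<phi> (s k) z * det (replace_column i j (E z)) / det (E z))" for k z
  have holF: "(\<lambda>z. F k z $ i $ j) holomorphic_on unit_disc" for k i j
  proof -
    have "(\<lambda>z. det (replace_column i j (E z))) holomorphic_on unit_disc"
    proof (rule holomorphic_on_det)
      show "(\<lambda>z. replace_column i j (E z) $ a $ b) holomorphic_on unit_disc" for a b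
        by (cases "b = i") (auto simp: replace_column_def holE)
    qed
    moreover have "(\<lambda>z. det (E z)) holomorphic_on unit_disc"
      by (rule holomorphic_on_det[OF holE])
    ultimately show ?thesis
      unfolding F_def using e0 by (auto intro!: holomorphic_intros hol\<phi> simp: e_def)
  qed
  have Fb: "norm (F k z $ i $ j) \<le> exp (real (s k))" if z: "z \<in> unit_disc" for k z i j
  proof -
    have nqi: "integrable \<mu> (\<lambda>t. ?N * q t)" and ci: "integrable \<mu> (\<lambda>t. ln (fact ?n))"
      using qi by auto
    \<comment> \<open>Subtracting the excess \<open>x (s k)\<close> leaves a function bounded by
      \<open>s k\<close>, and its Poisson integral is the exponent in the estimate of
      \<open>F k\<close>.\<close>
    have "poisson (\<lambda>t. ((ln (fact ?n) + ?N * q t) - lw t) - x (s k) t) z \<le> poisson (\<lambda>t. real (s k)) z"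
    proof (rule poisson_mono_AE[OF z])
      show "integrable \<mu> (\<lambda>t. ((ln (fact ?n) + ?N * q t) - lw t) - x (s k) t)"
        using nqi lwi xi by (intro Bochner_Integration.integrable_diff Bochner_Integration.integrable_add) auto
      show "AE t in \<mu>. ((ln (fact ?n) + ?N * q t) - lw t) - x (s k) t \<le> real (s k)"
      proof (rule AE_I2)
        fix t
        have "ln (fact ?n) + ?N * q t - lw t \<le> \<bar>h t\<bar>"
          using h0[of t] by (simp add: h_def)
        moreover have "\<bar>h t\<bar> - real (s k) \<le> x (s k) t" by (simp add: x_def)
        ultimately show "((ln (fact ?n) + ?N * q t) - lw t) - x (s k) t \<le> real (s k)" by linarith
      qed
    qed simp
    moreover have "poisson (\<lambda>t. ((ln (fact ?n) + ?N * q t) - lw t) - x (s k) t) z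
        = ln (fact ?n) + ?N * poisson q z - poisson lw z - poisson (x (s k)) z"
      using nqi ci lwi xi poisson_const[OF z, of "ln (fact ?n)"]
      by (simp add: poisson_diff[OF z] poisson_add[OF z] poisson_cmult)
    ultimately have p: "ln (fact ?n) + ?N * poisson q z - poisson lw z - poisson (x (s k)) z \<le> real (s k)"
      using poisson_const[OF z] by simp
    have "norm (F k z $ i $ j) = norm (\<phi> (s k) z) * norm (det (replace_column i j (E z))) / norm (e z)"
      by (simp add: F_def e_def norm_mult norm_divide)
    also have "\<dots> \<le> exp (- poisson (x (s k)) z) * exp (ln (fact ?n) + ?N * poisson q z) / exp (poisson lw z)"
      unfolding n\<phi>[OF z] ne[OF z] using poisson_nonneg[OF z q0]
      by (intro divide_right_mono mult_left_mono cofactor Eq z) auto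
    also have "\<dots> = exp (ln (fact ?n) + ?N * poisson q z - poisson lw z - poisson (x (s k)) z)"
      by (simp only: exp_add[symmetric] exp_diff[symmetric]) (simp add: algebra_simps)
    also have "\<dots> \<le> exp (real (s k))"
      using p by simp
    finally show ?thesis .
  qed
  have holF': "matrix_holomorphic (F k)" for k
    using holF by (simp add: matrix_holomorphic_def)
  have FH: "F k \<in> H_infinity" for k
    unfolding H_infinity_def using holF' opnorm_le_entries[OF Fb] by blast
  have r\<phi>: "AE t in \<mu>. \<forall>k. has_radial_limit (\<phi> k) t (radial_limit (\<phi> k) t) \<and> norm (radial_limit (\<phi> k) t) \<le> 1"
    unfolding AE_all_countable
    by (intro allI eventually_conj smirnov_has_radial_limit_AE smirnov_if_bounded[OF hol\<phi> \<phi>1] radial_limit_bounded[OF hol\<phi> \<phi>1])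
  have rE: "AE t in \<mu>. has_radial_limit E t (boundary_value E t)"
    by (intro boundary_value_AE scalar_smirnov_entry E)
  have nz: "AE t in \<mu>. radial_limit e t \<noteq> 0"
    by (rule smirnov_nonzero_AE[OF sme]) (use e0 in simp)
  have bv: "AE t in \<mu>. radial_limit e t = det (boundary_value E t) \<and> det (boundary_value E t) \<noteq> 0 \<and>
      (\<forall>k. boundary_value (F k) t = (\<chi> i j. radial_limit (\<phi> (s k)) t * det (replace_column i j (boundary_value E t)) / det (boundary_value E t)))"
    using rE r\<phi> nz
  proof eventually_elim
    case (elim t)
    have det: "radial_limit e t = det (boundary_value E t)"
      unfolding e_def by (intro radial_limit_eqI has_radial_limit_det elim)
    with elim have nz: "det (boundary_value E t) \<noteq> 0" by simp
    have "boundary_value (F k) t = (\<chi> i j. radial_limit (\<phi> (s k)) t * det (replace_column i j (boundary_value E t)) / det (boundary_value E t))" for k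
      unfolding boundary_value_eq_radial_limit F_def
    proof (rule radial_limit_eqI)
      have lE: "((\<lambda>r. E (of_real r * t)) \<longlongrightarrow> radial_limit E t) (at_left 1)"
        using elim(1) by (simp add: has_radial_limit_def boundary_value_eq_radial_limit)
      have l\<phi>: "((\<lambda>r. \<phi> (s k) (of_real r * t)) \<longlongrightarrow> radial_limit (\<phi> (s k)) t) (at_left 1)"
        using elim(2) by (simp add: has_radial_limit_def)
      show "has_radial_limit (\<lambda>z. \<chi> i j. \<phi> (s k) z * det (replace_column i j (E z)) / det (E z)) t
          (\<chi> i j. radial_limit (\<phi> (s k)) t * det (replace_column i j (radial_limit E t)) / det (radial_limit E t))"
        unfolding has_radial_limit_def
        by (intro tendsto_vec_lambda tendsto_divide tendsto_mult l\<phi> tendsto_det tendsto_replace_column lE)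
           (use nz in \<open>simp add: boundary_value_eq_radial_limit\<close>)
    qed
    with det nz show ?case by blast
  qed
  have prod: "AE t in \<mu>. \<forall>k. boundary_value E t ** boundary_value (F k) t = mat (radial_limit (\<phi> (s k)) t)"
    using bv by eventually_elim (simp add: matrix_mult_adjugate)
  have \<alpha>: "cond_alpha E F"
    unfolding cond_alpha_def using prod lim\<phi>
    by eventually_elim (simp add: tendsto_mat)
  have \<gamma>: "cond_gamma E F"
  proof -
    \<comment> \<open>The quantifier over \<open>k\<close> stands inside, so one null set serves all
      \<open>k\<close>.\<close>
    have "AE t in \<mu>. \<forall>k. opnorm (boundary_value E t ** boundary_value (F k) t) \<le> 1"
      using prod r\<phi>
    proof eventually_elim
      case (elim t)
      then show ?case using opnorm_mat_le order_trans by metis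
    qed
    then obtain B where B: "B \<in> null_sets \<mu>"
      "{t \<in> space \<mu>. \<not> (\<forall>k. opnorm (boundary_value E t ** boundary_value (F k) t) \<le> 1)} \<subseteq> B"
      unfolding eventually_ae_filter by blast
    then show ?thesis
      unfolding cond_gamma_def by (intro bexI[of _ B]) auto
  qed
  have \<beta>: "cond_beta F"
    unfolding cond_beta_def
  proof (rule uniformly_integrable_dominated[OF uniformly_integrable_const_zero order_refl])
    \<comment> \<open>A majorant independent of \<open>k\<close>: the outer factors have boundary
      modulus at most 1 and drop out. The summand \<open>ln (?N\<^sup>2)\<close> comes from
      \<open>opnorm_le_entries\<close>, and the last one from the division by \<open>det E\<close>
      on the circle.\<close>
    let ?H = "\<lambda>t. ln (?N\<^sup>2) + (ln (fact ?n) + ?N * q t) + \<bar>ln (norm (radial_limit e t))\<bar>"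
    have "integrable \<mu> (\<lambda>t. ln (norm (radial_limit e t)))"
      by (rule smirnov_integrable_ln[OF sme]) (use e0 in simp)
    then show "integrable \<mu> ?H"
      using qi by auto
    fix k :: nat
    have "boundary_value (F k) \<in> borel_measurable \<mu>"
      by (rule borel_measurable_boundary_value[OF holF'])
    moreover have "opnorm \<in> borel_measurable (borel :: (complex^'n^'n) measure)"
      by (rule borel_measurable_continuous_onI[OF continuous_on_opnorm])
    ultimately show "(\<lambda>t. ln_plus (opnorm (boundary_value (F k) t))) \<in> borel_measurable \<mu>"
      by measurable
    show "AE t in \<mu>. \<bar>ln_plus (opnorm (boundary_value (F k) t))\<bar> \<le> 0 * \<bar>0\<bar> + ?H t"
      using bv Eq' r\<phi>
    proof eventually_elim
      case (elim t)
      let ?e = "norm (radial_limit e t)"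
      have e': "0 < ?e" using elim(1) by simp
      have "norm (boundary_value (F k) t $ i $ j) \<le> exp (ln (fact ?n) + ?N * q t) / ?e" for i j
      proof -
        have "norm (boundary_value (F k) t $ i $ j) =
            norm (radial_limit (\<phi> (s k)) t) * norm (det (replace_column i j (boundary_value E t))) / ?e"
          using elim(1) by (simp add: norm_mult norm_divide)
        also have "\<dots> \<le> 1 * exp (ln (fact ?n) + ?N * q t) / ?e"
          using elim(2,3) by (intro divide_right_mono mult_mono cofactor q0) auto
        finally show ?thesis by simp
      qed
      then have "opnorm (boundary_value (F k) t) \<le> ?N\<^sup>2 * (exp (ln (fact ?n) + ?N * q t) / ?e)"
        by (rule opnorm_le_entries)
      also have "\<dots> = exp (ln (?N\<^sup>2) + (ln (fact ?n) + ?N * q t) - ln ?e)"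
        using e' by (simp add: exp_add exp_diff)
      also have "\<dots> \<le> exp (?H t)" by simp
      finally have "opnorm (boundary_value (F k) t) \<le> exp (?H t)" .
      \<comment> \<open>\<open>ln_plus\<close> truncates at 1, so the exponential majorant must
        itself be at least 1.\<close>
      moreover have H0: "0 \<le> ?H t"
      proof -
        have "1 \<le> ?N\<^sup>2" by (simp add: one_le_power Suc_le_eq)
        then have "0 \<le> ln (?N\<^sup>2)" by (rule ln_ge_zero)
        moreover have "0 \<le> ln (fact ?n :: real)" by (intro ln_ge_zero fact_ge_1)
        moreover have "0 \<le> ?N * q t" using q0[of t] by simp
        ultimately show ?thesis by linarith
      qed
      ultimately have "max 1 (opnorm (boundary_value (F k) t)) \<le> exp (?H t)" by simp
      then have "ln (max 1 (opnorm (boundary_value (F k) t))) \<le> ln (exp (?H t))"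
        by (subst ln_le_cancel_iff) simp_all
      then have "ln_plus (opnorm (boundary_value (F k) t)) \<le> ?H t"
        by (simp only: ln_plus_def ln_exp)
      then show ?case using ln_plus_nonneg[of "opnorm (boundary_value (F k) t)"] by simp
    qed
  qed
  show ?thesis using FH \<alpha> \<beta> \<gamma> by blast
qed

theorem theorem3p2:
  fixes E :: "complex \<Rightarrow> complex^'n^'n"
  shows "(E \<in> outer_class \<longrightarrow>
            (\<exists>F. (\<forall>k. F k \<in> H_infinity) \<and> cond_alpha E F \<and> cond_beta F \<and> cond_gamma E F)) \<and>
         (E \<in> smirnov_class \<and>
            (\<exists>F. (\<forall>k. F k \<in> H_infinity) \<and> cond_alpha E F \<and> cond_beta F) \<longrightarrow>
          E \<in> outer_class)"
  using outer_class_approximate_inverse[of E] outer_if_matrix_approximate_inverse[of E]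
  unfolding outer_class_def by blast

end
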